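(* Let $X$ be an $n$-dimensional complex submanifold of an open subset $\Omega\subset\mathbb{C}^m$, $n\ge1$. Then there exists a countable union $A$ of thin closed analytic subsets of $X$ such that, for every $a\in X\setminus A$ and every local parametrisation $\Phi$ of $X$ at $a$, $$\alpha(\Phi)\le\dim\overline{X}_a\le m.$$ The set $A$ is of first category in Baire's sense and of Lebesgue measure $0$ in $X$.
   Context: A closed analytic subset of $X$ is thin if it is nowhere dense in $X$. A local parametrisation of $X$ at $a$ is a holomorphic map germ $\Phi=(\Phi_1,\dots,\Phi_m):(\mathbb{C}^n,b)\to(\mathbb{C}^m,a)$ (for some $b\in\mathbb{C}^n$) inducing a biholomorphic germ $(\mathbb{C}^n,b)\to(X,a)$. $\mathbb{C}[x]^d$ is the space of polynomials of degree $\le d$ in $x=(x_1,\dots,x_m)$. The zero-estimate function is $\theta_{\Phi}(d)=\sup\{\mathrm{ord}_b(F\circ\Phi):F\in\mathbb{C}[x]^d,\ F\circ\Phi\neq0\}$, where $\mathrm{ord}_b$ is the vanishing order at $b$, and the transcendency index is $\alpha(\Phi)=\limsup_{d\to\infty}\log_d\theta_\Phi(d)$. $\overline{X}_a$ is the Zariski closure of the germ $X_a$ of $X$ at $a$, i.e. the smallest algebraic subset of $\mathbb{C}^m$ containing some representative of $X_a$. *)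

theory Defs
  imports "HOL-Analysis.Analysis"
begin

section \<open>Holomorphic functions of several variables\<close>

definition complex_differentiable_at :: "(complex^'n \<Rightarrow> complex) \<Rightarrow> complex^'n \<Rightarrow> bool" where
  "complex_differentiable_at f z \<longleftrightarrow>
     (\<exists>D. (f has_derivative D) (at z) \<and> (\<forall>c v. D (c *s v) = c * D v))"

text \<open>
  Functions on a subset \<open>S\<close> of \<open>\<complex>\<^sup>n\<close> are holomorphic if they are locally restrictions of holomorphic
  functions of the ambient space. For open \<open>S\<close> this is ordinary holomorphy, and for a
  submanifold \<open>S\<close> it is holomorphy with respect to the induced complex structure.
\<close>

definition holo_on :: "(complex^'n \<Rightarrow> complex) \<Rightarrow> (complex^'n) set \<Rightarrow> bool" where
  "holo_on f S \<longleftrightarrow>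
     (\<forall>p\<in>S. \<exists>U F. open U \<and> p \<in> U \<and> (\<forall>z\<in>U. complex_differentiable_at F z) \<and>
        (\<forall>z\<in>S \<inter> U. f z = F z))"

definition holo_map_on :: "(complex^'n \<Rightarrow> complex^'m) \<Rightarrow> (complex^'n) set \<Rightarrow> bool" where
  "holo_map_on f S \<longleftrightarrow> (\<forall>i. holo_on (\<lambda>z. f z $ i) S)"

definition biholomorphism ::
    "(complex^'n) set \<Rightarrow> (complex^'m) set \<Rightarrow> (complex^'n \<Rightarrow> complex^'m) \<Rightarrow> (complex^'m \<Rightarrow> complex^'n) \<Rightarrow> bool"
  where
  "biholomorphism S T f g \<longleftrightarrow>
     holo_map_on f S \<and> holo_map_on g T \<and> f ` S = T \<and> g ` T = S \<and>
     (\<forall>x\<in>S. g (f x) = x) \<and> (\<forall>y\<in>T. f (g y) = y)"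


section \<open>Submanifolds and their analytic subsets\<close>

text \<open>
  Submanifolds are embedded, of pure dimension \<open>k\<close>, not necessarily connected or closed in \<open>\<Omega>\<close>.
  (A submanifold in this sense is a closed submanifold of some open subset of \<open>\<Omega>\<close>.)
\<close>

definition complex_submanifold :: "nat \<Rightarrow> (complex^'m) set \<Rightarrow> (complex^'m) set \<Rightarrow> bool" where
  "complex_submanifold k \<Omega> X \<longleftrightarrow>
     X \<subseteq> \<Omega> \<and>
     (\<forall>a\<in>X. \<exists>U V (f :: complex^'m \<Rightarrow> complex^'m) g L.
        open U \<and> a \<in> U \<and> U \<subseteq> \<Omega> \<and> open V \<and> biholomorphism U V f g \<and>
        vec.subspace L \<and> vec.dim L = k \<and> f ` (X \<inter> U) = L \<inter> V)"

definition closed_analytic_subset :: "(complex^'m) set \<Rightarrow> (complex^'m) set \<Rightarrow> bool" where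
  "closed_analytic_subset X T \<longleftrightarrow>
     closedin (top_of_set X) T \<and>
     (\<forall>a\<in>X. \<exists>U G. open U \<and> a \<in> U \<and> finite G \<and> (\<forall>g\<in>G. holo_on g (X \<inter> U)) \<and>
        T \<inter> U = {z \<in> X \<inter> U. \<forall>g\<in>G. g z = 0})"

definition nowhere_dense_in :: "'a topology \<Rightarrow> 'a set \<Rightarrow> bool" where
  "nowhere_dense_in X T \<longleftrightarrow> T \<subseteq> topspace X \<and> X interior_of (X closure_of T) = {}"

definition first_category_in :: "'a topology \<Rightarrow> 'a set \<Rightarrow> bool" where
  "first_category_in X A \<longleftrightarrow>
     (\<exists>\<N>. countable \<N> \<and> (\<forall>T\<in>\<N>. nowhere_dense_in X T) \<and> A = \<Union>\<N>)"

definition thin_analytic_subset :: "(complex^'m) set \<Rightarrow> (complex^'m) set \<Rightarrow> bool" where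
  "thin_analytic_subset X T \<longleftrightarrow>
     closed_analytic_subset X T \<and> nowhere_dense_in (top_of_set X) T"

definition parametrisation ::
    "(complex^'m) set \<Rightarrow> (complex^'n) set \<Rightarrow> (complex^'n \<Rightarrow> complex^'m) \<Rightarrow> bool" where
  "parametrisation X W \<Phi> \<longleftrightarrow>
     open W \<and> openin (top_of_set X) (\<Phi> ` W) \<and> (\<exists>\<Psi>. biholomorphism W (\<Phi> ` W) \<Phi> \<Psi>)"

text \<open>The germ at \<open>b\<close> is represented by a total function whose values far from \<open>b\<close> are irrelevant.\<close>

definition local_parametrisation ::
    "(complex^'m) set \<Rightarrow> complex^'m \<Rightarrow> complex^'n \<Rightarrow> (complex^'n \<Rightarrow> complex^'m) \<Rightarrow> bool" where
  "local_parametrisation X a b \<Phi> \<longleftrightarrow> \<Phi> b = a \<and> (\<exists>W. b \<in> W \<and> parametrisation X W \<Phi>)"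

text \<open>
  Lebesgue null sets of a submanifold of dimension \<open>CARD('n)\<close>, tested in all holomorphic
  parametrisations. The type argument only supplies the dimension.
\<close>

definition lebesgue_null_in ::
    "'n::finite itself \<Rightarrow> (complex^'m) set \<Rightarrow> (complex^'m) set \<Rightarrow> bool" where
  "lebesgue_null_in _ X A \<longleftrightarrow>
     A \<subseteq> X \<and>
     (\<forall>W (\<Phi> :: complex^'n \<Rightarrow> complex^'m). parametrisation X W \<Phi> \<longrightarrow>
        {z \<in> W. \<Phi> z \<in> A} \<in> null_sets lebesgue)"


section \<open>Polynomials and algebraic sets\<close>

text \<open>
  Polynomials are identified with the functions they define; exponents of monomials are functions
  \<open>'m \<Rightarrow> nat\<close>.
\<close>

definition polys_upto :: "nat \<Rightarrow> (complex^'m \<Rightarrow> complex) set" where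
  "polys_upto d =
     {F. \<exists>c. F = (\<lambda>x. \<Sum>\<nu> | sum \<nu> UNIV \<le> d. c \<nu> * (\<Prod>i\<in>UNIV. x $ i ^ \<nu> i))}"

text \<open>The sum above is not vacuous:\<close>

lemma finite_exponents_upto: "finite {\<nu> :: 'm::finite \<Rightarrow> nat. sum \<nu> UNIV \<le> d}"
proof (rule finite_subset)
  show "{\<nu> :: 'm \<Rightarrow> nat. sum \<nu> UNIV \<le> d} \<subseteq> (\<Pi>\<^sub>E i\<in>UNIV. {..d})"
  proof
    fix \<nu> :: "'m \<Rightarrow> nat" assume "\<nu> \<in> {\<nu>. sum \<nu> UNIV \<le> d}"
    moreover have "\<nu> i \<le> sum \<nu> UNIV" for i
      by (rule member_le_sum) simp_all
    ultimately have "\<nu> i \<le> d" for i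
      using order_trans by blast
    then show "\<nu> \<in> (\<Pi>\<^sub>E i\<in>UNIV. {..d})"
      by (simp add: PiE_iff)
  qed
  show "finite ((\<Pi>\<^sub>E i\<in>UNIV. {..d}) :: ('m \<Rightarrow> nat) set)"
    by (rule finite_PiE) simp_all
qed

definition algebraic_set :: "(complex^'m) set \<Rightarrow> bool" where
  "algebraic_set Z \<longleftrightarrow> (\<exists>S \<subseteq> (\<Union>d. polys_upto d). Z = {x. \<forall>F\<in>S. F x = 0})"

definition zariski_closure_germ :: "(complex^'m) set \<Rightarrow> complex^'m \<Rightarrow> (complex^'m) set" where
  "zariski_closure_germ X a =
     (LEAST Z. algebraic_set Z \<and> (\<exists>U. open U \<and> a \<in> U \<and> X \<inter> U \<subseteq> Z))"

text \<open>The dimension of a nonempty analytic set: the largest dimension at a regular point.\<close>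

definition analytic_dim :: "(complex^'m) set \<Rightarrow> nat" where
  "analytic_dim Z =
     Sup {k. \<exists>p U. open U \<and> p \<in> Z \<inter> U \<and> complex_submanifold k U (Z \<inter> U)}"


section \<open>Vanishing order, zero-estimate function and transcendency index\<close>

definition partial_deriv :: "'n \<Rightarrow> (complex^'n \<Rightarrow> complex) \<Rightarrow> complex^'n \<Rightarrow> complex" where
  "partial_deriv i f z = deriv (\<lambda>t. f (z + axis i t)) 0"

text \<open>
  The least order of an iterated partial derivative (\<open>is\<close> lists the indices of differentiation)
  that does not vanish at \<open>b\<close>; it is \<open>\<infinity>\<close> if they all vanish.
\<close>

definition vanishing_order :: "complex^'n \<Rightarrow> (complex^'n \<Rightarrow> complex) \<Rightarrow> enat" where
  "vanishing_order b f = Inf {enat (length is) | is. foldr partial_deriv is f b \<noteq> 0}"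

text \<open>The condition \<open>F \<circ> \<Phi> \<noteq> 0\<close> is understood for germs at \<open>b\<close>.\<close>

definition zero_estimate :: "complex^'n \<Rightarrow> (complex^'n \<Rightarrow> complex^'m) \<Rightarrow> nat \<Rightarrow> enat" where
  "zero_estimate b \<Phi> d =
     Sup {vanishing_order b (F \<circ> \<Phi>) | F.
            F \<in> polys_upto d \<and> \<not> (\<forall>\<^sub>F z in nhds b. (F \<circ> \<Phi>) z = 0)}"

definition log_enat :: "nat \<Rightarrow> enat \<Rightarrow> ereal" where
  "log_enat d t =
     (case t of enat k \<Rightarrow> if k = 0 then -\<infinity> else ereal (log (real d) (real k)) | \<infinity> \<Rightarrow> \<infinity>)"

definition transcendency_index :: "complex^'n \<Rightarrow> (complex^'n \<Rightarrow> complex^'m) \<Rightarrow> ereal" where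
  "transcendency_index b \<Phi> = limsup (\<lambda>d. log_enat d (zero_estimate b \<Phi> d))"

end

(*
  Generalised Wronskians bound vanishing orders: if N holomorphic functions are linearly independent,
  then no nonzero combination of them vanishes to order N at a generic point. Applied to a finite
  set B of monomials that are independent on X near a point, this gives the exceptional set of B,
  locally the common zero set of the maximal minors of a jet matrix; A is the union over all B.
  Outside A the zero-estimate function in degree d is at most the dimension of the space of
  polynomials of degree at most d restricted to X near a. If k coordinates form a transcendence basis
  of the coordinate functions on X near a, this dimension is O(d^k), and at a generic point of X
  the Zariski closure is a graph over these k coordinates, so k is at most its dimension.
*)

theory Submission
  imports Defs "HOL-Complex_Analysis.Conformal_Mappings" "Jordan_Normal_Form.Determinant"
begin

text \<open>Holomorphy is given as complex differentiability at each point, and the facts in several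
  variables are drawn from one variable by restriction to complex lines. The order of vanishing is
  phrased metrically, so that it lives on \<open>X\<close> itself. The exceptional sets are indexed
  by sets \<open>B\<close> of monomials and not by degrees, since \<open>X\<close> may be
  disconnected: a monomial basis of the germs of polynomials of degree at most \<open>d\<close> may
  change from component to component. Each \<open>B\<close> counts only where it is independent, and
  there are countably many of them. Function fields are avoided: instead of dividing by the leading
  coefficients of the equations for the remaining coordinates, polynomials are multiplied by powers
  of their product. In degree \<open>d\<close> this costs a degree linear in \<open>d\<close>, which
  leaves the exponent of growth unchanged. The dimension of the closure is a supremum over its
  regular points, so one regular point of local dimension \<open>k\<close> is enough, and it need
  not be \<open>a\<close>. In the upper limit the constant factor of \<open>d^k\<close>
  disappears.\<close>

no_notation Matrix.vec_index (infixl \<open>$\<close> 100)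
no_notation Matrix.scalar_prod (infix \<open>\<bullet>\<close> 70)

lemmas cart_eq_iff = Finite_Cartesian_Product.vec_eq_iff

section \<open>Holomorphic functions of several variables\<close>

definition has_cderiv :: "(complex^'n \<Rightarrow> complex) \<Rightarrow> (complex^'n \<Rightarrow> complex) \<Rightarrow> complex^'n \<Rightarrow> bool" where
  "has_cderiv f D z \<longleftrightarrow> (f has_derivative D) (at z) \<and> (\<forall>c v. D (c *s v) = c * D v)"

definition hol :: "(complex^'n \<Rightarrow> complex) \<Rightarrow> (complex^'n) set \<Rightarrow> bool" where
  "hol f S \<longleftrightarrow> (\<forall>z\<in>S. complex_differentiable_at f z)"

lemma cdiff_iff: "complex_differentiable_at f z \<longleftrightarrow> (\<exists>D. has_cderiv f D z)"
  by (simp add: complex_differentiable_at_def has_cderiv_def)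

lemma hol_subset: "hol f S \<Longrightarrow> T \<subseteq> S \<Longrightarrow> hol f T"
  by (auto simp: hol_def)

lemma norm_scalar_mult_vec: "norm (c *s (v :: complex^'n)) = norm c * norm v"
proof -
  have "norm (c *s v) = L2_set (\<lambda>i. norm c * norm (v $ i)) UNIV"
    by (simp add: norm_vec_def norm_mult)
  also have "\<dots> = norm c * norm v"
    by (simp add: norm_vec_def L2_set_right_distrib)
  finally show ?thesis .
qed

lemma axis_eq_smult: "axis i t = t *s axis i (1 :: complex)"
  by (simp add: cart_eq_iff axis_def)

lemma norm_axis_complex [simp]: "norm (axis i t :: complex^'n) = norm t"
  using norm_scalar_mult_vec [of t "axis i 1"] by (simp flip: axis_eq_smult)

lemma bounded_linear_scalar_mult_vec: "bounded_linear (\<lambda>t. t *s (v :: complex^'n))"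
  by (rule bounded_linear_intro [where K = "norm v"])
    (auto simp: norm_scalar_mult_vec cart_eq_iff algebra_simps scaleR_conv_of_real [where 'a = complex])

lemma scaleR_eq_smult: "r *\<^sub>R (v :: complex^'n) = of_real r *s v"
  by (simp add: cart_eq_iff scaleR_conv_of_real [where 'a = complex])

lemma has_cderiv_const: "has_cderiv (\<lambda>z. c) (\<lambda>v. 0) z"
  by (simp add: has_cderiv_def)

lemma has_cderiv_coord: "has_cderiv (\<lambda>z. z $ i) (\<lambda>v. v $ i) z"
  by (auto simp: has_cderiv_def intro!: bounded_linear.has_derivative [OF bounded_linear_vec_nth]
      derivative_eq_intros)

lemma has_cderiv_add:
  "has_cderiv f D z \<Longrightarrow> has_cderiv g E z \<Longrightarrow> has_cderiv (\<lambda>z. f z + g z) (\<lambda>v. D v + E v) z"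
  by (auto simp: has_cderiv_def algebra_simps intro!: has_derivative_add)

lemma has_cderiv_diff:
  "has_cderiv f D z \<Longrightarrow> has_cderiv g E z \<Longrightarrow> has_cderiv (\<lambda>z. f z - g z) (\<lambda>v. D v - E v) z"
  by (auto simp: has_cderiv_def algebra_simps intro!: has_derivative_diff)

lemma has_cderiv_mult:
  "has_cderiv f D z \<Longrightarrow> has_cderiv g E z \<Longrightarrow>
    has_cderiv (\<lambda>z. f z * g z) (\<lambda>v. f z * E v + D v * g z) z"
  unfolding has_cderiv_def by (auto intro!: has_derivative_mult) (simp add: algebra_simps)

lemma has_cderiv_cmult: "has_cderiv f D z \<Longrightarrow> has_cderiv (\<lambda>z. c * f z) (\<lambda>v. c * D v) z"
  using has_cderiv_mult [OF has_cderiv_const] by fastforce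

lemma has_cderiv_sum:
  "(\<And>k. k \<in> A \<Longrightarrow> has_cderiv (f k) (D k) z) \<Longrightarrow>
    has_cderiv (\<lambda>z. \<Sum>k\<in>A. f k z) (\<lambda>v. \<Sum>k\<in>A. D k v) z"
  by (auto simp: has_cderiv_def sum_distrib_left intro!: has_derivative_sum sum.cong)

lemma has_cderiv_inverse:
  assumes "has_cderiv f D z" "f z \<noteq> 0"
  shows "has_cderiv (\<lambda>z. inverse (f z)) (\<lambda>v. - (inverse (f z) * D v * inverse (f z))) z"
  using assms by (auto simp: has_cderiv_def intro!: has_derivative_inverse)

lemma has_cderiv_zero: "has_cderiv f D z \<Longrightarrow> D 0 = 0"
  unfolding has_cderiv_def using has_derivative_bounded_linear linear_simps(3) by blast

lemma cdiff_intros: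
  "complex_differentiable_at (\<lambda>z. c) z"
  "complex_differentiable_at (\<lambda>z. z $ i) z"
  "complex_differentiable_at f z \<Longrightarrow> complex_differentiable_at g z \<Longrightarrow>
     complex_differentiable_at (\<lambda>z. f z + g z) z"
  "complex_differentiable_at f z \<Longrightarrow> complex_differentiable_at g z \<Longrightarrow>
     complex_differentiable_at (\<lambda>z. f z - g z) z"
  "complex_differentiable_at f z \<Longrightarrow> complex_differentiable_at g z \<Longrightarrow>
     complex_differentiable_at (\<lambda>z. f z * g z) z"
  "complex_differentiable_at f z \<Longrightarrow> f z \<noteq> 0 \<Longrightarrow> complex_differentiable_at (\<lambda>z. inverse (f z)) z"
  unfolding cdiff_iff
       apply (rule exI, rule has_cderiv_const)
      apply (rule exI, rule has_cderiv_coord)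
     apply (elim exE, rule exI, rule has_cderiv_add; assumption)
    apply (elim exE, rule exI, rule has_cderiv_diff; assumption)
   apply (elim exE, rule exI, rule has_cderiv_mult; assumption)
  apply (elim exE, rule exI, rule has_cderiv_inverse; assumption)
  done

lemma cdiff_divide:
  "complex_differentiable_at f z \<Longrightarrow> complex_differentiable_at g z \<Longrightarrow> g z \<noteq> 0 \<Longrightarrow>
    complex_differentiable_at (\<lambda>z. f z / g z) z"
  by (simp add: divide_inverse cdiff_intros)

lemma cdiff_sum:
  "(\<And>k. k \<in> A \<Longrightarrow> complex_differentiable_at (f k) z) \<Longrightarrow>
    complex_differentiable_at (\<lambda>z. \<Sum>k\<in>A. f k z) z"
  by (induction A rule: infinite_finite_induct) (auto intro: cdiff_intros)

lemma cdiff_prod: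
  "(\<And>k. k \<in> A \<Longrightarrow> complex_differentiable_at (f k) z) \<Longrightarrow>
    complex_differentiable_at (\<lambda>z. \<Prod>k\<in>A. f k z) z"
  by (induction A rule: infinite_finite_induct) (auto intro: cdiff_intros)

lemma cdiff_power:
  "complex_differentiable_at f z \<Longrightarrow> complex_differentiable_at (\<lambda>z. f z ^ k) z"
  by (induction k) (auto intro: cdiff_intros)

lemma cdiff_imp_isCont: "complex_differentiable_at f z \<Longrightarrow> isCont f z"
  unfolding complex_differentiable_at_def using has_derivative_continuous by blast

lemma hol_imp_continuous_on: "hol f S \<Longrightarrow> continuous_on S f"
  unfolding hol_def by (meson cdiff_imp_isCont continuous_at_imp_continuous_on)

lemma cdiff_transform_open:
  assumes "complex_differentiable_at f z" "open U" "z \<in> U" "\<And>w. w \<in> U \<Longrightarrow> f w = g w"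
  shows "complex_differentiable_at g z"
  using assms has_derivative_transform_within_open unfolding complex_differentiable_at_def
  by metis

lemma sum_axis_component: "(\<Sum>i\<in>UNIV. axis i (v $ i)) = (v :: complex^'n)"
  by (simp add: cart_eq_iff axis_def)

text \<open>Components are complex, so the map is reassembled from its \<open>axis i\<close> parts
  rather than along the real basis.\<close>

lemma has_derivative_vec:
  fixes h :: "'a::real_normed_vector \<Rightarrow> complex^'m"
  assumes "\<And>i. ((\<lambda>z. h z $ i) has_derivative (\<lambda>v. D v $ i)) F"
  shows "(h has_derivative D) F"
proof -
  have bl: "bounded_linear (\<lambda>t. axis i t :: complex^'m)" for i
    using bounded_linear_scalar_mult_vec [of "axis i 1"] by (simp flip: axis_eq_smult)
  have "((\<lambda>z. \<Sum>i\<in>UNIV. axis i (h z $ i)) has_derivative (\<lambda>v. \<Sum>i\<in>UNIV. axis i (D v $ i))) F"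
    by (intro has_derivative_sum bounded_linear.has_derivative [OF bl] assms)
  then show ?thesis
    by (simp add: sum_axis_component)
qed

lemma has_derivative_map_of_components:
  fixes h :: "complex^'n \<Rightarrow> complex^'m"
  assumes "\<And>i. complex_differentiable_at (\<lambda>z. h z $ i) z"
  obtains D where "(h has_derivative D) (at z)" "\<And>c v. D (c *s v) = c *s D v"
proof -
  obtain E where E: "\<And>i. has_cderiv (\<lambda>z. h z $ i) (E i) z"
    using assms unfolding cdiff_iff by metis
  show thesis
  proof
    show "(h has_derivative (\<lambda>v. \<chi> i. E i v)) (at z)"
      using E by (intro has_derivative_vec) (simp add: has_cderiv_def)
    show "(\<chi> i. E i (c *s v)) = c *s (\<chi> i. E i v)" for c v
      using E by (simp add: has_cderiv_def cart_eq_iff)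
  qed
qed

lemma cdiff_compose:
  fixes h :: "complex^'n \<Rightarrow> complex^'m"
  assumes "complex_differentiable_at F (h z)" "\<And>i. complex_differentiable_at (\<lambda>z. h z $ i) z"
  shows "complex_differentiable_at (\<lambda>z. F (h z)) z"
proof -
  obtain D where D: "(h has_derivative D) (at z)" "\<And>c v. D (c *s v) = c *s D v"
    using has_derivative_map_of_components assms(2) by blast
  obtain E where E: "has_cderiv F E (h z)"
    using assms(1) cdiff_iff by blast
  have "has_cderiv (\<lambda>z. F (h z)) (\<lambda>v. E (D v)) z"
    using E D has_derivative_compose [OF D(1), of F E] unfolding has_cderiv_def by simp
  then show ?thesis
    using cdiff_iff by blast
qed

section \<open>Restriction to complex lines, Cauchy estimates, partial derivatives\<close>

lemma has_cderiv_line: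
  assumes "has_cderiv f D (z + t *s v)"
  shows "((\<lambda>t. f (z + t *s v)) has_field_derivative D v) (at t)"
proof -
  have "((\<lambda>t. z + t *s v) has_derivative (\<lambda>h. h *s v)) (at t)"
    using bounded_linear.has_derivative [OF bounded_linear_scalar_mult_vec [of v] has_derivative_ident, of "at t"]
    by (auto intro!: derivative_eq_intros)
  from has_derivative_compose [OF this, of f D]
  have "((\<lambda>t. f (z + t *s v)) has_derivative (\<lambda>h. D (h *s v))) (at t)"
    using assms by (simp add: has_cderiv_def)
  moreover have "(\<lambda>h. D (h *s v)) = (*) (D v)"
    using assms by (auto simp: has_cderiv_def mult.commute)
  ultimately show ?thesis
    by (simp add: has_field_derivative_def)
qed

lemma partial_deriv_eq:
  assumes "has_cderiv f D z"
  shows "partial_deriv i f z = D (axis i 1)"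
proof -
  have "((\<lambda>t. f (z + t *s axis i 1)) has_field_derivative D (axis i 1)) (at 0)"
    using assms by (intro has_cderiv_line) simp
  then show ?thesis
    unfolding partial_deriv_def by (simp add: DERIV_imp_deriv flip: axis_eq_smult)
qed

lemma has_cderiv_partials:
  assumes "has_cderiv f D z"
  shows "D v = (\<Sum>i\<in>UNIV. v $ i * partial_deriv i f z)"
proof -
  have lin: "linear D"
    using assms has_derivative_bounded_linear bounded_linear.linear unfolding has_cderiv_def by blast
  have "D v = D (\<Sum>i\<in>UNIV. v $ i *s axis i 1)"
    by (simp add: sum_axis_component flip: axis_eq_smult)
  also have "\<dots> = (\<Sum>i\<in>UNIV. v $ i * D (axis i 1))"
    using assms by (subst linear_sum [OF lin]) (simp add: has_cderiv_def)
  finally show ?thesis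
    by (simp add: partial_deriv_eq [OF assms])
qed

lemma holomorphic_on_line:
  assumes "hol f S" "\<And>t. t \<in> T \<Longrightarrow> z + t *s v \<in> S"
  shows "(\<lambda>t. f (z + t *s v)) holomorphic_on T"
  unfolding holomorphic_on_def
proof
  fix t assume "t \<in> T"
  then obtain D where "has_cderiv f D (z + t *s v)"
    using assms unfolding hol_def cdiff_iff by blast
  from has_cderiv_line [OF this] show "(\<lambda>t. f (z + t *s v)) field_differentiable at t within T"
    using field_differentiable_at_within field_differentiable_def by blast
qed

text \<open>The one-variable Cauchy inequality for the first derivative, along the line through
  \<open>z\<close> in direction \<open>v\<close>; a parameter disc of radius
  \<open>r / norm v\<close> corresponds to points at distance at most \<open>r\<close> from
  \<open>z\<close>.\<close>

lemma cderiv_Cauchy_bound: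
  assumes hol: "hol f (ball z R)" and M: "\<And>w. w \<in> ball z R \<Longrightarrow> norm (f w) \<le> M"
    and D: "has_cderiv f D z" and r: "0 < r" "r < R"
  shows "norm (D v) * r \<le> M * norm v"
proof (cases "v = 0")
  case True
  then show ?thesis
    using has_cderiv_zero [OF D] by simp
next
  case False
  define s where "s = r / norm v"
  have s: "s > 0" "s * norm v = r"
    using r False by (auto simp: s_def)
  have sub: "z + t *s v \<in> ball z R" if "t \<in> cball 0 s" for t
  proof -
    have "norm t * norm v \<le> s * norm v"
      using that by (intro mult_right_mono) auto
    then show ?thesis
      using s r by (simp add: dist_norm norm_scalar_mult_vec)
  qed
  have h: "(\<lambda>t. f (z + t *s v)) holomorphic_on cball 0 s"
    using holomorphic_on_line [OF hol sub] by blast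
  have "norm ((deriv ^^ 1) (\<lambda>t. f (z + t *s v)) 0) \<le> fact 1 * M / s ^ 1"
  proof (rule Cauchy_inequality)
    show "norm (f (z + x *s v)) \<le> M" if "norm (0 - x) = s" for x
      using that by (intro M sub) auto
  qed (use h s in \<open>auto intro: holomorphic_on_subset holomorphic_on_imp_continuous_on\<close>)
  moreover have "deriv (\<lambda>t. f (z + t *s v)) 0 = D v"
    using D by (intro DERIV_imp_deriv has_cderiv_line) simp
  ultimately have "norm (D v) * s \<le> M"
    using s by (simp add: field_simps)
  then have "norm (D v) * s * norm v \<le> M * norm v"
    by (intro mult_right_mono) auto
  then show ?thesis
    using s by (simp add: mult.assoc)
qed

text \<open>Taylor's formula with a remainder of second order. About points of norm below
  \<open>r / 2\<close> a disc of radius \<open>r / 3\<close> stays inside \<open>ball 0 r\<close>,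
  so Cauchy bounds the second derivative by \<open>2 * M / (r / 3)^2 = 18 * M / r^2\<close>. The
  bound depends on \<open>\<phi>\<close> only through \<open>M\<close> and \<open>r\<close>, which
  makes difference quotients converge uniformly over base points.\<close>

lemma difference_quotient_bound:
  assumes hol: "\<phi> holomorphic_on ball 0 r" and M: "\<And>t. t \<in> ball 0 r \<Longrightarrow> norm (\<phi> t) \<le> M"
    and h: "h \<noteq> 0" "norm h < r / 2"
  shows "norm ((\<phi> h - \<phi> 0) / h - deriv \<phi> 0) \<le> 18 * M / r\<^sup>2 * norm (h :: complex)"
proof -
  have r: "r > 0"
    using h norm_ge_zero [of h] by linarith
  define f where "f i = (deriv ^^ i) \<phi>" for i
  have holf: "f i holomorphic_on ball 0 r" for i
    unfolding f_def by (intro holomorphic_higher_deriv hol) auto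
  have "norm (f 0 h - (\<Sum>i\<le>1. f i 0 * (h - 0) ^ i / (fact i))) \<le> 18 * M / r\<^sup>2 * norm (h - 0) ^ (Suc 1) / fact 1"
  proof (rule complex_Taylor [where S = "ball 0 (r/2)"])
    show "(f i has_field_derivative f (Suc i) x) (at x within ball 0 (r / 2))"
      if "x \<in> ball 0 (r / 2)" for i x
    proof -
      have "(f i has_field_derivative deriv (f i) x) (at x)"
        using holf r that by (intro holomorphic_derivI [of _ "ball 0 r"]) auto
      then show ?thesis
        by (simp add: f_def has_field_derivative_at_within)
    qed
    show "norm (f (Suc 1) x) \<le> 18 * M / r\<^sup>2" if "x \<in> ball 0 (r / 2)" for x
    proof -
      have sub: "cball x (r / 3) \<subseteq> ball 0 r"
      proof
        fix y assume "y \<in> cball x (r / 3)"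
        then have "norm (y - x) \<le> r / 3" "norm x < r / 2"
          using that by (auto simp: dist_norm norm_minus_commute)
        moreover have "norm y \<le> norm (y - x) + norm x"
          by (metis add.commute diff_add_cancel norm_triangle_ineq)
        ultimately have "norm y < r"
          using r by linarith
        then show "y \<in> ball 0 r"
          by simp
      qed
      have "norm ((deriv ^^ 2) \<phi> x) \<le> fact 2 * M / (r / 3) ^ 2"
      proof (rule Cauchy_inequality)
        have "\<phi> holomorphic_on cball x (r / 3)"
          using hol sub holomorphic_on_subset by blast
        then show "\<phi> holomorphic_on ball x (r / 3)" "continuous_on (cball x (r / 3)) \<phi>"
          using holomorphic_on_imp_continuous_on by (auto intro: holomorphic_on_subset)
        show "norm (\<phi> y) \<le> M" if "norm (x - y) = r / 3" for y
          using sub that by (intro M) (auto simp: dist_norm)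
      qed (use r in auto)
      then show ?thesis
        using r by (simp add: f_def numeral_2_eq_2 power2_eq_square field_simps)
    qed
  qed (use h r in auto)
  then have *: "norm (\<phi> h - \<phi> 0 - deriv \<phi> 0 * h) \<le> 18 * M / r\<^sup>2 * (norm h)\<^sup>2"
    by (simp add: f_def algebra_simps power2_eq_square)
  have "(\<phi> h - \<phi> 0) / h - deriv \<phi> 0 = (\<phi> h - \<phi> 0 - deriv \<phi> 0 * h) / h"
    using h by (simp add: field_simps)
  then have "norm ((\<phi> h - \<phi> 0) / h - deriv \<phi> 0) = norm (\<phi> h - \<phi> 0 - deriv \<phi> 0 * h) / norm h"
    by (simp add: norm_divide)
  also have "\<dots> \<le> 18 * M / r\<^sup>2 * (norm h)\<^sup>2 / norm h"
    using * by (intro divide_right_mono) auto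
  finally show ?thesis
    using h by (simp add: power2_eq_square)
qed

text \<open>The difference quotients \<open>q n\<close> in direction \<open>i\<close> converge to
  the partial derivative at a uniform rate. By Cauchy's estimate their complex derivatives
  \<open>E n\<close> are then uniformly Cauchy, and the theorem on differentiating limits gives the
  partial derivative a derivative \<open>G\<close>, complex linear as a pointwise limit.\<close>

theorem partial_deriv_hol:
  assumes S: "open S" and hol: "hol f S"
  shows "hol (partial_deriv i f) S"
  unfolding hol_def
proof
  fix z0 assume "z0 \<in> S"
  then obtain R where R: "R > 0" "cball z0 R \<subseteq> S"
    using S open_contains_cball by blast
  \<comment> \<open>Room for nested balls: the limit is differentiated on radius \<open>r\<close>,
    Cauchy's estimate uses balls of radius \<open>2 * r\<close> about its points and hence quotients
    on radius \<open>3 * r\<close>, and shifting by \<open>h n\<close> stays within radius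
    \<open>4 * r\<close>, where \<open>M\<close> bounds \<open>f\<close>.\<close>
  define r where "r = R / 4"
  have r: "r > 0" and sub: "cball z0 (4 * r) \<subseteq> S"
    using R by (auto simp: r_def)
  have "compact (f ` cball z0 (4 * r))"
    using hol_imp_continuous_on [OF hol] sub
    by (intro compact_continuous_image) (auto intro: continuous_on_subset)
  then have "bounded (f ` cball z0 (4 * r))"
    by (rule compact_imp_bounded)
  then have "\<exists>M. \<forall>z\<in>cball z0 (4 * r). norm (f z) \<le> M"
    unfolding bounded_iff by blast
  then obtain M where "\<forall>z\<in>cball z0 (4 * r). norm (f z) \<le> M" ..
  note M = this [rule_format]
  obtain D where D: "\<And>z. z \<in> S \<Longrightarrow> has_cderiv f (D z) z"
    using hol unfolding hol_def cdiff_iff by metis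
  define e where "e = (axis i 1 :: complex^'a)"
  have e: "norm e = 1"
    by (simp add: e_def)
  \<comment> \<open>The summand 2 keeps \<open>norm (h n)\<close> strictly below
    \<open>r / 2\<close> already for \<open>n = 0\<close>, as
    \<open>difference_quotient_bound\<close> demands.\<close>
  define h where "h n = complex_of_real (r / (2 * (real n + 2)))" for n :: nat
  have hr: "norm (h n) < r / 2" "h n \<noteq> 0" for n
  proof -
    have pos: "r / (2 * (real n + 2)) > 0" and less: "r / (2 * (real n + 2)) < r / 2"
      using r by (auto simp: field_simps add_pos_nonneg)
    show "norm (h n) < r / 2"
      unfolding h_def norm_of_real abs_of_pos [OF pos] by (rule less)
    show "h n \<noteq> 0"
      unfolding h_def of_real_eq_0_iff using pos by linarith
  qed
  have h0: "(\<lambda>n. norm (h n)) \<longlonglongrightarrow> 0"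
  proof -
    have "(\<lambda>n. r / (2 * (real n + 2))) \<longlonglongrightarrow> 0"
      by real_asymp
    moreover have "norm (h n) = r / (2 * (real n + 2))" for n
      unfolding h_def norm_of_real using r by (intro abs_of_nonneg divide_nonneg_nonneg) auto
    ultimately show ?thesis
      by simp
  qed
  define q where "q n z = (f (z + h n *s e) - f z) / h n" for n z
  define C where "C = 18 * M / r\<^sup>2"
  have shift: "z + t *s e \<in> cball z0 (4 * r)" if "z \<in> ball z0 (3 * r)" "norm t < r" for z t
  proof -
    have "dist z0 (z + t *s e) \<le> dist z0 z + norm (t *s e)"
      by (metis add.commute add_diff_cancel_right' dist_norm dist_triangle norm_minus_commute)
    then show ?thesis
      using that e by (simp add: norm_scalar_mult_vec)
  qed
  have sub3: "ball z0 (3 * r) \<subseteq> S"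
  proof -
    have "ball z0 (3 * r) \<subseteq> cball z0 (4 * r)"
      using r by auto
    then show ?thesis
      using sub by blast
  qed
  have q: "norm (q n z - partial_deriv i f z) \<le> C * norm (h n)" if z: "z \<in> ball z0 (3 * r)" for n z
  proof -
    define \<phi> where "\<phi> t = f (z + t *s e)" for t
    have "\<phi> holomorphic_on ball 0 r"
      unfolding \<phi>_def using shift [OF z] sub by (intro holomorphic_on_line [OF hol]) auto
    moreover have "norm (\<phi> t) \<le> M" if "t \<in> ball 0 r" for t
      unfolding \<phi>_def using that shift [OF z] by (intro M) auto
    ultimately have "norm ((\<phi> (h n) - \<phi> 0) / h n - deriv \<phi> 0) \<le> C * norm (h n)"
      unfolding C_def using hr by (intro difference_quotient_bound)
    moreover have "deriv \<phi> 0 = partial_deriv i f z"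
    proof -
      have "\<phi> = (\<lambda>t. f (z + axis i t))"
        by (simp add: \<phi>_def e_def fun_eq_iff flip: axis_eq_smult)
      then show ?thesis
        by (simp add: partial_deriv_def)
    qed
    ultimately show ?thesis
      by (simp add: \<phi>_def q_def)
  qed
  define E where "E n z v = (D (z + h n *s e) v - D z v) / h n" for n z v
  have E: "has_cderiv (q n) (E n z) z" if z: "z \<in> ball z0 (3 * r)" for n z
  proof -
    have "z + h n *s e \<in> S"
      using shift [OF z] hr(1) [of n] r sub by fastforce
    then have 1: "has_cderiv f (D (z + h n *s e)) (z + h n *s e)"
      using D by blast
    then have "has_cderiv (\<lambda>z. f (z + h n *s e)) (D (z + h n *s e)) z"
    proof -
      have "((\<lambda>z. z + h n *s e) has_derivative (\<lambda>v. v)) (at z)"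
        by (auto intro!: derivative_eq_intros)
      from has_derivative_compose [OF this] 1 show ?thesis
        unfolding has_cderiv_def by blast
    qed
    then have "has_cderiv (\<lambda>z. inverse (h n) * (f (z + h n *s e) - f z))
        (\<lambda>v. inverse (h n) * (D (z + h n *s e) v - D z v)) z"
      using sub3 z by (intro has_cderiv_cmult has_cderiv_diff D) auto
    moreover have "q n = (\<lambda>z. inverse (h n) * (f (z + h n *s e) - f z))"
      by (auto simp: q_def divide_inverse mult.commute)
    moreover have "E n z = (\<lambda>v. inverse (h n) * (D (z + h n *s e) v - D z v))"
      by (auto simp: E_def divide_inverse mult.commute)
    ultimately show ?thesis
      by simp
  qed
  \<comment> \<open>Both \<open>q n\<close> and \<open>q k\<close> are close to the same partial
    derivative, so their difference is small on a ball about \<open>z\<close>; Cauchy's estimate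
    transfers this to the derivatives.\<close>
  have Ediff: "norm (E n z v - E k z v) \<le> C / r * (norm (h n) + norm (h k)) * norm v"
    if z: "z \<in> ball z0 r" for n k z v
  proof -
    have in3: "w \<in> ball z0 (3 * r)" if "w \<in> ball z (2 * r)" for w
    proof -
      have "dist z0 w \<le> dist z0 z + dist z w"
        by (rule dist_triangle)
      then show ?thesis
        using that z by simp
    qed
    have "norm (E n z v - E k z v) * r \<le> (C * norm (h n) + C * norm (h k)) * norm v"
    proof (rule cderiv_Cauchy_bound [where f = "\<lambda>z. q n z - q k z" and R = "2 * r"])
      show "hol (\<lambda>z. q n z - q k z) (ball z (2 * r))"
        unfolding hol_def using E in3 cdiff_iff by (blast intro: cdiff_intros)
      show "norm (q n w - q k w) \<le> C * norm (h n) + C * norm (h k)" if "w \<in> ball z (2 * r)" for w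
        using q [of w n] q [of w k] in3 [OF that]
          norm_triangle_ineq4 [of "q n w - partial_deriv i f w" "q k w - partial_deriv i f w"] by simp
      show "has_cderiv (\<lambda>z. q n z - q k z) (\<lambda>v. E n z v - E k z v) z"
        using in3 [of z] r by (intro has_cderiv_diff E) auto
    qed (use r in auto)
    then show ?thesis
      using r by (simp add: field_simps)
  qed
  have C: "C \<ge> 0"
  proof -
    have "0 \<le> norm (f z0)" "norm (f z0) \<le> M"
      using M r by auto
    then have "0 \<le> M"
      by (rule order_trans)
    then show ?thesis
      by (simp add: C_def)
  qed
  have conv: "\<exists>l. (\<lambda>n. E n z v) \<longlonglongrightarrow> l" if z: "z \<in> ball z0 r" for z v
  proof -
    have "Cauchy (\<lambda>n. E n z v)"
      unfolding Cauchy_def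
    proof (intro allI impI)
      fix \<epsilon> :: real assume \<epsilon>: "\<epsilon> > 0"
      have "(\<lambda>n. C / r * norm (h n) * norm v) \<longlonglongrightarrow> C / r * 0 * norm v"
        by (intro tendsto_intros h0)
      then have "\<forall>\<^sub>F n in sequentially. C / r * norm (h n) * norm v < \<epsilon> / 2"
        using \<epsilon> by (intro order_tendstoD) auto
      then obtain N where N: "\<And>n. n \<ge> N \<Longrightarrow> C / r * norm (h n) * norm v < \<epsilon> / 2"
        unfolding eventually_sequentially by blast
      have "dist (E m z v) (E n z v) < \<epsilon>" if "m \<ge> N" "n \<ge> N" for m n
        proof -
        have "norm (E m z v - E n z v) \<le> C / r * norm (h m) * norm v + C / r * norm (h n) * norm v"
          using Ediff [OF z, of m v n] by (simp only: distrib_left distrib_right)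
        then show ?thesis
          using N [OF that(1)] N [OF that(2)] unfolding dist_norm by linarith
      qed
      then show "\<exists>N. \<forall>m\<ge>N. \<forall>n\<ge>N. dist (E m z v) (E n z v) < \<epsilon>"
        by blast
    qed
    then show ?thesis
      using Cauchy_convergent convergent_def by blast
  qed
  then obtain G where G: "\<And>z v. z \<in> ball z0 r \<Longrightarrow> (\<lambda>n. E n z v) \<longlonglongrightarrow> G z v"
    by metis
  have EG: "norm (E n z v - G z v) \<le> C / r * norm (h n) * norm v" if z: "z \<in> ball z0 r" for n z v
  proof (rule tendsto_le [OF sequentially_bot])
    show "(\<lambda>k. norm (E n z v - E k z v)) \<longlonglongrightarrow> norm (E n z v - G z v)"
      by (intro tendsto_intros G z)
    have "(\<lambda>k. C / r * (norm (h n) + norm (h k)) * norm v) \<longlonglongrightarrow> C / r * (norm (h n) + 0) * norm v"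
      by (intro tendsto_intros h0)
    then show "(\<lambda>k. C / r * (norm (h n) + norm (h k)) * norm v) \<longlonglongrightarrow> C / r * norm (h n) * norm v"
      by simp
    show "\<forall>\<^sub>F k in sequentially. norm (E n z v - E k z v) \<le> C / r * (norm (h n) + norm (h k)) * norm v"
      using Ediff [OF z] by (intro always_eventually) auto
  qed
  have in3: "z \<in> ball z0 (3 * r)" if "z \<in> ball z0 r" for z
    using that r by simp
  have lim: "(\<lambda>n. q n z) \<longlonglongrightarrow> partial_deriv i f z" if "z \<in> ball z0 r" for z
  proof -
    have "(\<lambda>n. q n z - partial_deriv i f z) \<longlonglongrightarrow> 0"
    proof (rule Lim_null_comparison)
      show "\<forall>\<^sub>F n in sequentially. norm (q n z - partial_deriv i f z) \<le> C * norm (h n)"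
        using q in3 [OF that] by (intro always_eventually) blast
      show "(\<lambda>n. C * norm (h n)) \<longlonglongrightarrow> 0"
        using tendsto_mult_right_zero [OF h0] by blast
    qed
    then show ?thesis
      by (simp add: LIM_zero_iff)
  qed
  have "\<exists>g. \<forall>z\<in>ball z0 r. (\<lambda>n. q n z) \<longlonglongrightarrow> g z \<and> (g has_derivative G z) (at z within ball z0 r)"
  proof (rule has_derivative_sequence)
    show "(q n has_derivative E n z) (at z within ball z0 r)" if "z \<in> ball z0 r" for n z
      using E [OF in3 [OF that]] has_derivative_at_withinI unfolding has_cderiv_def by blast
    show "\<forall>\<^sub>F n in sequentially. \<forall>z\<in>ball z0 r. \<forall>v. norm (E n z v - G z v) \<le> \<epsilon> * norm v"
      if \<epsilon>: "\<epsilon> > 0" for \<epsilon>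
    proof -
      have "(\<lambda>n. C / r * norm (h n)) \<longlonglongrightarrow> C / r * 0"
        by (intro tendsto_intros h0)
      then have "\<forall>\<^sub>F n in sequentially. C / r * norm (h n) < \<epsilon>"
        using \<epsilon> by (intro order_tendstoD) auto
      then show ?thesis
      proof eventually_elim
        case (elim n)
        show ?case
        proof (intro ballI allI)
          fix z v assume "z \<in> ball z0 r"
          then have "norm (E n z v - G z v) \<le> C / r * norm (h n) * norm v"
            by (rule EG)
          also have "\<dots> \<le> \<epsilon> * norm v"
            using elim by (intro mult_right_mono) auto
          finally show "norm (E n z v - G z v) \<le> \<epsilon> * norm v" .
        qed
      qed
    qed
    show "z0 \<in> ball z0 r"
      using r by simp
    show "(\<lambda>n. q n z0) \<longlonglongrightarrow> partial_deriv i f z0"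
      using lim r by simp
  qed auto
  then obtain g where g: "\<And>z. z \<in> ball z0 r \<Longrightarrow> (\<lambda>n. q n z) \<longlonglongrightarrow> g z"
      "\<And>z. z \<in> ball z0 r \<Longrightarrow> (g has_derivative G z) (at z within ball z0 r)"
    by blast
  have z0: "z0 \<in> ball z0 r"
    using r by simp
  have "(g has_derivative G z0) (at z0)"
    using g(2) [OF z0] at_within_open [OF z0] by simp
  moreover have "G z0 (c *s v) = c * G z0 v" for c v
  proof -
    have "(\<lambda>n. c * E n z0 v) \<longlonglongrightarrow> c * G z0 v"
      by (intro tendsto_intros G z0)
    moreover have "E n z0 (c *s v) = c * E n z0 v" for n
      using E [OF in3 [OF z0]] unfolding has_cderiv_def by blast
    ultimately show ?thesis
      using G [OF z0, of "c *s v"] LIMSEQ_unique by auto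
  qed
  ultimately have "complex_differentiable_at g z0"
    unfolding complex_differentiable_at_def by blast
  moreover have "g z = partial_deriv i f z" if "z \<in> ball z0 r" for z
    using g(1) [OF that] lim [OF that] LIMSEQ_unique by blast
  ultimately show "complex_differentiable_at (partial_deriv i f) z0"
    using cdiff_transform_open z0 by blast
qed

section \<open>Metric order of vanishing and partial derivatives\<close>

definition vanishes_to :: "('a::metric_space) set \<Rightarrow> nat \<Rightarrow> ('a \<Rightarrow> complex) \<Rightarrow> 'a \<Rightarrow> bool" where
  "vanishes_to S N f z \<longleftrightarrow>
     (\<exists>C e. e > 0 \<and> (\<forall>w\<in>S. dist w z < e \<longrightarrow> norm (f w) \<le> C * dist w z ^ N))"

lemma vanishes_toE:
  assumes "vanishes_to S N f z"
  obtains C e where "C > 0" "e > 0" "\<forall>w\<in>S. dist w z < e \<longrightarrow> norm (f w) \<le> C * dist w z ^ N"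
proof -
  obtain C e where e: "e > 0" and C: "\<forall>w\<in>S. dist w z < e \<longrightarrow> norm (f w) \<le> C * dist w z ^ N"
    using assms unfolding vanishes_to_def by blast
  have "norm (f w) \<le> (\<bar>C\<bar> + 1) * dist w z ^ N" if "w \<in> S" "dist w z < e" for w
  proof -
    have "C * dist w z ^ N \<le> (\<bar>C\<bar> + 1) * dist w z ^ N"
      by (intro mult_right_mono) auto
    then show ?thesis
      using C that by fastforce
  qed
  moreover have "\<bar>C\<bar> + 1 > 0"
    by linarith
  ultimately show thesis
    using that e by blast
qed

lemma vanishes_to_cong:
  assumes "open U" "z \<in> U" "\<And>w. w \<in> S \<inter> U \<Longrightarrow> f w = g w" "vanishes_to S N f z"
  shows "vanishes_to S N g z"
proof -
  obtain C e where e: "e > 0" and C: "\<And>w. w \<in> S \<Longrightarrow> dist w z < e \<Longrightarrow> norm (f w) \<le> C * dist w z ^ N"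
    using assms(4) unfolding vanishes_to_def by blast
  obtain d where d: "d > 0" "ball z d \<subseteq> U"
    using assms(1,2) open_contains_ball by blast
  have "norm (g w) \<le> C * dist w z ^ N" if "w \<in> S" "dist w z < min d e" for w
    using C [of w] assms(3) [of w] that d by (auto simp: dist_commute subset_iff)
  then show ?thesis
    unfolding vanishes_to_def using d e by (metis min_less_iff_conj)
qed

lemma vanishes_to_mult:
  assumes f: "vanishes_to UNIV N f z" and g: "isCont g z"
  shows "vanishes_to UNIV N (\<lambda>w. f w * g w) z"
proof -
  obtain C e where "C > 0" "e > 0" "\<forall>w\<in>UNIV. dist w z < e \<longrightarrow> norm (f w) \<le> C * dist w z ^ N"
    by (rule vanishes_toE [OF f])
  note C = this(1,2) this(3) [rule_format, OF UNIV_I]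
  obtain d where d: "d > 0" "\<And>w. dist w z < d \<Longrightarrow> dist (g w) (g z) < 1"
    using g [unfolded continuous_at_eps_delta, rule_format, of 1] by auto
  have "norm (f w * g w) \<le> C * (norm (g z) + 1) * dist w z ^ N" if w: "dist w z < min d e" for w
  proof -
    have "norm (g w) \<le> norm (g z) + 1"
      using d(2) [of w] w norm_triangle_sub [of "g w" "g z"] by (simp add: dist_norm)
    then have "norm (f w) * norm (g w) \<le> (C * dist w z ^ N) * (norm (g z) + 1)"
      using C w by (intro mult_mono) auto
    then show ?thesis
      by (simp add: norm_mult mult_ac)
  qed
  then show ?thesis
    unfolding vanishes_to_def using C(2) d(1) by (metis min_less_iff_conj)
qed

lemma vanishes_to_add:
  assumes "vanishes_to S N f z" "vanishes_to S N g z"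
  shows "vanishes_to S N (\<lambda>w. f w + g w) z"
proof -
  obtain C e where "C > 0" "e > 0" "\<forall>w\<in>S. dist w z < e \<longrightarrow> norm (f w) \<le> C * dist w z ^ N"
    by (rule vanishes_toE [OF assms(1)])
  note C = this(1,2) this(3) [rule_format]
  obtain D d where "D > 0" "d > 0" "\<forall>w\<in>S. dist w z < d \<longrightarrow> norm (g w) \<le> D * dist w z ^ N"
    by (rule vanishes_toE [OF assms(2)])
  note D = this(1,2) this(3) [rule_format]
  have "norm (f w + g w) \<le> (C + D) * dist w z ^ N" if "w \<in> S" "dist w z < min d e" for w
    using C(3) [of w] D(3) [of w] that norm_triangle_ineq [of "f w" "g w"] by (simp add: algebra_simps)
  then show ?thesis
    unfolding vanishes_to_def using C(2) D(2) by (metis min_less_iff_conj)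
qed

lemma vanishes_to_zero: "vanishes_to S N (\<lambda>w. 0) z"
  unfolding vanishes_to_def by (intro exI [of _ 0] exI [of _ 1]) simp

lemma vanishes_to_sum:
  "(\<And>k. k \<in> A \<Longrightarrow> vanishes_to S N (f k) z) \<Longrightarrow> vanishes_to S N (\<lambda>w. \<Sum>k\<in>A. f k w) z"
  by (induction A rule: infinite_finite_induct) (auto intro: vanishes_to_add vanishes_to_zero)

lemma vanishes_to_0:
  assumes "isCont f z"
  shows "vanishes_to UNIV 0 f z"
proof -
  have "vanishes_to UNIV 0 (\<lambda>_. 1) z"
    unfolding vanishes_to_def by (intro exI [of _ 1]) simp
  from vanishes_to_mult [OF this assms] show ?thesis
    by simp
qed

lemma vanishes_to_Suc_imp_zero:
  assumes "vanishes_to S (Suc N) f z" "z \<in> S"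
  shows "f z = 0"
  using assms unfolding vanishes_to_def by force

text \<open>Cauchy's estimate at \<open>w\<close> on a ball whose radius is comparable to
  \<open>\<rho> = dist w z\<close>: there \<open>f\<close> is at most
  \<open>C * (3 * \<rho>) ^ Suc N\<close>, and dividing by \<open>\<rho>\<close> costs exactly one
  order.\<close>

lemma vanishes_to_partial_deriv:
  assumes S: "open S" "z \<in> S" and hol: "hol f S" and van: "vanishes_to UNIV (Suc N) f z"
  shows "vanishes_to UNIV N (partial_deriv i f) z"
proof -
  obtain C e where "C > 0" "e > 0" "\<forall>w\<in>UNIV. dist w z < e \<longrightarrow> norm (f w) \<le> C * dist w z ^ Suc N"
    by (rule vanishes_toE [OF van])
  note C = this(1,2) this(3) [rule_format, OF UNIV_I]
  obtain d where d: "d > 0" "ball z d \<subseteq> S"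
    using S open_contains_ball by blast
  define m where "m = min d e / 4"
  have m: "m > 0" "4 * m \<le> d" "4 * m \<le> e"
    using C d by (auto simp: m_def)
  have bound: "norm (partial_deriv i f w) * \<rho> \<le> C * (3 * \<rho>) ^ Suc N"
    if w: "dist w z \<le> \<rho>" "\<rho> > 0" "\<rho> \<le> m" for w \<rho>
  proof -
    have near: "dist v z < 3 * \<rho>" if "v \<in> ball w (2 * \<rho>)" for v
      using that w dist_triangle [of v z w] by (simp add: dist_commute)
    have less: "dist v z < d" "dist v z < e" if "v \<in> ball w (2 * \<rho>)" for v
      using near [OF that] w m by linarith+
    have "w \<in> S"
      using d(2) less(1) [of w] w by (auto simp: dist_commute)
    then obtain D where D: "has_cderiv f D w"
      using hol unfolding hol_def cdiff_iff by blast
    have "norm (D (axis i 1)) * \<rho> \<le> (C * (3 * \<rho>) ^ Suc N) * norm (axis i 1 :: complex^'a)"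
    proof (rule cderiv_Cauchy_bound [where R = "2 * \<rho>"])
      show "hol f (ball w (2 * \<rho>))"
        using hol d(2) less by (auto intro!: hol_subset [OF hol] simp: dist_commute subset_iff)
      show "norm (f v) \<le> C * (3 * \<rho>) ^ Suc N" if "v \<in> ball w (2 * \<rho>)" for v
      proof -
        have "norm (f v) \<le> C * dist v z ^ Suc N"
          using less that by (intro C(3)) auto
        also have "\<dots> \<le> C * (3 * \<rho>) ^ Suc N"
          using near [OF that] C(1) by (intro mult_left_mono power_mono) auto
        finally show ?thesis .
      qed
    qed (use D w in auto)
    then show ?thesis
      by (simp add: partial_deriv_eq [OF D])
  qed
  have *: "norm (partial_deriv i f w) \<le> C * 3 ^ Suc N * dist w z ^ N" if "dist w z < m" "w \<noteq> z" for w
  proof -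
    have "norm (partial_deriv i f w) * dist w z \<le> C * 3 ^ Suc N * dist w z ^ N * dist w z"
      using bound [of w "dist w z"] that by (simp add: power_mult_distrib mult_ac)
    then show ?thesis
      using that by (simp add: mult_le_cancel_right)
  qed
  \<comment> \<open>The ball degenerates for \<open>w = z\<close>; the bound at this point is
    recovered by continuity.\<close>
  have "isCont (\<lambda>w. norm (partial_deriv i f w)) z"
    using partial_deriv_hol [OF S(1) hol] S cdiff_imp_isCont unfolding hol_def
    by (intro continuous_intros) blast
  then have "((\<lambda>w. norm (partial_deriv i f w)) \<longlongrightarrow> norm (partial_deriv i f z)) (at z)"
    by (simp add: isCont_def)
  moreover have "((\<lambda>w. C * 3 ^ Suc N * dist w z ^ N) \<longlongrightarrow> C * 3 ^ Suc N * dist z z ^ N) (at z)"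
    by (intro tendsto_intros)
  moreover have "\<forall>\<^sub>F w in at z. norm (partial_deriv i f w) \<le> C * 3 ^ Suc N * dist w z ^ N"
    unfolding eventually_at using * m(1) by blast
  ultimately have "norm (partial_deriv i f z) \<le> C * 3 ^ Suc N * dist z z ^ N"
    by (intro tendsto_le [OF _ _ _, of "at z"]) (auto simp: trivial_limit_at)
  then have "norm (partial_deriv i f w) \<le> C * 3 ^ Suc N * dist w z ^ N" if "dist w z < m" for w
    using * that by (cases "w = z") auto
  then show ?thesis
    unfolding vanishes_to_def using m(1) by blast
qed

text \<open>Mean value inequality on the closed ball about \<open>z\<close> through
  \<open>w\<close>, where the total derivative is controlled by the sum of the bounds for the
  partial derivatives.\<close>

lemma vanishes_to_SucI:
  assumes S: "open S" "z \<in> S" and hol: "hol f S" and z: "f z = 0"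
    and van: "\<And>i. vanishes_to UNIV N (partial_deriv i f) z"
  shows "vanishes_to UNIV (Suc N) f z"
proof -
  have "\<exists>C e. C > 0 \<and> e > 0 \<and> (\<forall>w. dist w z < e \<longrightarrow> norm (partial_deriv i f w) \<le> C * dist w z ^ N)" for i
    by (rule vanishes_toE [OF van [of i]]) blast
  then obtain C e where C: "\<And>i. C i > 0" "\<And>i. e i > 0"
      "\<And>i w. dist w z < e i \<Longrightarrow> norm (partial_deriv i f w) \<le> C i * dist w z ^ N"
    by metis
  obtain d where d: "d > 0" "ball z d \<subseteq> S"
    using S open_contains_ball by blast
  define m where "m = Min (insert d (range e))"
  have m: "m > 0" "m \<le> d" "\<And>i. m \<le> e i"
    using d C by (auto simp: m_def intro: min.coboundedI2)
  define K where "K = (\<Sum>i\<in>UNIV. C i)"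
  have "norm (f w) \<le> K * dist w z ^ Suc N" if w: "dist w z < m" for w
  proof -
    let ?\<rho> = "dist w z"
    obtain D where D: "\<And>x. x \<in> S \<Longrightarrow> has_cderiv f (D x) x"
      using hol unfolding hol_def cdiff_iff by metis
    have inS: "x \<in> S" "dist x z < m" if "x \<in> cball z ?\<rho>" for x
      using that w m d(2) by (auto simp: dist_commute subset_iff)
    have "norm (f w - f z) \<le> (K * ?\<rho> ^ N) * norm (w - z)"
    proof (rule differentiable_bound [where S = "cball z ?\<rho>" and f' = D])
      show "(f has_derivative D x) (at x within cball z ?\<rho>)" if "x \<in> cball z ?\<rho>" for x
        using D [OF inS(1) [OF that]] has_derivative_at_withinI unfolding has_cderiv_def by blast
      show "onorm (D x) \<le> K * ?\<rho> ^ N" if x: "x \<in> cball z ?\<rho>" for x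
      proof (rule onorm_bound)
        show "norm (D x v) \<le> K * ?\<rho> ^ N * norm v" for v
        proof -
          have "norm (D x v) \<le> (\<Sum>i\<in>UNIV. norm (v $ i) * norm (partial_deriv i f x))"
            unfolding has_cderiv_partials [OF D [OF inS(1) [OF x]], of v]
            by (intro order_trans [OF norm_sum]) (simp add: norm_mult)
          also have "\<dots> \<le> (\<Sum>i\<in>UNIV. norm v * (C i * ?\<rho> ^ N))"
          proof (intro sum_mono mult_mono)
            fix i
            have "norm (partial_deriv i f x) \<le> C i * dist x z ^ N"
              using inS(2) [OF x] m(3) [of i] by (intro C(3)) auto
            also have "\<dots> \<le> C i * ?\<rho> ^ N"
              using x C(1) [of i] by (intro mult_left_mono power_mono) (auto simp: dist_commute)
            finally show "norm (partial_deriv i f x) \<le> C i * ?\<rho> ^ N" .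
          qed (auto simp: Finite_Cartesian_Product.norm_nth_le)
          also have "\<dots> = K * ?\<rho> ^ N * norm v"
            by (simp add: K_def sum_distrib_left sum_distrib_right mult_ac)
          finally show ?thesis .
        qed
        show "0 \<le> K * ?\<rho> ^ N"
          unfolding K_def by (intro mult_nonneg_nonneg sum_nonneg) (use C(1) less_imp_le in auto)
      qed
    qed (auto simp: dist_commute)
    then show ?thesis
      by (simp add: z dist_norm mult_ac)
  qed
  then show ?thesis
    unfolding vanishes_to_def using m(1) by blast
qed

lemma foldr_partial_deriv_hol:
  assumes "open S" "hol f S"
  shows "hol (foldr partial_deriv is f) S"
  using assms by (induction "is") (auto intro: partial_deriv_hol)

text \<open>Translates between the metric order, which makes sense on \<open>X\<close>, and the
  iterated derivatives that occur in \<open>vanishing_order\<close> and as rows of the jet matrix.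
  Since \<open>foldr\<close> applies the last index first, lists are split as
  \<open>is @ [i]\<close> and the induction differentiates \<open>f\<close> itself.\<close>

theorem vanishes_to_iff_partial_derivs:
  assumes "open S" "z \<in> S" "hol f S"
  shows "vanishes_to UNIV N f z \<longleftrightarrow> (\<forall>is. length is < N \<longrightarrow> foldr partial_deriv is f z = 0)"
  using assms
proof (induction N arbitrary: f)
  case 0
  then show ?case
    by (auto simp: hol_def intro!: vanishes_to_0 cdiff_imp_isCont)
next
  case (Suc N)
  have IH: "vanishes_to UNIV N (partial_deriv i f) z \<longleftrightarrow>
      (\<forall>is. length is < N \<longrightarrow> foldr partial_deriv (is @ [i]) f z = 0)" for i
    using Suc.IH [OF Suc.prems(1,2) partial_deriv_hol [OF Suc.prems(1,3)]] by simp
  have "vanishes_to UNIV (Suc N) f z \<longleftrightarrow> f z = 0 \<and> (\<forall>i. vanishes_to UNIV N (partial_deriv i f) z)"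
    using vanishes_to_partial_deriv [OF Suc.prems] vanishes_to_SucI [OF Suc.prems]
      vanishes_to_Suc_imp_zero by (metis UNIV_I)
  also have "\<dots> \<longleftrightarrow> (\<forall>is. length is < Suc N \<longrightarrow> foldr partial_deriv is f z = 0)"
    unfolding IH
  proof (intro iffI conjI allI impI)
    fix "is" :: "'a list"
    assume *: "f z = 0 \<and> (\<forall>i is. length is < N \<longrightarrow> foldr partial_deriv (is @ [i]) f z = 0)" "length is < Suc N"
    show "foldr partial_deriv is f z = 0"
      using * by (cases "is" rule: rev_cases) auto
  next
    assume *: "\<forall>is. length is < Suc N \<longrightarrow> foldr partial_deriv is f z = 0"
    show "f z = 0"
      using * [rule_format, of "[]"] by simp
    show "foldr partial_deriv (is @ [i]) f z = 0" if "length is < N" for i "is"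
      using * [rule_format, of "is @ [i]"] that by simp
  qed
  finally show ?case .
qed

lemma foldr_partial_deriv_lincomb:
  assumes "open S" "z \<in> S" "\<And>k. k \<in> A \<Longrightarrow> hol (f k) S"
  shows "foldr partial_deriv is (\<lambda>w. \<Sum>k\<in>A. c k * f k w) z = (\<Sum>k\<in>A. c k * foldr partial_deriv is (f k) z)"
  using assms(2)
proof (induction "is" arbitrary: z)
  case (Cons i "is")
  have "\<exists>D. has_cderiv (foldr partial_deriv is (f k)) D z" if "k \<in> A" for k
    using foldr_partial_deriv_hol [OF assms(1) assms(3) [OF that]] Cons.prems
    unfolding hol_def cdiff_iff by blast
  then obtain D where D: "\<And>k. k \<in> A \<Longrightarrow> has_cderiv (foldr partial_deriv is (f k)) (D k) z"
    by metis
  let ?F = "\<lambda>w. \<Sum>k\<in>A. c k * foldr partial_deriv is (f k) w"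
  have DF: "has_cderiv ?F (\<lambda>v. \<Sum>k\<in>A. c k * D k v) z"
    by (intro has_cderiv_sum has_cderiv_cmult D)
  then have "has_cderiv (foldr partial_deriv is (\<lambda>w. \<Sum>k\<in>A. c k * f k w)) (\<lambda>v. \<Sum>k\<in>A. c k * D k v) z"
    unfolding has_cderiv_def using Cons.IH
    by (auto intro: has_derivative_transform_within_open [OF _ assms(1) Cons.prems])
  then show ?case
    by (simp add: partial_deriv_eq partial_deriv_eq [OF D])
qed simp

section \<open>Identity theorems on convex open sets\<close>

lemma open_line_preimage: "open V \<Longrightarrow> open {t. p + t *s (v :: complex^'n) \<in> V}"
proof -
  assume "open V"
  have "continuous_on UNIV (\<lambda>t. p + t *s v)"
    using linear_continuous_on [OF bounded_linear_scalar_mult_vec] by (intro continuous_intros)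
  then show ?thesis
    using open_vimage [OF \<open>open V\<close>] by (auto simp: vimage_def)
qed

lemma convex_line_preimage: "convex V \<Longrightarrow> convex {t. p + t *s (v :: complex^'n) \<in> V}"
proof (rule convexI, safe)
  fix s t :: complex and u w :: real
  assume *: "convex V" "p + s *s v \<in> V" "p + t *s v \<in> V" "0 \<le> u" "0 \<le> w" "u + w = 1"
  have "p + (u *\<^sub>R s + w *\<^sub>R t) *s v = u *\<^sub>R (p + s *s v) + w *\<^sub>R (p + t *s v)"
    using *(6) by (simp add: scaleR_eq_smult scaleR_conv_of_real [where 'a = complex] cart_eq_iff
        algebra_simps flip: distrib_right of_real_add)
  then show "p + (u *\<^sub>R s + w *\<^sub>R t) *s v \<in> V"
    using * by (metis convexD)
qed

text \<open>The complex line through \<open>p\<close> and \<open>q\<close> stays in \<open>L\<close>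
  and meets the convex \<open>V\<close> in a connected set, so the one-variable identity theorem
  applies. The subspace \<open>L\<close> is there for branches of the Zariski closure, which are
  images of \<open>L \<inter> V\<close>.\<close>

theorem hol_identity:
  assumes V: "open V" "convex V" and hol: "hol f V" and L: "vec.subspace L"
    and p: "p \<in> L \<inter> V" and q: "q \<in> L \<inter> V"
    and e: "e > 0" and zero: "\<And>z. z \<in> L \<inter> V \<Longrightarrow> dist z p < e \<Longrightarrow> f z = 0"
  shows "f q = 0"
proof -
  define v where "v = q - p"
  define T where "T = {t. p + t *s v \<in> V}"
  have T: "open T" "connected T"
    unfolding T_def using V open_line_preimage convex_line_preimage convex_connected by blast+
  have vL: "v \<in> L"
    unfolding v_def using L p q vec.subspace_diff by blast
  define \<delta> where "\<delta> = e / (norm v + 1)"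
  have \<delta>: "\<delta> > 0" "\<delta> * norm v < e"
    using e by (auto simp: \<delta>_def divide_simps add_nonneg_pos mult_less_cancel_left)
  have "f (p + 1 *s v) = 0"
  proof (rule analytic_continuation_open [of "ball 0 \<delta> \<inter> T" T "\<lambda>t. f (p + t *s v)" "\<lambda>t. 0"])
    have "0 \<in> ball 0 \<delta> \<inter> T"
      using \<delta> p by (simp add: T_def)
    then show "ball 0 \<delta> \<inter> T \<noteq> {}"
      by blast
    show "(\<lambda>t. f (p + t *s v)) holomorphic_on T"
      by (rule holomorphic_on_line [OF hol]) (simp add: T_def)
    show "1 \<in> T"
      using q by (simp add: T_def v_def)
    show "f (p + t *s v) = 0" if t: "t \<in> ball 0 \<delta> \<inter> T" for t
    proof (rule zero)
      have "t *s v \<in> L"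
        using L vL vec.subspace_scale by blast
      then show "p + t *s v \<in> L \<inter> V"
        using t p L vec.subspace_add by (auto simp: T_def)
      have "norm t * norm v \<le> \<delta> * norm v"
        using t by (intro mult_right_mono) auto
      then show "dist (p + t *s v) p < e"
        using \<delta> by (simp add: dist_norm norm_scalar_mult_vec)
    qed
  qed (use T in auto)
  then show ?thesis
    by (simp add: v_def)
qed

lemma hol_identity_UNIV:
  assumes "open V" "convex V" "hol f V" "p \<in> V" "q \<in> V" "e > 0"
    "\<And>z. z \<in> V \<Longrightarrow> dist z p < e \<Longrightarrow> f z = 0"
  shows "f q = 0"
  using hol_identity [OF assms(1-3) vec.subspace_UNIV, of p q e] assms by auto

text \<open>On the line from \<open>p\<close> to \<open>q\<close> all Taylor coefficients at
  \<open>p\<close> vanish: flatness of order \<open>Suc k\<close> turns Cauchy's bound for the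
  \<open>k\<close>-th derivative on the circle of radius \<open>\<rho>\<close> into a fixed multiple
  of \<open>\<rho>\<close>, which tends to 0.\<close>

theorem hol_flat_imp_zero:
  assumes V: "open V" "convex V" and hol: "hol f V" and p: "p \<in> V" and q: "q \<in> V"
    and flat: "\<And>N. vanishes_to UNIV N f p"
  shows "f q = 0"
proof -
  define v where "v = q - p"
  define T where "T = {t. p + t *s v \<in> V}"
  have T: "open T" "connected T" "0 \<in> T" "1 \<in> T"
  proof -
    show "open T" "connected T"
      unfolding T_def using V open_line_preimage convex_line_preimage convex_connected by blast+
    show "0 \<in> T" "1 \<in> T"
      using p q by (auto simp: T_def v_def)
  qed
  define \<phi> where "\<phi> t = f (p + t *s v)" for t
  have h: "\<phi> holomorphic_on T"
    unfolding \<phi>_def by (rule holomorphic_on_line [OF hol]) (simp add: T_def)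
  have "\<phi> 1 = 0"
  proof (rule holomorphic_fun_eq_0_on_connected [OF h T(1,2) _ T(3,4)])
    fix k
    obtain C e where "C > 0" "e > 0" "\<forall>w\<in>UNIV. dist w p < e \<longrightarrow> norm (f w) \<le> C * dist w p ^ Suc k"
      by (rule vanishes_toE [OF flat [of "Suc k"]])
    note C = this(1,2) this(3) [rule_format, OF UNIV_I]
    obtain d where d: "d > 0" "cball 0 d \<subseteq> T"
      using T open_contains_cball by blast
    define m where "m = min d (e / (norm v + 1))"
    have m: "m > 0" "m \<le> d"
      using d C by (auto simp: m_def add_nonneg_pos)
    have m2: "m * norm v < e"
    proof -
      have "m * (norm v + 1) \<le> e"
        by (simp add: m_def add_nonneg_pos pos_le_divide_eq flip: pos_le_divide_eq)
      then show ?thesis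
        using m by (simp add: algebra_simps)
    qed
    have "norm ((deriv ^^ k) \<phi> 0) \<le> (fact k * C * norm v ^ Suc k) * \<rho>" if \<rho>: "0 < \<rho>" "\<rho> < m" for \<rho>
    proof -
      have "norm ((deriv ^^ k) \<phi> 0) \<le> fact k * (C * (\<rho> * norm v) ^ Suc k) / \<rho> ^ k"
      proof (rule Cauchy_inequality)
        have "cball 0 \<rho> \<subseteq> T"
          using \<rho> m d by auto
        then show "\<phi> holomorphic_on ball 0 \<rho>" "continuous_on (cball 0 \<rho>) \<phi>"
          using h ball_subset_cball
          by (blast intro: holomorphic_on_subset holomorphic_on_imp_continuous_on)+
        show "norm (\<phi> t) \<le> C * (\<rho> * norm v) ^ Suc k" if "norm (0 - t) = \<rho>" for t
        proof -
          have "dist (p + t *s v) p = \<rho> * norm v"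
            using that by (simp add: dist_norm norm_scalar_mult_vec)
          moreover have "\<rho> * norm v \<le> m * norm v"
            using \<rho> by (intro mult_right_mono) auto
          ultimately show ?thesis
            using C(3) [of "p + t *s v"] m2 by (simp add: \<phi>_def)
        qed
      qed (use \<rho> in auto)
      also have "\<dots> = (fact k * C * norm v ^ Suc k) * \<rho>"
        using \<rho> by (simp add: power_mult_distrib field_simps)
      finally show ?thesis .
    qed
    then have "\<forall>\<^sub>F \<rho> in at_right 0. norm ((deriv ^^ k) \<phi> 0) \<le> (fact k * C * norm v ^ Suc k) * \<rho>"
      unfolding eventually_at_right_field using m by blast
    moreover have "((\<lambda>\<rho>. (fact k * C * norm v ^ Suc k) * \<rho>) \<longlongrightarrow> (fact k * C * norm v ^ Suc k) * 0) (at_right 0)"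
      by (intro tendsto_intros)
    ultimately have "norm ((deriv ^^ k) \<phi> 0) \<le> (fact k * C * norm v ^ Suc k) * 0"
      by (intro tendsto_lowerbound [of _ _ "at_right 0"]) auto
    then show "(deriv ^^ k) \<phi> 0 = 0"
      by simp
  qed
  then show ?thesis
    by (simp add: \<phi>_def v_def)
qed

text \<open>On a segment from \<open>p\<close> the radial field is the parameter times the
  derivative along the segment, so \<open>H\<close> is constant there.\<close>

lemma radial_derivative_zero_imp_const:
  assumes hol: "hol H (ball p \<delta>)"
    and zero: "\<And>z. z \<in> ball p \<delta> \<Longrightarrow> (\<Sum>i\<in>UNIV. (z - p) $ i * partial_deriv i H z) = 0"
    and z: "z \<in> ball p \<delta>"
  shows "H z = H p"
proof -
  define v where "v = z - p"
  define \<phi> where "\<phi> t = H (p + of_real t *s v)" for t :: real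
  have inb: "p + of_real t *s v \<in> ball p \<delta>" if "t \<in> {0..1}" for t :: real
  proof -
    have "\<bar>t\<bar> * norm v \<le> 1 * norm v"
      using that by (intro mult_right_mono) auto
    then show ?thesis
      using z by (simp add: dist_norm norm_scalar_mult_vec v_def norm_minus_commute del: vector_ssub_ldistrib)
  qed
  have der: "(\<phi> has_vector_derivative D v) (at t)"
    if "has_cderiv H D (p + of_real t *s v)" for t D
    unfolding \<phi>_def by (intro has_vector_derivative_real_field has_cderiv_line that)
  \<comment> \<open>At parameter 0 the hypothesis reads \<open>0 = 0\<close> and says nothing about
    the direction \<open>v\<close>; hence 0 is an exceptional point, where continuity
    suffices.\<close>
  have "\<phi> 1 = H p"
  proof (rule has_derivative_zero_unique_strong_interval [of "{0}" 0 1])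
    show "continuous_on {0..1} \<phi>"
    proof (rule continuous_at_imp_continuous_on, rule ballI)
      fix t :: real assume "t \<in> {0..1}"
      then obtain D where "has_cderiv H D (p + of_real t *s v)"
        using hol inb unfolding hol_def cdiff_iff by blast
      from der [OF this] show "isCont \<phi> t"
        by (rule has_vector_derivative_continuous)
    qed
    show "(\<phi> has_derivative (\<lambda>x. 0)) (at t within {0..1})" if t: "t \<in> {0..1} - {0}" for t
    proof -
      obtain D where D: "has_cderiv H D (p + of_real t *s v)"
        using hol inb [of t] t unfolding hol_def cdiff_iff by blast
      have "D (of_real t *s v) = 0"
        using zero [OF inb, of t] t has_cderiv_partials [OF D, of "of_real t *s v"] by simp
      then have "D v = 0"
        using D t unfolding has_cderiv_def by simp
      then have "(\<phi> has_vector_derivative 0) (at t within {0..1})"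
        using der [OF D] has_vector_derivative_at_within by metis
      then show ?thesis
        by (simp add: has_vector_derivative_def)
    qed
  qed (auto simp: \<phi>_def)
  then show ?thesis
    by (simp add: \<phi>_def v_def)
qed

text \<open>
  Dividing by one of the functions turns it into the constant 1, which the radial vector field
  centred at \<open>p\<close> kills; on functions modulo constants that field is injective near \<open>p\<close>, so the
  number of functions and the order to be excluded both drop by one.
\<close>

theorem exists_point_of_low_order:
  fixes f :: "nat \<Rightarrow> complex^'n \<Rightarrow> complex"
  assumes "r > 0" "\<And>k. k < N \<Longrightarrow> hol (f k) (ball w r)"
    and "\<And>c. (\<And>z. z \<in> ball w r \<Longrightarrow> (\<Sum>k<N. c k * f k z) = 0) \<Longrightarrow> \<forall>k<N. c k = 0"
  shows "\<exists>t\<in>ball w r. \<forall>c. vanishes_to UNIV N (\<lambda>z. \<Sum>k<N. c k * f k z) t \<longrightarrow> (\<forall>k<N. c k = 0)"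
  using assms
proof (induction N arbitrary: f w r)
  case 0
  then have "w \<in> ball w r"
    by simp
  then show ?case
    by blast
next
  case (Suc N)
  note hol = Suc.prems(2) and ind = Suc.prems(3)
  have "\<exists>p\<in>ball w r. f N p \<noteq> 0"
  proof (rule ccontr)
    assume "\<not> ?thesis"
    then have "\<forall>k<Suc N. (if k = N then 1 else 0 :: complex) = 0"
      by (intro ind) (auto intro!: sum.neutral)
    then show False
      by auto
  qed
  then obtain p where p: "p \<in> ball w r" "f N p \<noteq> 0"
    by blast
  have "\<exists>\<delta>>0. ball p \<delta> \<subseteq> ball w r \<and> (\<forall>z\<in>ball p \<delta>. f N z \<noteq> 0)"
  proof -
    have "isCont (f N) p"
      using hol [of N] p(1) cdiff_imp_isCont unfolding hol_def by blast
    then obtain e where e: "e > 0" "\<And>z. dist p z < e \<Longrightarrow> f N z \<noteq> 0"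
      using p(2) continuous_at_avoid by blast
    obtain d where "d > 0" "ball p d \<subseteq> ball w r"
      using p(1) open_contains_ball [of "ball w r"] open_ball by blast
    then show ?thesis
      using e by (intro exI [of _ "min d e"]) auto
  qed
  then obtain \<delta> where \<delta>: "\<delta> > 0" "ball p \<delta> \<subseteq> ball w r" "\<And>z. z \<in> ball p \<delta> \<Longrightarrow> f N z \<noteq> 0"
    by blast
  define h where "h k z = f k z / f N z" for k z
  define g where "g k z = (\<Sum>i\<in>UNIV. (z - p) $ i * partial_deriv i (h k) z)" for k z
  have hh: "hol (h k) (ball p \<delta>)" if "k < N" for k
    unfolding hol_def
  proof
    fix z assume z: "z \<in> ball p \<delta>"
    then show "complex_differentiable_at (h k) z"
      unfolding h_def using hol [of k] hol [of N] that \<delta>(2,3) by (intro cdiff_divide) (auto simp: hol_def)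
  qed
  have gh: "hol (g k) (ball p \<delta>)" if "k < N" for k
    unfolding hol_def
  proof
    fix z assume "z \<in> ball p \<delta>"
    then have "complex_differentiable_at (partial_deriv i (h k)) z" for i
      using partial_deriv_hol [OF open_ball hh [OF that]] by (auto simp: hol_def)
    then show "complex_differentiable_at (g k) z"
      unfolding g_def vector_minus_component by (intro cdiff_sum cdiff_intros)
  qed
  have lin: "partial_deriv i (\<lambda>w. \<Sum>k<N. c k * h k w) z = (\<Sum>k<N. c k * partial_deriv i (h k) z)"
    if "z \<in> ball p \<delta>" for i c z
    using foldr_partial_deriv_lincomb [OF open_ball that, of "{..<N}" h "[i]" c] hh by simp
  have radial: "(\<Sum>k<N. c k * g k z) = (\<Sum>i\<in>UNIV. (\<Sum>k<N. c k * partial_deriv i (h k) z) * (z - p) $ i)" for c z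
    unfolding g_def sum_distrib_left sum_distrib_right
    by (subst sum.swap) (simp add: mult_ac)
  have quot: "(\<Sum>k<N. c k * h k z) * f N z = (\<Sum>k<N. c k * f k z)" if "z \<in> ball p \<delta>" for c z
    using \<delta>(3) [OF that] by (simp add: h_def sum_distrib_right)
  have holsum: "hol (\<lambda>z. \<Sum>k<N. c k * h k z) (ball p \<delta>)" for c
    unfolding hol_def using hh unfolding hol_def by (intro ballI cdiff_sum cdiff_intros) auto
  have "\<exists>t\<in>ball p \<delta>. \<forall>c. vanishes_to UNIV N (\<lambda>z. \<Sum>k<N. c k * g k z) t \<longrightarrow> (\<forall>k<N. c k = 0)"
  proof (rule Suc.IH [OF \<delta>(1) gh])
    fix c assume c: "\<And>z. z \<in> ball p \<delta> \<Longrightarrow> (\<Sum>k<N. c k * g k z) = 0"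
    define H where "H z = (\<Sum>k<N. c k * h k z)" for z
    have "H z = H p" if "z \<in> ball p \<delta>" for z
    proof (rule radial_derivative_zero_imp_const [OF _ _ that])
      show "hol H (ball p \<delta>)"
        unfolding H_def by (rule holsum)
      show "(\<Sum>i\<in>UNIV. (z - p) $ i * partial_deriv i H z) = 0" if "z \<in> ball p \<delta>" for z
        using c [OF that] lin [OF that] unfolding H_def radial by (simp add: mult.commute)
    qed
    \<comment> \<open>Multiplying the constant quotient by \<open>f N\<close> gives a linear
      relation between the original functions, with minus the constant as last coefficient; the
      identity theorem extends it from the small ball to \<open>ball w r\<close>, where independence
      applies.\<close>
    then have "(\<Sum>k<N. c k * f k z) - H p * f N z = 0" if "z \<in> ball p \<delta>" for z
      using quot [OF that, of c] that by (metis H_def eq_iff_diff_eq_0)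
    then have zero: "(\<Sum>k<Suc N. (if k < N then c k else - H p) * f k z) = 0" if "z \<in> ball p \<delta>" for z
      using that by simp
    have "\<forall>k<Suc N. (if k < N then c k else - H p) = 0"
    proof (rule ind, rule hol_identity_UNIV [OF open_ball convex_ball])
      show "hol (\<lambda>z. \<Sum>k<Suc N. (if k < N then c k else - H p) * f k z) (ball w r)"
        unfolding hol_def using hol unfolding hol_def by (intro ballI cdiff_sum cdiff_intros) auto
    qed (use zero p \<delta>(1) in \<open>auto simp: dist_commute\<close>)
    then show "\<forall>k<N. c k = 0"
      by (metis less_Suc_eq)
  qed auto
  then obtain t where t: "t \<in> ball p \<delta>"
      "\<And>c. vanishes_to UNIV N (\<lambda>z. \<Sum>k<N. c k * g k z) t \<Longrightarrow> \<forall>k<N. c k = 0"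
    by blast
  have "\<forall>k<Suc N. c k = 0" if c: "vanishes_to UNIV (Suc N) (\<lambda>z. \<Sum>k<Suc N. c k * f k z) t" for c
  proof -
    define H where "H z = (\<Sum>k<N. c k * h k z)" for z
    have cN: "isCont (f N) t"
      using hol [of N] t(1) \<delta>(2) cdiff_imp_isCont unfolding hol_def by blast
    \<comment> \<open>Division by the nonvanishing \<open>f N\<close> preserves the order and turns
      the last term into the constant \<open>c N\<close>; a first derivative then removes this
      constant at the cost of one order.\<close>
    have "vanishes_to UNIV (Suc N) (\<lambda>z. (\<Sum>k<Suc N. c k * f k z) * inverse (f N z)) t"
      using \<delta>(3) [OF t(1)] by (intro vanishes_to_mult c continuous_intros cN)
    then have "vanishes_to UNIV (Suc N) (\<lambda>z. H z + c N) t"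
    proof (rule vanishes_to_cong [OF open_ball t(1), rotated])
      fix z assume "z \<in> UNIV \<inter> ball p \<delta>"
      then have z: "z \<in> ball p \<delta>"
        by simp
      show "(\<Sum>k<Suc N. c k * f k z) * inverse (f N z) = H z + c N"
        using \<delta>(3) [OF z] quot [OF z, of c] by (simp add: H_def field_simps)
    qed
    moreover have holH: "hol (\<lambda>z. H z + c N) (ball p \<delta>)"
      using holsum [of c] unfolding hol_def H_def by (auto intro: cdiff_intros)
    ultimately have "vanishes_to UNIV N (partial_deriv i (\<lambda>z. H z + c N)) t" for i
      using vanishes_to_partial_deriv [OF open_ball t(1)] by blast
    moreover have "partial_deriv i (\<lambda>z. H z + c N) z = (\<Sum>k<N. c k * partial_deriv i (h k) z)" if z: "z \<in> ball p \<delta>" for i z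
    proof -
      obtain D where D: "has_cderiv H D z"
        using holsum [of c] z unfolding hol_def H_def cdiff_iff by blast
      from has_cderiv_add [OF this has_cderiv_const] partial_deriv_eq
      have "partial_deriv i (\<lambda>z. H z + c N) z = partial_deriv i H z"
        using partial_deriv_eq [OF D] by fastforce
      moreover have "H = (\<lambda>z. \<Sum>k<N. c k * h k z)"
        by (simp add: H_def fun_eq_iff)
      ultimately show ?thesis
        using lin [OF z] by simp
    qed
    ultimately have van: "vanishes_to UNIV N (\<lambda>z. \<Sum>k<N. c k * partial_deriv i (h k) z) t" for i
      by (rule_tac vanishes_to_cong [OF open_ball t(1), of UNIV "partial_deriv i (\<lambda>z. H z + c N)" for i]) auto
    have "vanishes_to UNIV N (\<lambda>z. \<Sum>k<N. c k * g k z) t"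
      unfolding radial by (intro vanishes_to_sum vanishes_to_mult van) (intro continuous_intros)
    then have zero: "\<forall>k<N. c k = 0"
      by (rule t(2))
    \<comment> \<open>Differentiation lost the coefficient \<open>c N\<close>; it is recovered from
      the value at \<open>t\<close>.\<close>
    moreover have "(\<Sum>k<Suc N. c k * f k t) = 0"
      using vanishes_to_Suc_imp_zero [OF c] by simp
    ultimately have "c N * f N t = 0"
      by simp
    then show ?thesis
      using zero \<delta>(3) [OF t(1)] less_Suc_eq by auto
  qed
  then show ?case
    using t(1) \<delta>(2) by blast
qed

section \<open>Minors\<close>

text \<open>If some minor of size \<open>N\<close> with one column struck out is nonzero, the signed
  minors on the same rows form a kernel vector: pairing them with a row \<open>r\<close> is the
  Laplace expansion of a determinant of size \<open>Suc N\<close>, zero by hypothesis. Otherwise the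
  first column is dropped. In size 0 the hypothesis is absurd, the empty determinant being
  1.\<close>

lemma kernel_nontrivial_if_minors_zero:
  fixes M :: "'r \<Rightarrow> nat \<Rightarrow> 'a::field"
  assumes "\<And>\<rho>. (\<forall>i<N. \<rho> i \<in> R) \<Longrightarrow> det (mat N N (\<lambda>(i, k). M (\<rho> i) k)) = 0"
  shows "\<exists>c. (\<exists>k<N. c k \<noteq> 0) \<and> (\<forall>r\<in>R. (\<Sum>k<N. c k * M r k) = 0)"
  using assms
proof (induction N arbitrary: M)
  case 0
  then show ?case
    by (metis det_dim_zero mat_carrier not_less_zero zero_neq_one)
next
  case (Suc N)
  \<comment> \<open>Enumerates the columns other than \<open>j\<close>, in accordance with
    \<open>mat_delete\<close>.\<close>
  define skip :: "nat \<Rightarrow> nat \<Rightarrow> nat" where "skip j k = (if k < j then k else Suc k)" for j k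
  show ?case
  proof (cases "\<exists>\<rho> j. (\<forall>i<N. \<rho> i \<in> R) \<and> j < Suc N \<and> det (mat N N (\<lambda>(i, k). M (\<rho> i) (skip j k))) \<noteq> 0")
    case True
    then obtain \<rho> j where \<rho>: "\<And>i. i < N \<Longrightarrow> \<rho> i \<in> R"
      and j: "j < Suc N" "det (mat N N (\<lambda>(i, k). M (\<rho> i) (skip j k))) \<noteq> 0"
      by blast
    define c where "c k = (-1) ^ k * det (mat N N (\<lambda>(i, l). M (\<rho> i) (skip k l)))" for k
    have "(\<Sum>k<Suc N. c k * M r k) = 0" if r: "r \<in> R" for r
    proof -
      define A where "A = mat (Suc N) (Suc N) (\<lambda>(i, k). M (case i of 0 \<Rightarrow> r | Suc i \<Rightarrow> \<rho> i) k)"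
      have A: "A \<in> carrier_mat (Suc N) (Suc N)"
        by (simp add: A_def)
      have "det A = 0"
        unfolding A_def by (rule Suc.prems) (use \<rho> r in \<open>auto split: nat.split\<close>)
      moreover have "det A = (\<Sum>k<Suc N. A $$ (0, k) * cofactor A 0 k)"
        by (rule laplace_expansion_row [OF A]) simp
      moreover have "cofactor A 0 k = c k" if "k < Suc N" for k
      proof -
        have "mat_delete A 0 k = mat N N (\<lambda>(i, l). M (\<rho> i) (skip k l))"
          unfolding mat_delete_def by (rule eq_matI) (auto simp: A_def skip_def)
        then show ?thesis
          by (simp add: cofactor_def c_def)
      qed
      ultimately show ?thesis
        by (simp add: A_def mult.commute)
    qed
    moreover have "c j \<noteq> 0"
      using j by (simp add: c_def)
    ultimately show ?thesis
      using j(1) by blast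
  next
    case False
    have "\<exists>c. (\<exists>k<N. c k \<noteq> 0) \<and> (\<forall>r\<in>R. (\<Sum>k<N. c k * M r (Suc k)) = 0)"
    proof (rule Suc.IH)
      fix \<rho> assume "\<forall>i<N. \<rho> i \<in> R"
      then have "det (mat N N (\<lambda>(i, k). M (\<rho> i) (skip 0 k))) = 0"
        using False by blast
      then show "det (mat N N (\<lambda>(i, k). M (\<rho> i) (Suc k))) = 0"
        by (simp add: skip_def)
    qed
    then obtain c where c: "\<exists>k<N. c k \<noteq> 0" "\<forall>r\<in>R. (\<Sum>k<N. c k * M r (Suc k)) = 0"
      by blast
    show ?thesis
      using c by (intro exI [of _ "\<lambda>k. case k of 0 \<Rightarrow> 0 | Suc k \<Rightarrow> c k"]) (auto simp: sum.lessThan_Suc_shift simp del: sum.lessThan_Suc)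
  qed
qed

lemma minor_zero_if_kernel_nontrivial:
  fixes M :: "'r \<Rightarrow> nat \<Rightarrow> 'a::field"
  assumes "k < N" "c k \<noteq> 0" and zero: "\<And>i. i < N \<Longrightarrow> (\<Sum>k<N. c k * M (\<rho> i) k) = 0"
  shows "det (mat N N (\<lambda>(i, k). M (\<rho> i) k)) = 0"
proof -
  let ?A = "mat N N (\<lambda>(i, k). M (\<rho> i) k)" and ?v = "Matrix.vec N c"
  have "?v \<noteq> 0\<^sub>v N"
    using assms(1,2) by (metis index_vec index_zero_vec(1))
  moreover have "?A *\<^sub>v ?v = 0\<^sub>v N"
    using zero by (intro eq_vecI) (auto simp: scalar_prod_def atLeast0LessThan mult.commute)
  ultimately show ?thesis
    using det_0_iff_vec_prod_zero_field [of ?A N] vec_carrier [of N c] mat_carrier by blast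
qed

lemma cdiff_det:
  assumes "\<And>i k. i < N \<Longrightarrow> k < N \<Longrightarrow> complex_differentiable_at (M i k) z"
  shows "complex_differentiable_at (\<lambda>z. det (mat N N (\<lambda>(i, k). M i k z))) z"
proof -
  have "(\<lambda>z. det (mat N N (\<lambda>(i, k). M i k z))) =
      (\<lambda>z. \<Sum>p | p permutes {0..<N}. signof p * (\<Prod>i = 0..<N. M i (p i) z))"
    by (auto simp: det_def fun_eq_iff permutes_in_image intro!: sum.cong prod.cong)
  then show ?thesis
    using assms by (auto simp: permutes_in_image intro!: cdiff_sum cdiff_intros cdiff_prod)
qed

section \<open>Parametrisations\<close>

lemma holo_on_open_iff:
  assumes S: "open S"
  shows "holo_on f S \<longleftrightarrow> hol f S"
proof
  assume f: "holo_on f S"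
  show "hol f S"
    unfolding hol_def
  proof
    fix p assume p: "p \<in> S"
    obtain U F where U: "open U" "p \<in> U" "\<forall>z\<in>U. complex_differentiable_at F z" "\<forall>z\<in>S \<inter> U. f z = F z"
      using bspec [OF f [unfolded holo_on_def] p] by (elim exE conjE) (rule that)
    show "complex_differentiable_at f p"
      by (rule cdiff_transform_open [of F p "S \<inter> U"]) (use U S p in auto)
  qed
next
  assume "hol f S"
  with S show "holo_on f S"
    unfolding holo_on_def hol_def by (intro ballI exI [of _ S] exI [of _ f]) auto
qed

lemma holo_map_on_extension:
  fixes h :: "complex^'n \<Rightarrow> complex^'m"
  assumes "holo_map_on h S" "z \<in> S"
  obtains U H where "open U" "z \<in> U" "\<forall>i. hol (\<lambda>w. H w $ i) U" "\<forall>w\<in>S \<inter> U. h w = H w"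
proof -
  have "\<exists>U F. open U \<and> z \<in> U \<and> (\<forall>w\<in>U. complex_differentiable_at F w) \<and> (\<forall>w\<in>S \<inter> U. h w $ i = F w)" for i
    using assms unfolding holo_map_on_def holo_on_def by blast
  then obtain U F where U: "\<And>i. open (U i)" "\<And>i. z \<in> U i"
      "\<And>i. \<forall>w\<in>U i. complex_differentiable_at (F i) w" "\<And>i. \<forall>w\<in>S \<inter> U i. h w $ i = F i w"
    by metis
  show thesis
  proof
    show "open (\<Inter>i. U i)"
      using U(1) by auto
    show "z \<in> (\<Inter>i. U i)"
      using U(2) by auto
    show "\<forall>i. hol (\<lambda>w. (\<chi> i. F i w) $ i) (\<Inter>i. U i)"
      using U(3) by (auto simp: hol_def)
    show "\<forall>w\<in>S \<inter> (\<Inter>i. U i). h w = (\<chi> i. F i w)"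
      using U(4) by (auto simp: cart_eq_iff)
  qed
qed

lemma has_derivative_imp_Lipschitz_at:
  assumes "(H has_derivative D) (at z)"
  shows "\<exists>K>0. \<exists>e>0. \<forall>w. dist w z < e \<longrightarrow> dist (H w) (H z) \<le> K * dist w z"
proof -
  obtain B where B: "B > 0" "\<And>v. norm (D v) \<le> norm v * B"
    using has_derivative_bounded_linear [OF assms] bounded_linear.pos_bounded by blast
  have "\<exists>d>0. \<forall>y. norm (y - z) < d \<longrightarrow> norm (H y - H z - D (y - z)) \<le> 1 * norm (y - z)"
    using assms unfolding has_derivative_at_alt by (elim conjE allE [of _ 1]) simp
  then obtain d where d: "d > 0" "\<And>y. norm (y - z) < d \<Longrightarrow> norm (H y - H z - D (y - z)) \<le> 1 * norm (y - z)"
    by auto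
  have "dist (H w) (H z) \<le> (B + 1) * dist w z" if "dist w z < d" for w
  proof -
    have "norm (H w - H z) \<le> norm (H w - H z - D (w - z)) + norm (D (w - z))"
      by (metis diff_add_cancel norm_triangle_ineq)
    then show ?thesis
      using d(2) [of w] B(2) [of "w - z"] that by (simp add: dist_norm algebra_simps)
  qed
  moreover have "B + 1 > 0"
    using B by simp
  ultimately show ?thesis
    using d(1) by blast
qed

lemma holo_map_on_Lipschitz_at:
  fixes h :: "complex^'n \<Rightarrow> complex^'m"
  assumes "holo_map_on h S" "z \<in> S"
  obtains K e where "K > 0" "e > 0" "\<forall>w\<in>S. dist w z < e \<longrightarrow> dist (h w) (h z) \<le> K * dist w z"
proof -
  obtain U H where U: "open U" "z \<in> U" "\<forall>i. hol (\<lambda>w. H w $ i) U" "\<forall>w\<in>S \<inter> U. h w = H w"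
    by (rule holo_map_on_extension [OF assms])
  then obtain D where "(H has_derivative D) (at z)"
    using has_derivative_map_of_components [of H z] unfolding hol_def by blast
  then obtain K e where K: "K > 0" "e > 0" "\<forall>w. dist w z < e \<longrightarrow> dist (H w) (H z) \<le> K * dist w z"
    using has_derivative_imp_Lipschitz_at by blast
  obtain d where d: "d > 0" "ball z d \<subseteq> U"
    using U(1,2) open_contains_ball by blast
  have "dist (h w) (h z) \<le> K * dist w z" if "w \<in> S" "dist w z < min d e" for w
  proof -
    have "w \<in> U"
      using d(2) that by (auto simp: dist_commute)
    then show ?thesis
      using U(2,4) assms(2) that K(3) by auto
  qed
  then show thesis
    using that [of K "min d e"] K d by simp
qed

lemma components_cdiff_imp_isCont:
  fixes h :: "complex^'n \<Rightarrow> complex^'m"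
  assumes "\<And>i. complex_differentiable_at (\<lambda>z. h z $ i) z"
  shows "isCont h z"
  using assms by (rule has_derivative_map_of_components) (rule has_derivative_continuous)

lemma holo_map_on_continuous_on:
  fixes h :: "complex^'n \<Rightarrow> complex^'m"
  assumes "holo_map_on h S"
  shows "continuous_on S h"
  unfolding continuous_on_eq_continuous_within
proof
  fix z assume z: "z \<in> S"
  obtain U H where U: "open U" "z \<in> U" "\<forall>i. hol (\<lambda>w. H w $ i) U" "\<forall>w\<in>S \<inter> U. h w = H w"
    by (rule holo_map_on_extension [OF assms z])
  have "isCont H z"
    using U(2,3) unfolding hol_def by (intro components_cdiff_imp_isCont) blast
  then have "continuous (at z within S) H"
    by (rule continuous_at_imp_continuous_at_within)
  then show "continuous (at z within S) h"
    by (rule continuous_transform_within_openin [OF _ openin_open_Int [OF U(1)]]) (use U z in auto)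
qed

section \<open>Vanishing germs and pullback along holomorphic maps\<close>

definition zero_near :: "('a::metric_space) set \<Rightarrow> ('a \<Rightarrow> complex) \<Rightarrow> 'a \<Rightarrow> bool" where
  "zero_near S F a \<longleftrightarrow> (\<exists>e>0. \<forall>w\<in>S. dist w a < e \<longrightarrow> F w = 0)"

lemma zero_near_Int_open:
  assumes "open U" "a \<in> U"
  shows "zero_near (S \<inter> U) F a \<longleftrightarrow> zero_near S F a"
proof -
  obtain d where d: "d > 0" "ball a d \<subseteq> U"
    using assms open_contains_ball by blast
  have "zero_near S F a" if e: "e > 0" "\<forall>w\<in>S \<inter> U. dist w a < e \<longrightarrow> F w = 0" for e
    unfolding zero_near_def
  proof (intro exI [of _ "min d e"] conjI ballI impI)
    fix w assume "w \<in> S" "dist w a < min d e"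
    then show "F w = 0"
      using d e by (auto simp: dist_commute subset_iff)
  qed (use d e in auto)
  then show ?thesis
    unfolding zero_near_def by blast
qed

lemma vanishes_to_Int_open:
  assumes "open U" "a \<in> U"
  shows "vanishes_to (S \<inter> U) N F a \<longleftrightarrow> vanishes_to S N F a"
proof -
  obtain d where d: "d > 0" "ball a d \<subseteq> U"
    using assms open_contains_ball by blast
  have "vanishes_to S N F a" if e: "e > 0" "\<forall>w\<in>S \<inter> U. dist w a < e \<longrightarrow> norm (F w) \<le> C * dist w a ^ N" for e C
    unfolding vanishes_to_def
  proof (rule exI [of _ C], rule exI [of _ "min d e"], intro conjI ballI impI)
    fix w assume "w \<in> S" "dist w a < min d e"
    then show "norm (F w) \<le> C * dist w a ^ N"
      using d e by (auto simp: dist_commute subset_iff)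
  qed (use d e in auto)
  then show ?thesis
    unfolding vanishes_to_def by blast
qed

text \<open>A holomorphic map is Lipschitz at each point with some constant \<open>K\<close>, so it
  carries a bound of order \<open>N\<close> back with an extra factor \<open>K ^ N\<close>, and a
  neighbourhood of zeros back to a neighbourhood of zeros.\<close>

lemma holo_map_pullback:
  fixes h :: "complex^'n \<Rightarrow> complex^'m"
  assumes h: "holo_map_on h S" "z \<in> S" "h ` S \<subseteq> T"
  shows "vanishes_to T N F (h z) \<Longrightarrow> vanishes_to S N (\<lambda>w. F (h w)) z"
    and "zero_near T F (h z) \<Longrightarrow> zero_near S (\<lambda>w. F (h w)) z"
proof -
  obtain K d where K: "K > 0" "d > 0" "\<forall>w\<in>S. dist w z < d \<longrightarrow> dist (h w) (h z) \<le> K * dist w z"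
    by (rule holo_map_on_Lipschitz_at [OF h(1,2)])
  have near: "dist (h w) (h z) \<le> K * dist w z" "dist (h w) (h z) < e"
    if "w \<in> S" "dist w z < min d (e / K)" for w e
  proof -
    show "dist (h w) (h z) \<le> K * dist w z"
      using K(3) that by auto
    also have "\<dots> < e"
      using that K(1) by (simp add: field_simps)
    finally show "dist (h w) (h z) < e" .
  qed
  show "vanishes_to S N (\<lambda>w. F (h w)) z" if "vanishes_to T N F (h z)"
  proof -
    obtain C e where C: "C > 0" "e > 0" "\<forall>w\<in>T. dist w (h z) < e \<longrightarrow> norm (F w) \<le> C * dist w (h z) ^ N"
      by (rule vanishes_toE [OF \<open>vanishes_to T N F (h z)\<close>])
    show ?thesis
      unfolding vanishes_to_def
    proof (rule exI [of _ "C * K ^ N"], rule exI [of _ "min d (e / K)"], intro conjI ballI impI)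
      fix w assume w: "w \<in> S" "dist w z < min d (e / K)"
      have "norm (F (h w)) \<le> C * dist (h w) (h z) ^ N"
        using C(3) h(3) w near [OF w] by blast
      also have "\<dots> \<le> C * (K * dist w z) ^ N"
        using C(1) near [OF w] by (intro mult_left_mono power_mono) auto
      finally show "norm (F (h w)) \<le> C * K ^ N * dist w z ^ N"
        by (simp add: power_mult_distrib mult.assoc)
    qed (use C K in auto)
  qed
  show "zero_near S (\<lambda>w. F (h w)) z" if zn: "zero_near T F (h z)"
  proof -
    obtain e where e: "e > 0" "\<forall>w\<in>T. dist w (h z) < e \<longrightarrow> F w = 0"
      using zn unfolding zero_near_def by blast
    then show ?thesis
      unfolding zero_near_def using near(2) [of _ e] K h(3)
      by (intro exI [of _ "min d (e / K)"]) auto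
  qed
qed

lemma parametrisationE:
  fixes \<Phi> :: "complex^'n \<Rightarrow> complex^'m"
  assumes "parametrisation X W \<Phi>"
  obtains \<Psi> U where "open W" "open U" "\<Phi> ` W = X \<inter> U" "\<forall>i. hol (\<lambda>u. \<Phi> u $ i) W"
    "holo_map_on \<Phi> W" "holo_map_on \<Psi> (\<Phi> ` W)" "\<forall>u\<in>W. \<Psi> (\<Phi> u) = u"
proof -
  obtain \<Psi> where "biholomorphism W (\<Phi> ` W) \<Phi> \<Psi>" and W: "open W" and op: "openin (top_of_set X) (\<Phi> ` W)"
    using assms unfolding parametrisation_def by blast
  then have \<Psi>: "holo_map_on \<Phi> W" "holo_map_on \<Psi> (\<Phi> ` W)" "\<And>u. u \<in> W \<Longrightarrow> \<Psi> (\<Phi> u) = u"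
    unfolding biholomorphism_def by auto
  moreover have "hol (\<lambda>u. \<Phi> u $ i) W" for i
    using \<Psi>(1) holo_on_open_iff [OF W] unfolding holo_map_on_def by blast
  ultimately show thesis
    using op W that unfolding openin_open by metis
qed

text \<open>Pulling back along both \<open>\<Phi>\<close> and its inverse turns the implications
  into equivalences. Orders and germs on \<open>X\<close> can thus be computed in any
  parametrisation, and sets defined by them do not depend on the choice.\<close>

lemma parametrisation_pullback:
  fixes \<Phi> :: "complex^'n \<Rightarrow> complex^'m"
  assumes par: "parametrisation X W \<Phi>" and b: "b \<in> W"
  shows "vanishes_to X N F (\<Phi> b) \<longleftrightarrow> vanishes_to UNIV N (\<lambda>u. F (\<Phi> u)) b"
    and "zero_near X F (\<Phi> b) \<longleftrightarrow> zero_near UNIV (\<lambda>u. F (\<Phi> u)) b"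
proof -
  obtain \<Psi> U where P: "open W" "open U" "\<Phi> ` W = X \<inter> U" "holo_map_on \<Phi> W" "holo_map_on \<Psi> (\<Phi> ` W)"
      "\<forall>u\<in>W. \<Psi> (\<Phi> u) = u"
    by (rule parametrisationE [OF par])
  have bU: "\<Phi> b \<in> U"
    using P(3) b by blast
  have \<Psi>W: "\<Psi> ` (\<Phi> ` W) \<subseteq> W" "\<Phi> b \<in> \<Phi> ` W" "\<Psi> (\<Phi> b) = b"
    using P(6) b by auto
  have eq: "\<Phi> (\<Psi> w) = w" if "w \<in> \<Phi> ` W" for w
    using that P(6) by auto
  have "vanishes_to X N F (\<Phi> b) \<longleftrightarrow> vanishes_to (\<Phi> ` W) N F (\<Phi> b)"
    unfolding P(3) using vanishes_to_Int_open [OF P(2) bU] by blast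
  also have "\<dots> \<longleftrightarrow> vanishes_to W N (\<lambda>u. F (\<Phi> u)) b"
  proof
    assume "vanishes_to W N (\<lambda>u. F (\<Phi> u)) b"
    then have "vanishes_to (\<Phi> ` W) N (\<lambda>w. F (\<Phi> (\<Psi> w))) (\<Phi> b)"
      using holo_map_pullback(1) [OF P(5) \<Psi>W(2,1), of N "\<lambda>u. F (\<Phi> u)"] \<Psi>W(3) by simp
    then show "vanishes_to (\<Phi> ` W) N F (\<Phi> b)"
      by (rule vanishes_to_cong [OF open_UNIV UNIV_I, rotated]) (use eq in auto)
  qed (use holo_map_pullback(1) [OF P(4) b order_refl] in blast)
  also have "\<dots> \<longleftrightarrow> vanishes_to UNIV N (\<lambda>u. F (\<Phi> u)) b"
    using vanishes_to_Int_open [OF P(1) b, of UNIV] by simp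
  finally show "vanishes_to X N F (\<Phi> b) \<longleftrightarrow> vanishes_to UNIV N (\<lambda>u. F (\<Phi> u)) b" .
  have "zero_near X F (\<Phi> b) \<longleftrightarrow> zero_near (\<Phi> ` W) F (\<Phi> b)"
    unfolding P(3) using zero_near_Int_open [OF P(2) bU] by blast
  also have "\<dots> \<longleftrightarrow> zero_near W (\<lambda>u. F (\<Phi> u)) b"
  proof
    assume "zero_near W (\<lambda>u. F (\<Phi> u)) b"
    then have "zero_near (\<Phi> ` W) (\<lambda>w. F (\<Phi> (\<Psi> w))) (\<Phi> b)"
      using holo_map_pullback(2) [OF P(5) \<Psi>W(2,1), of "\<lambda>u. F (\<Phi> u)"] \<Psi>W(3) by simp
    then show "zero_near (\<Phi> ` W) F (\<Phi> b)"
      unfolding zero_near_def by (simp add: eq P(6))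
  qed (use holo_map_pullback(2) [OF P(4) b order_refl] in blast)
  also have "\<dots> \<longleftrightarrow> zero_near UNIV (\<lambda>u. F (\<Phi> u)) b"
    using zero_near_Int_open [OF P(1) b, of UNIV] by simp
  finally show "zero_near X F (\<Phi> b) \<longleftrightarrow> zero_near UNIV (\<lambda>u. F (\<Phi> u)) b" .
qed

lemma holo_on_subset:
  assumes "holo_on f S" "T \<subseteq> S"
  shows "holo_on f T"
  unfolding holo_on_def
proof
  fix p assume "p \<in> T"
  then have "p \<in> S"
    using assms(2) by blast
  obtain U F where "open U" "p \<in> U" "\<forall>z\<in>U. complex_differentiable_at F z" "\<forall>z\<in>S \<inter> U. f z = F z"
    using bspec [OF assms(1) [unfolded holo_on_def] \<open>p \<in> S\<close>] by (elim exE conjE) (rule that)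
  then show "\<exists>U F. open U \<and> p \<in> U \<and> (\<forall>z\<in>U. complex_differentiable_at F z) \<and> (\<forall>z\<in>T \<inter> U. f z = F z)"
    using assms(2) by (intro exI [of _ U] exI [of _ F]) auto
qed

lemma holo_map_on_subset: "holo_map_on f S \<Longrightarrow> T \<subseteq> S \<Longrightarrow> holo_map_on f T"
  unfolding holo_map_on_def using holo_on_subset by blast

lemma parametrisation_restrict:
  fixes \<Phi> :: "complex^'n \<Rightarrow> complex^'m"
  assumes par: "parametrisation X W \<Phi>" and W': "open W'" "W' \<subseteq> W"
  shows "parametrisation X W' \<Phi>"
proof -
  obtain \<Psi> U where P: "open W" "open U" "\<Phi> ` W = X \<inter> U" "holo_map_on \<Phi> W" "holo_map_on \<Psi> (\<Phi> ` W)"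
      "\<forall>u\<in>W. \<Psi> (\<Phi> u) = u"
    by (rule parametrisationE [OF par])
  have im: "\<Phi> ` W' = \<Phi> ` W \<inter> \<Psi> -` W'"
    using P(6) W'(2) by auto
  have "openin (top_of_set (\<Phi> ` W)) (\<Phi> ` W \<inter> \<Psi> -` W')"
    using continuous_openin_preimage_gen [OF holo_map_on_continuous_on [OF P(5)] W'(1)] .
  then have "openin (top_of_set X) (\<Phi> ` W')"
    unfolding im by (rule openin_trans) (simp add: P(2,3) openin_open_Int)
  moreover have "biholomorphism W' (\<Phi> ` W') \<Phi> \<Psi>"
    unfolding biholomorphism_def
  proof (intro conjI ballI)
    show "holo_map_on \<Phi> W'" "holo_map_on \<Psi> (\<Phi> ` W')"
      using P(4,5) W'(2) holo_map_on_subset by blast+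
    show "\<Psi> ` \<Phi> ` W' = W'"
      using P(6) W'(2) by (force simp: image_image)
  qed (use P(6) W'(2) in auto)
  ultimately show ?thesis
    unfolding parametrisation_def using W'(1) by blast
qed

lemma parametrisation_ball_inside:
  fixes \<Phi> :: "complex^'n \<Rightarrow> complex^'m"
  assumes par: "parametrisation X W \<Phi>" and b: "b \<in> W" and U: "openin (top_of_set X) U" "\<Phi> b \<in> U"
  obtains r where "r > 0" "ball b r \<subseteq> W" "parametrisation X (ball b r) \<Phi>" "\<Phi> ` ball b r \<subseteq> U"
proof -
  obtain O' where O': "open O'" "U = X \<inter> O'"
    using U unfolding openin_open by blast
  obtain V where P: "open W" "open V" "\<Phi> ` W = X \<inter> V" "holo_map_on \<Phi> W"
    by (rule parametrisationE [OF par])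
  have "open (W \<inter> \<Phi> -` O')"
    using continuous_open_preimage [OF holo_map_on_continuous_on [OF P(4)] P(1) O'(1)] .
  moreover have "b \<in> W \<inter> \<Phi> -` O'"
    using b U O' by blast
  ultimately obtain r where r: "r > 0" "ball b r \<subseteq> W \<inter> \<Phi> -` O'"
    using open_contains_ball by blast
  show thesis
  proof
    show "parametrisation X (ball b r) \<Phi>"
      using parametrisation_restrict [OF par] r by auto
    show "\<Phi> ` ball b r \<subseteq> U"
      using r P(3) O'(2) by blast
  qed (use r in auto)
qed

lemma linear_imp_hol:
  fixes l :: "complex^'n \<Rightarrow> complex^'m"
  assumes "Vector_Spaces.linear (*s) (*s) l"
  shows "complex_differentiable_at (\<lambda>x. l x $ i) z"
proof -
  have "(\<lambda>x. l x $ i) = (\<lambda>x. \<Sum>j\<in>UNIV. matrix l $ i $ j * x $ j)"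
    by (simp add: fun_eq_iff matrix_works [OF assms, symmetric] matrix_vector_mult_def)
  then show ?thesis
    by (simp add: cdiff_sum cdiff_intros)
qed

text \<open>A chart flattens \<open>X\<close> onto \<open>L \<inter> V\<close>; a linear isomorphism
  \<open>l\<close> from \<open>complex^'n\<close> onto \<open>L\<close>, followed by the inverse
  chart, is the parametrisation. The left inverse \<open>l'\<close> is linear on the whole space, so
  the inverse map extends holomorphically off \<open>X\<close>.\<close>

theorem parametrisation_exists:
  fixes X :: "(complex^'m) set"
  assumes X: "complex_submanifold CARD('n::finite) \<Omega> X" and a: "a \<in> X"
  obtains W \<Phi> b where "b \<in> W" "parametrisation X W (\<Phi> :: complex^'n \<Rightarrow> complex^'m)" "\<Phi> b = a"
proof -
  obtain U V f g L where U: "open U" "a \<in> U" "U \<subseteq> \<Omega>" "open V" "biholomorphism U V (f :: complex^'m \<Rightarrow> complex^'m) g"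
      and L: "vec.subspace L" "vec.dim L = CARD('n)" "f ` (X \<inter> U) = L \<inter> V"
    using X a unfolding complex_submanifold_def by metis
  have fg: "holo_map_on f U" "holo_map_on g V" "f ` U = V" "\<And>x. x \<in> U \<Longrightarrow> g (f x) = x"
    "\<And>y. y \<in> V \<Longrightarrow> f (g y) = y"
    using U(5) unfolding biholomorphism_def by auto
  have "vec.dim (UNIV :: (complex^'n) set) = vec.dim L"
    by (simp add: L(2) card_cart_basis)
  then obtain l :: "complex^'n \<Rightarrow> complex^'m" where
    l: "Vector_Spaces.linear (*s) (*s) l" "l ` UNIV = L" "inj l"
    using vec.subspace_isomorphism [OF vec.subspace_UNIV L(1)] by blast
  obtain l' where l': "Vector_Spaces.linear (*s) (*s) l'" "l' \<circ> l = id"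
    using vec.linear_injective_left_inverse [OF l(1,3)] by blast
  have l'l: "l' (l x) = x" for x
    using l'(2) by (metis comp_apply id_apply)
  have ll': "l (l' y) = y" if "y \<in> L" for y
    using that l(2) l'l by force
  define W where "W = {x. l x \<in> V}"
  define \<Phi> where "\<Phi> x = g (l x)" for x
  define \<Psi> where "\<Psi> y = l' (f y)" for y
  have "isCont l x" for x
    by (rule components_cdiff_imp_isCont) (rule linear_imp_hol [OF l(1)])
  then have contl: "continuous_on UNIV l"
    by (simp add: continuous_at_imp_continuous_on)
  then have W: "open W"
    unfolding W_def using open_vimage [OF U(4) contl] by (simp add: vimage_def)
  have fX: "f y \<in> L \<inter> V" if "y \<in> X \<inter> U" for y
    using that L(3) by blast
  have im: "\<Phi> ` W = X \<inter> U"
  proof (intro equalityI subsetI)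
    fix y assume "y \<in> \<Phi> ` W"
    then obtain x where x: "l x \<in> V" "y = g (l x)"
      by (auto simp: W_def \<Phi>_def)
    moreover have "l x \<in> L"
      using l(2) by blast
    ultimately obtain x' where "x' \<in> X \<inter> U" "l x = f x'"
      using L(3) by blast
    then show "y \<in> X \<inter> U"
      using x fg(4) by auto
  next
    fix y assume y: "y \<in> X \<inter> U"
    then have "l (l' (f y)) = f y"
      using fX ll' by blast
    then show "y \<in> \<Phi> ` W"
      using y fX [OF y] fg(4) by (auto simp: W_def \<Phi>_def image_iff intro!: exI [of _ "l' (f y)"])
  qed
  have holf: "hol (\<lambda>z. f z $ i) U" and holg: "hol (\<lambda>z. g z $ i) V" for i
    using fg(1,2) holo_on_open_iff U(1,4) unfolding holo_map_on_def by blast+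
  have \<Psi>\<Phi>: "\<Psi> (\<Phi> x) = x" if "x \<in> W" for x
    using that fg(5) by (simp add: W_def \<Phi>_def \<Psi>_def l'l)
  have "biholomorphism W (\<Phi> ` W) \<Phi> \<Psi>"
    unfolding biholomorphism_def
  proof (intro conjI ballI)
    have "hol (\<lambda>x. \<Phi> x $ i) W" for i
      unfolding hol_def
    proof
      fix x assume "x \<in> W"
      then show "complex_differentiable_at (\<lambda>x. \<Phi> x $ i) x"
        unfolding \<Phi>_def using holg [of i]
        by (intro cdiff_compose [where F = "\<lambda>y. g y $ i", OF _ linear_imp_hol [OF l(1)]]) (auto simp: hol_def W_def)
    qed
    then show "holo_map_on \<Phi> W"
      unfolding holo_map_on_def using holo_on_open_iff [OF W] by blast
    have "complex_differentiable_at (\<lambda>y. \<Psi> y $ i) y" if "y \<in> U" for y i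
      unfolding \<Psi>_def using that holf
      by (intro cdiff_compose [where F = "\<lambda>y. l' y $ i", OF linear_imp_hol [OF l'(1)]]) (auto simp: hol_def)
    then have "hol (\<lambda>y. \<Psi> y $ i) U" for i
      by (simp add: hol_def)
    then have "holo_map_on \<Psi> U"
      unfolding holo_map_on_def using holo_on_open_iff [OF U(1)] by blast
    then show "holo_map_on \<Psi> (\<Phi> ` W)"
      by (rule holo_map_on_subset) (simp add: im)
    show "\<Psi> ` \<Phi> ` W = W"
      using \<Psi>\<Phi> by (force simp: image_image)
  qed (use \<Psi>\<Phi> in auto)
  moreover have "openin (top_of_set X) (\<Phi> ` W)"
    unfolding im using U(1) by (rule openin_open_Int)
  ultimately have par: "parametrisation X W \<Phi>"
    unfolding parametrisation_def using W by blast
  obtain b where "b \<in> W" "\<Phi> b = a"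
    using im U(2) a by (metis IntI imageE)
  with par show thesis
    using that by blast
qed

section \<open>The exceptional sets\<close>

definition mono_fun :: "('m \<Rightarrow> nat) \<Rightarrow> complex^'m \<Rightarrow> complex" where
  "mono_fun \<nu> x = (\<Prod>i\<in>UNIV. x $ i ^ \<nu> i)"

definition mono_comb :: "('m \<Rightarrow> nat) set \<Rightarrow> (('m \<Rightarrow> nat) \<Rightarrow> complex) \<Rightarrow> complex^'m \<Rightarrow> complex" where
  "mono_comb B c x = (\<Sum>\<nu>\<in>B. c \<nu> * mono_fun \<nu> x)"

definition indep_near :: "(complex^'m) set \<Rightarrow> ('m \<Rightarrow> nat) set \<Rightarrow> complex^'m \<Rightarrow> bool" where
  "indep_near X B a \<longleftrightarrow> (\<forall>c. zero_near X (mono_comb B c) a \<longrightarrow> (\<forall>\<nu>\<in>B. c \<nu> = 0))"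

text \<open>Points where the jet matrix of \<open>B\<close> drops rank, expressed without charts.
  Independence is demanded at \<open>z\<close> itself: where \<open>B\<close> is dependent, some
  nontrivial combination vanishes to every order, and whole components of \<open>X\<close> would
  otherwise enter a set meant to be thin.\<close>

definition bad_set :: "(complex^'m) set \<Rightarrow> ('m \<Rightarrow> nat) set \<Rightarrow> (complex^'m) set" where
  "bad_set X B = {z\<in>X. indep_near X B z \<and>
     (\<exists>c. (\<exists>\<nu>\<in>B. c \<nu> \<noteq> 0) \<and> vanishes_to X (card B) (mono_comb B c) z)}"

lemma cdiff_mono_fun: "complex_differentiable_at (mono_fun \<nu>) z"
  unfolding mono_fun_def [abs_def] by (intro cdiff_prod cdiff_power cdiff_intros)

lemma cdiff_mono_comb: "complex_differentiable_at (mono_comb B c) z"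
  unfolding mono_comb_def [abs_def] by (intro cdiff_sum cdiff_mono_fun cdiff_intros)

lemma hol_compose_param:
  assumes "\<And>x. complex_differentiable_at F x" "\<forall>i. hol (\<lambda>u. \<Phi> u $ i) W"
  shows "hol (\<lambda>u. F (\<Phi> u)) W"
  unfolding hol_def
proof
  fix u assume "u \<in> W"
  then show "complex_differentiable_at (\<lambda>u. F (\<Phi> u)) u"
    using assms(2) unfolding hol_def by (intro cdiff_compose [OF assms(1)]) blast
qed

text \<open>By the identity theorem on the ball, a germ that is zero at one point is zero on the
  whole image. Independence of monomials near a point is therefore constant along the ball.\<close>

lemma zero_near_ball_iff:
  fixes \<Phi> :: "complex^'n \<Rightarrow> complex^'m"
  assumes par: "parametrisation X (ball b r) \<Phi>" and F: "\<And>x. complex_differentiable_at F x"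
    and u: "u \<in> ball b r"
  shows "zero_near X F (\<Phi> u) \<longleftrightarrow> (\<forall>x\<in>\<Phi> ` ball b r. F x = 0)"
proof -
  have "\<forall>i. hol (\<lambda>u. \<Phi> u $ i) (ball b r)"
    by (rule parametrisationE [OF par])
  then have h: "hol (\<lambda>u. F (\<Phi> u)) (ball b r)"
    by (rule hol_compose_param [OF F])
  have "zero_near UNIV (\<lambda>u. F (\<Phi> u)) u \<longleftrightarrow> zero_near (ball b r) (\<lambda>u. F (\<Phi> u)) u"
    using zero_near_Int_open [OF open_ball u, of UNIV] by simp
  also have "\<dots> \<longleftrightarrow> (\<forall>v\<in>ball b r. F (\<Phi> v) = 0)"
  proof
    assume "zero_near (ball b r) (\<lambda>u. F (\<Phi> u)) u"
    then obtain e where "e > 0" "\<And>v. v \<in> ball b r \<Longrightarrow> dist v u < e \<Longrightarrow> F (\<Phi> v) = 0"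
      unfolding zero_near_def by blast
    then show "\<forall>v\<in>ball b r. F (\<Phi> v) = 0"
      using hol_identity_UNIV [OF open_ball convex_ball h u] by blast
  qed (auto simp: zero_near_def intro: exI [of _ 1])
  finally show ?thesis
    using parametrisation_pullback(2) [OF par u] by auto
qed

lemma indep_near_ball_iff:
  fixes \<Phi> :: "complex^'n \<Rightarrow> complex^'m"
  assumes "parametrisation X (ball b r) \<Phi>" "u \<in> ball b r"
  shows "indep_near X B (\<Phi> u) \<longleftrightarrow>
    (\<forall>c. (\<forall>x\<in>\<Phi> ` ball b r. mono_comb B c x = 0) \<longrightarrow> (\<forall>\<nu>\<in>B. c \<nu> = 0))"
  unfolding indep_near_def zero_near_ball_iff [OF assms(1) cdiff_mono_comb assms(2)] ..

lemma parametrisation_in: "parametrisation X W \<Phi> \<Longrightarrow> u \<in> W \<Longrightarrow> \<Phi> u \<in> X"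
  unfolding parametrisation_def using openin_imp_subset by blast

text \<open>If \<open>B\<close> is independent on the ball, a point is bad exactly when the matrix
  of derivatives of order below \<open>card B\<close> of the monomials has dependent columns, that
  is, when all its maximal minors vanish; \<open>exists_point_of_low_order\<close> provides a point
  where one of them does not.\<close>

lemma bad_set_local_equations:
  fixes \<Phi> :: "complex^'n \<Rightarrow> complex^'m"
  assumes r: "r > 0" and par: "parametrisation X (ball b r) \<Phi>" and B: "finite B"
  obtains G where "finite G" "\<forall>g\<in>G. hol g (ball b r)"
    "\<forall>u\<in>ball b r. \<Phi> u \<in> bad_set X B \<longleftrightarrow> (\<forall>g\<in>G. g u = 0)"
    "\<exists>g\<in>G. \<exists>u\<in>ball b r. g u \<noteq> 0"
proof -
  have h: "\<forall>i. hol (\<lambda>u. \<Phi> u $ i) (ball b r)"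
    by (rule parametrisationE [OF par])
  have b: "b \<in> ball b r"
    using r by simp
  show thesis
  proof (cases "indep_near X B (\<Phi> b)")
    case False
    then have "\<not> indep_near X B (\<Phi> u)" if "u \<in> ball b r" for u
      using indep_near_ball_iff [OF par b] indep_near_ball_iff [OF par that] by blast
    then have "\<Phi> u \<notin> bad_set X B" if "u \<in> ball b r" for u
      using that by (simp add: bad_set_def)
    \<comment> \<open>The empty set is cut out by the constant 1, which also serves as the equation
      that is not identically zero.\<close>
    then show thesis
      using r by (intro that [of "{\<lambda>u. 1}"]) (auto simp: hol_def cdiff_intros intro!: exI [of _ b])
  next
    case True
    define N where "N = card B"
    obtain e where e: "bij_betw e {..<N} B"
      using ex_bij_betw_nat_finite [OF B] unfolding N_def atLeast0LessThan by blast
    have "inj_on e {..<N}"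
      using e by (rule bij_betw_imp_inj_on)
    then obtain e' where e': "\<forall>k\<in>{..<N}. e' (e k) = k"
      using the_inv_into_f_f by metis
    define f where "f k u = mono_fun (e k) (\<Phi> u)" for k u
    have hf: "hol (f k) (ball b r)" for k
      unfolding f_def using hol_compose_param [OF cdiff_mono_fun h] .
    have sum_eq: "mono_comb B c (\<Phi> u) = (\<Sum>k<N. c (e k) * f k u)" for c u
      unfolding mono_comb_def f_def using sum.reindex_bij_betw [OF e, of "\<lambda>\<nu>. c \<nu> * mono_fun \<nu> (\<Phi> u)"] by simp
    have sum_eq': "(\<Sum>k<N. c k * f k u) = mono_comb B (\<lambda>\<nu>. c (e' \<nu>)) (\<Phi> u)" for c u
      unfolding sum_eq using e' by (intro sum.cong) auto
    define M where "M is k = foldr partial_deriv is (f k)" for "is" k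
    \<comment> \<open>Index set of the rows of the jet matrix. A mixed derivative occurs once for
      each ordering of its indices, which changes neither the kernel nor whether all maximal minors
      vanish.\<close>
    define R where "R = {is :: 'n list. length is < N}"
    have finR: "finite R"
    proof (rule finite_subset)
      show "R \<subseteq> {is. set is \<subseteq> UNIV \<and> length is \<le> N}"
        by (auto simp: R_def)
      show "finite {is :: 'n list. set is \<subseteq> UNIV \<and> length is \<le> N}"
        by (rule finite_lists_length_le) simp
    qed
    define g where "g \<rho> u = det (mat N N (\<lambda>(i, k). M (\<rho> i) k u))" for \<rho> u
    have hg: "hol (g \<rho>) (ball b r)" for \<rho>
      unfolding hol_def
    proof
      fix u assume u: "u \<in> ball b r"
      show "complex_differentiable_at (g \<rho>) u"
        unfolding g_def [abs_def] using foldr_partial_deriv_hol [OF open_ball hf] u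
        by (intro cdiff_det) (auto simp: M_def hol_def)
    qed
    have van: "vanishes_to UNIV N (\<lambda>u. \<Sum>k<N. c k * f k u) u \<longleftrightarrow> (\<forall>is\<in>R. (\<Sum>k<N. c k * M is k u) = 0)"
      if u: "u \<in> ball b r" for c u
    proof -
      have "hol (\<lambda>u. \<Sum>k<N. c k * f k u) (ball b r)"
        unfolding hol_def using hf unfolding hol_def by (intro ballI cdiff_sum cdiff_intros) auto
      from vanishes_to_iff_partial_derivs [OF open_ball u this] show ?thesis
        unfolding foldr_partial_deriv_lincomb [OF open_ball u hf]
        by (simp add: R_def M_def)
    qed
    have bad: "\<Phi> u \<in> bad_set X B \<longleftrightarrow>
        (\<exists>c. (\<exists>k<N. c k \<noteq> 0) \<and> vanishes_to UNIV N (\<lambda>u. \<Sum>k<N. c k * f k u) u)"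
      if u: "u \<in> ball b r" for u
    proof -
      have "indep_near X B (\<Phi> u)"
        using True unfolding indep_near_ball_iff [OF par b] indep_near_ball_iff [OF par u] .
      then have "\<Phi> u \<in> bad_set X B \<longleftrightarrow>
          (\<exists>c. (\<exists>\<nu>\<in>B. c \<nu> \<noteq> 0) \<and> vanishes_to UNIV N (\<lambda>u. \<Sum>k<N. c (e k) * f k u) u)"
        using parametrisation_in [OF par u] parametrisation_pullback(1) [OF par u]
        by (simp add: bad_set_def sum_eq N_def)
      also have "\<dots> \<longleftrightarrow> (\<exists>c. (\<exists>k<N. c k \<noteq> 0) \<and> vanishes_to UNIV N (\<lambda>u. \<Sum>k<N. c k * f k u) u)"
      proof (intro iffI; elim exE conjE bexE)
        fix c \<nu> assume c: "\<nu> \<in> B" "c \<nu> \<noteq> 0" "vanishes_to UNIV N (\<lambda>u. \<Sum>k<N. c (e k) * f k u) u"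
        obtain k where "k < N" "\<nu> = e k"
          using e c(1) unfolding bij_betw_def by auto
        then show "\<exists>c. (\<exists>k<N. c k \<noteq> 0) \<and> vanishes_to UNIV N (\<lambda>u. \<Sum>k<N. c k * f k u) u"
          using c by (intro exI [of _ "\<lambda>k. c (e k)"]) auto
      next
        fix c k assume c: "k < N" "c k \<noteq> 0" "vanishes_to UNIV N (\<lambda>u. \<Sum>k<N. c k * f k u) u"
        let ?c = "\<lambda>\<nu>. c (e' \<nu>)"
        have "e k \<in> B" "?c (e k) \<noteq> 0"
          using c e' bij_betwE [OF e] by auto
        moreover have "vanishes_to UNIV N (\<lambda>u. \<Sum>k<N. ?c (e k) * f k u) u"
        proof -
          have "(\<lambda>u. \<Sum>k<N. ?c (e k) * f k u) = (\<lambda>u. \<Sum>k<N. c k * f k u)"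
            using e' by (intro ext sum.cong) auto
          then show ?thesis
            using c(3) by simp
        qed
        ultimately show "\<exists>c. (\<exists>\<nu>\<in>B. c \<nu> \<noteq> 0) \<and> vanishes_to UNIV N (\<lambda>u. \<Sum>k<N. c (e k) * f k u) u"
          by (intro exI [of _ ?c] conjI bexI [of _ "e k"])
      qed
      finally show ?thesis .
    qed
    \<comment> \<open>Extensional row selections make \<open>G\<close> finite; a minor depends only
      on the values below \<open>N\<close>.\<close>
    define G where "G = g ` ({..<N} \<rightarrow>\<^sub>E R)"
    have bad_iff: "\<Phi> u \<in> bad_set X B \<longleftrightarrow> (\<forall>q\<in>G. q u = 0)" if u: "u \<in> ball b r" for u
      unfolding bad [OF u] van [OF u]
    proof
      assume "\<exists>c. (\<exists>k<N. c k \<noteq> 0) \<and> (\<forall>is\<in>R. (\<Sum>k<N. c k * M is k u) = 0)"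
      then obtain c k where c: "k < N" "c k \<noteq> 0" "\<forall>is\<in>R. (\<Sum>k<N. c k * M is k u) = 0"
        by blast
      have "g \<rho> u = 0" if "\<rho> \<in> {..<N} \<rightarrow>\<^sub>E R" for \<rho>
        unfolding g_def
        by (rule minor_zero_if_kernel_nontrivial [where M = "\<lambda>is k. M is k u" and c = c and k = k])
          (use c that in \<open>auto simp: PiE_iff\<close>)
      then show "\<forall>q\<in>G. q u = 0"
        by (auto simp: G_def)
    next
      assume G: "\<forall>q\<in>G. q u = 0"
      show "\<exists>c. (\<exists>k<N. c k \<noteq> 0) \<and> (\<forall>is\<in>R. (\<Sum>k<N. c k * M is k u) = 0)"
      proof (rule kernel_nontrivial_if_minors_zero [where M = "\<lambda>is k. M is k u"])
        fix \<rho> assume "\<forall>i<N. \<rho> i \<in> R"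
        define \<rho>' where "\<rho>' i = (if i < N then \<rho> i else undefined)" for i
        have "\<rho>' \<in> {..<N} \<rightarrow>\<^sub>E R"
          using \<open>\<forall>i<N. \<rho> i \<in> R\<close> by (auto simp: \<rho>'_def PiE_iff extensional_def)
        then have "g \<rho>' u = 0"
          using G by (auto simp: G_def)
        moreover have "mat N N (\<lambda>(i, k). M (\<rho>' i) k u) = mat N N (\<lambda>(i, k). M (\<rho> i) k u)"
          by (rule eq_matI) (auto simp: \<rho>'_def)
        ultimately show "det (mat N N (\<lambda>(i, k). M (\<rho> i) k u)) = 0"
          by (simp add: g_def)
      qed
    qed
    have "\<exists>t\<in>ball b r. \<forall>c. vanishes_to UNIV N (\<lambda>u. \<Sum>k<N. c k * f k u) t \<longrightarrow> (\<forall>k<N. c k = 0)"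
    proof (rule exists_point_of_low_order [OF r hf])
      fix c assume "\<And>u. u \<in> ball b r \<Longrightarrow> (\<Sum>k<N. c k * f k u) = 0"
      then have "\<forall>x\<in>\<Phi> ` ball b r. mono_comb B (\<lambda>\<nu>. c (e' \<nu>)) x = 0"
        unfolding sum_eq' by blast
      then have *: "\<forall>\<nu>\<in>B. c (e' \<nu>) = 0"
        using True indep_near_ball_iff [OF par b] by blast
      show "\<forall>k<N. c k = 0"
      proof (intro allI impI)
        fix k assume "k < N"
        then show "c k = 0"
          using *[rule_format, of "e k"] \<open>k < N\<close> e' bij_betwE [OF e] by auto
      qed
    qed
    then obtain t where t: "t \<in> ball b r" "\<Phi> t \<notin> bad_set X B"
      using bad by blast
    show thesis
    proof (rule that)
      show "finite G"
        unfolding G_def using finR by (intro finite_imageI finite_PiE) auto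
      show "\<forall>g\<in>G. hol g (ball b r)"
        using hg by (auto simp: G_def)
      show "\<forall>u\<in>ball b r. \<Phi> u \<in> bad_set X B \<longleftrightarrow> (\<forall>g\<in>G. g u = 0)"
        using bad_iff by blast
      show "\<exists>g\<in>G. \<exists>u\<in>ball b r. g u \<noteq> 0"
        using t bad_iff by blast
    qed
  qed
qed

lemma closedin_local:
  assumes "T \<subseteq> X" "\<And>a. a \<in> X \<Longrightarrow> \<exists>U. openin (top_of_set X) U \<and> a \<in> U \<and> closedin (top_of_set U) (T \<inter> U)"
  shows "closedin (top_of_set X) T"
proof -
  have "openin (top_of_set X) (X - T)"
  proof (subst openin_subopen, intro ballI)
    fix a assume a: "a \<in> X - T"
    then obtain U where U: "openin (top_of_set X) U" "a \<in> U" "closedin (top_of_set U) (T \<inter> U)"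
      using assms(2) by blast
    have "openin (top_of_set U) (U - T)"
      using U(3) unfolding closedin_def by (simp add: Diff_Int2 Int_commute Diff_Int_distrib2) (metis Diff_Int2 Diff_Int Diff_cancel sup_bot.right_neutral)
    then have "openin (top_of_set X) (U - T)"
      using U(1) openin_trans by blast
    then show "\<exists>V. openin (top_of_set X) V \<and> a \<in> V \<and> V \<subseteq> X - T"
      using a U(2) openin_imp_subset [OF U(1)] by blast
  qed
  then show ?thesis
    using assms(1) by (simp add: closedin_def)
qed

text \<open>The equations on the parameter ball are moved to \<open>X\<close> by the inverse
  \<open>\<Psi>\<close> of the parametrisation.\<close>

lemma closed_analytic_bad_set:
  fixes X :: "(complex^'m) set"
  assumes X: "complex_submanifold CARD('n::finite) \<Omega> X" and B: "finite B"
  shows "closed_analytic_subset X (bad_set X B)"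
proof -
  have local: "\<exists>U G. open U \<and> a \<in> U \<and> finite G \<and> (\<forall>g\<in>G. holo_on g (X \<inter> U)) \<and>
        bad_set X B \<inter> U = {z \<in> X \<inter> U. \<forall>g\<in>G. g z = 0}" if a: "a \<in> X" for a
  proof -
    obtain W \<Phi> b where W: "b \<in> W" "parametrisation X W (\<Phi> :: complex^'n \<Rightarrow> complex^'m)" "\<Phi> b = a"
      by (rule parametrisation_exists [OF X a])
    obtain r where r: "r > 0" "parametrisation X (ball b r) \<Phi>"
      by (rule parametrisation_ball_inside [OF W(2,1) openin_subtopology_self]) (use a W in auto)
    obtain \<Psi> U where P: "open U" "\<Phi> ` ball b r = X \<inter> U" "holo_map_on \<Psi> (\<Phi> ` ball b r)"
      "\<forall>u\<in>ball b r. \<Psi> (\<Phi> u) = u"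
      by (rule parametrisationE [OF r(2)])
    obtain G where G: "finite G" "\<forall>g\<in>G. hol g (ball b r)"
      "\<forall>u\<in>ball b r. \<Phi> u \<in> bad_set X B \<longleftrightarrow> (\<forall>g\<in>G. g u = 0)"
      by (rule bad_set_local_equations [OF r B])
    have \<Psi>in: "\<Psi> z \<in> ball b r" "\<Phi> (\<Psi> z) = z" if "z \<in> X \<inter> U" for z
      using that P(4) unfolding P(2) [symmetric] by auto
    have "holo_on (\<lambda>z. g (\<Psi> z)) (X \<inter> U)" if g: "g \<in> G" for g
      unfolding holo_on_def
    proof
      fix p assume p: "p \<in> X \<inter> U"
      obtain V H where V: "open V" "p \<in> V" "\<forall>i. hol (\<lambda>w. H w $ i) V" "\<forall>w\<in>(X \<inter> U) \<inter> V. \<Psi> w = H w"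
        by (rule holo_map_on_extension [OF P(3) [unfolded P(2)] p])
      have "continuous_on V H"
      proof (rule continuous_at_imp_continuous_on, rule ballI)
        fix w assume "w \<in> V"
        then show "isCont H w"
          using V(3) unfolding hol_def by (intro components_cdiff_imp_isCont) blast
      qed
      \<comment> \<open>Holomorphy on \<open>X\<close> asks for an extension to an ambient open set.
        The extension \<open>H\<close> of \<open>\<Psi>\<close> may leave the ball on which
        \<open>g\<close> is holomorphic, hence the restriction to the preimage.\<close>
      then have op: "open (V \<inter> H -` ball b r)"
        using continuous_open_preimage V(1) open_ball by blast
      moreover have "p \<in> V \<inter> H -` ball b r"
        using V p \<Psi>in [OF p] by auto
      moreover have "complex_differentiable_at (\<lambda>z. g (H z)) w" if "w \<in> V \<inter> H -` ball b r" for w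
      proof (rule cdiff_compose)
        show "complex_differentiable_at g (H w)"
          using G(2) g that unfolding hol_def by blast
        show "complex_differentiable_at (\<lambda>z. H z $ i) w" for i
          using V(3) that unfolding hol_def by blast
      qed
      ultimately show "\<exists>U' F. open U' \<and> p \<in> U' \<and> (\<forall>z\<in>U'. complex_differentiable_at F z) \<and>
          (\<forall>z\<in>X \<inter> U \<inter> U'. g (\<Psi> z) = F z)"
        using V(4) by (intro exI [of _ "V \<inter> H -` ball b r"] exI [of _ "\<lambda>z. g (H z)"]) auto
    qed
    moreover have "bad_set X B \<inter> U = {z \<in> X \<inter> U. \<forall>h\<in>(\<lambda>g z. g (\<Psi> z)) ` G. h z = 0}"
    proof -
      have "z \<in> bad_set X B \<longleftrightarrow> (\<forall>g\<in>G. g (\<Psi> z) = 0)" if "z \<in> X \<inter> U" for z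
        using G(3) \<Psi>in [OF that] by metis
      moreover have "bad_set X B \<subseteq> X"
        by (auto simp: bad_set_def)
      ultimately show ?thesis
        by auto
    qed
    moreover have "a \<in> U"
      using P(2) W(3) r(1) by (metis Int_iff centre_in_ball imageI)
    ultimately show ?thesis
      using P(1) G(1) by (intro exI [of _ U] exI [of _ "(\<lambda>g z. g (\<Psi> z)) ` G"]) auto
  qed
  moreover have "closedin (top_of_set X) (bad_set X B)"
  proof (rule closedin_local)
    show "bad_set X B \<subseteq> X"
      by (auto simp: bad_set_def)
    fix a assume "a \<in> X"
    from local [OF this] obtain U G where U: "open U" "a \<in> U" "finite G" "\<forall>g\<in>G. holo_on g (X \<inter> U)"
        "bad_set X B \<inter> U = {z \<in> X \<inter> U. \<forall>g\<in>G. g z = 0}"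
      by (elim exE conjE) (rule that)
    have cont: "continuous_on (X \<inter> U) g" if "g \<in> G" for g
    proof -
      \<comment> \<open>A scalar function is read as a map to \<open>complex^1\<close>, so that
        continuity of holomorphic maps applies.\<close>
      have "holo_map_on (\<lambda>z. vector [g z] :: complex^1) (X \<inter> U)"
        unfolding holo_map_on_def using U(4) that by (auto simp: forall_1)
      then have "continuous_on (X \<inter> U) (\<lambda>z. (vector [g z] :: complex^1) $ 1)"
        by (intro continuous_intros holo_map_on_continuous_on)
      then show ?thesis
        by simp
    qed
    have "closedin (top_of_set (X \<inter> U)) (\<Inter>g\<in>G. {z \<in> X \<inter> U. g z = 0})" if "G \<noteq> {}"
      by (rule closedin_INT [OF that]) (intro continuous_closedin_preimage_constant cont)
    \<comment> \<open>For \<open>G = {}\<close> the indexed intersection would be the whole space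
      instead of \<open>X \<inter> U\<close>.\<close>
    moreover have "bad_set X B \<inter> (X \<inter> U) = (if G = {} then X \<inter> U else (\<Inter>g\<in>G. {z \<in> X \<inter> U. g z = 0}))"
    proof -
      have "bad_set X B \<inter> (X \<inter> U) = bad_set X B \<inter> U"
        by (auto simp: bad_set_def)
      then show ?thesis
        unfolding U(5) by auto
    qed
    ultimately have "closedin (top_of_set (X \<inter> U)) (bad_set X B \<inter> (X \<inter> U))"
      by (auto split: if_splits)
    then show "\<exists>U. openin (top_of_set X) U \<and> a \<in> U \<and> closedin (top_of_set U) (bad_set X B \<inter> U)"
      using U(1,2) \<open>a \<in> X\<close> openin_open_Int [of U X] by blast
  qed
  ultimately show ?thesis
    unfolding closed_analytic_subset_def by blast
qed

text \<open>An interior point would give a parametrised ball inside the set, on which every local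
  equation vanishes identically; but one of them does not.\<close>

theorem thin_bad_set:
  fixes X :: "(complex^'m) set"
  assumes X: "complex_submanifold CARD('n::finite) \<Omega> X" and B: "finite B"
  shows "thin_analytic_subset X (bad_set X B)"
proof -
  have ca: "closed_analytic_subset X (bad_set X B)"
    by (rule closed_analytic_bad_set [OF assms])
  then have cl: "top_of_set X closure_of bad_set X B = bad_set X B"
    unfolding closed_analytic_subset_def using closure_of_closedin by blast
  have "top_of_set X interior_of bad_set X B = {}"
  proof (rule ccontr)
    assume "top_of_set X interior_of bad_set X B \<noteq> {}"
    then obtain a where a: "a \<in> top_of_set X interior_of bad_set X B"
      by blast
    have op: "openin (top_of_set X) (top_of_set X interior_of bad_set X B)"
      by simp
    have "a \<in> X"
      using a openin_imp_subset [OF op] by blast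
    obtain W \<Phi> b where W: "b \<in> W" "parametrisation X W (\<Phi> :: complex^'n \<Rightarrow> complex^'m)" "\<Phi> b = a"
      by (rule parametrisation_exists [OF X \<open>a \<in> X\<close>])
    obtain r where r: "r > 0" "parametrisation X (ball b r) \<Phi>"
        and sub: "\<Phi> ` ball b r \<subseteq> top_of_set X interior_of bad_set X B"
      by (rule parametrisation_ball_inside [OF W(2,1) op]) (use a W in auto)
    obtain G where "finite G" "\<forall>g\<in>G. hol g (ball b r)"
      "\<forall>u\<in>ball b r. \<Phi> u \<in> bad_set X B \<longleftrightarrow> (\<forall>g\<in>G. g u = 0)" "\<exists>g\<in>G. \<exists>u\<in>ball b r. g u \<noteq> 0"
      by (rule bad_set_local_equations [OF r B])
    moreover have "\<Phi> ` ball b r \<subseteq> bad_set X B"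
      using sub interior_of_subset by (rule subset_trans)
    ultimately show False
      by blast
  qed
  then show ?thesis
    unfolding thin_analytic_subset_def nowhere_dense_in_def cl using ca by (auto simp: bad_set_def)
qed

section \<open>Null sets\<close>

text \<open>A closed set that meets every ray from a fixed point \<open>a\<close> at most once is
  negligible. With \<open>a\<close> one unit from \<open>u0\<close> along axis \<open>i\<close>, the
  rays near \<open>u0\<close> point roughly in direction \<open>i\<close>, and along them the real
  part of the normalised function is strictly increasing.\<close>

lemma negligible_zero_set_local:
  fixes h :: "complex^'n \<Rightarrow> complex"
  assumes S: "open S" "u0 \<in> S" and hol: "hol h S" and i: "partial_deriv i h u0 \<noteq> 0"
  shows "\<exists>e>0. negligible {u \<in> cball u0 e. h u = 0}"
proof -
  define \<alpha> where "\<alpha> = partial_deriv i h u0"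
  \<comment> \<open>Normalised so that the derivative in direction \<open>i\<close> at
    \<open>u0\<close> is 1; its real part then stays positive nearby.\<close>
  define g where "g z = inverse \<alpha> * h z" for z
  have \<alpha>: "\<alpha> \<noteq> 0"
    using i by (simp add: \<alpha>_def)
  have holg: "hol g S"
    using hol unfolding hol_def g_def by (intro ballI cdiff_intros) auto
  have gi: "partial_deriv i g u0 = 1"
  proof -
    obtain D where D: "has_cderiv h D u0"
      using hol S(2) unfolding hol_def cdiff_iff by blast
    have "has_cderiv g (\<lambda>v. inverse \<alpha> * D v) u0"
      unfolding g_def by (rule has_cderiv_cmult [OF D])
    then have "partial_deriv i g u0 = inverse \<alpha> * D (axis i 1)"
      by (rule partial_deriv_eq)
    then show ?thesis
      using \<alpha> partial_deriv_eq [OF D, of i] by (simp add: \<alpha>_def)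
  qed
  define v0 where "v0 = (axis i 1 :: complex^'n)"
  \<comment> \<open>The derivative of \<open>Re g\<close> at the point \<open>fst p\<close> in
    direction \<open>snd p\<close>.\<close>
  define K where "K p = Re (\<Sum>j\<in>UNIV. snd p $ j * partial_deriv j g (fst p))" for p :: "(complex^'n) \<times> (complex^'n)"
  have K0: "K (u0, v0) = 1"
  proof -
    have "(\<Sum>j\<in>UNIV. v0 $ j * partial_deriv j g u0) = (\<Sum>j\<in>UNIV. if j = i then 1 else 0)"
      by (intro sum.cong) (auto simp: v0_def gi axis_def)
    then show ?thesis
      by (simp add: K_def)
  qed
  have "isCont K (u0, v0)"
  proof -
    have "isCont (partial_deriv j g) u0" for j
      using partial_deriv_hol [OF S(1) holg] S(2) cdiff_imp_isCont unfolding hol_def by blast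
    then have cont: "isCont (\<lambda>p. partial_deriv j g (fst p)) (u0, v0)" for j
      by (intro isCont_o2 [where f = fst and g = "partial_deriv j g"] continuous_intros) simp
    show ?thesis
      unfolding K_def [abs_def] isCont_def
      by (intro tendsto_intros cont [unfolded isCont_def])
  qed
  then obtain d where d: "d > 0" "\<And>p. dist p (u0, v0) < d \<Longrightarrow> dist (K p) (K (u0, v0)) < 1"
    unfolding continuous_at_eps_delta by (elim allE [of _ 1]) auto
  obtain s where s: "s > 0" "cball u0 s \<subseteq> S"
    using S open_contains_cball by blast
  \<comment> \<open>Base point and direction each move by at most \<open>e\<close>, so
    \<open>2 * e < d\<close> keeps the pair within distance \<open>d\<close>.\<close>
  define e where "e = min s (d / 3)"
  have e: "e > 0" "e \<le> s" "2 * e < d"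
    using s d by (auto simp: e_def)
  define a where "a = u0 - v0"
  have pos: "K (w, x) > 0" if "w \<in> cball u0 e" "a + x \<in> cball u0 e" for w x
  proof -
    have "dist x v0 \<le> e" "dist w u0 \<le> e"
      using that by (auto simp: a_def dist_norm norm_minus_commute algebra_simps)
    then have "dist (w, x) (u0, v0) < d"
      using e sqrt_sum_squares_le_sum [of "dist w u0" "dist x v0"] by (simp add: dist_prod_def)
    then have "dist (K (w, x)) 1 < 1"
      using d(2) K0 by metis
    then show ?thesis
      by (simp add: dist_real_def)
  qed
  have "negligible {u \<in> cball u0 e. h u = 0}"
  proof (rule starlike_negligible)
    have "continuous_on (cball u0 e) h"
      using hol_imp_continuous_on [OF hol] s(2) e(2) continuous_on_subset subset_cball by blast
    then show "closed {u \<in> cball u0 e. h u = 0}"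
      by (rule continuous_closed_preimage_constant) simp
    fix c x
    assume cx: "a + c *\<^sub>R x \<in> {u \<in> cball u0 e. h u = 0}" "a + x \<in> {u \<in> cball u0 e. h u = 0}"
    define \<phi> where "\<phi> t = Re (g (a + of_real t *s x))" for t
    have der: "(\<phi> has_real_derivative K (a + t *\<^sub>R x, x)) (at t)" if t: "a + t *\<^sub>R x \<in> cball u0 e" for t
    proof -
      have "a + of_real t *s x \<in> S"
        using t s(2) e(2) subset_cball [of e s u0] by (auto simp flip: scaleR_eq_smult)
      then obtain D where D: "has_cderiv g D (a + of_real t *s x)"
        using holg unfolding hol_def cdiff_iff by blast
      have "((\<lambda>t. g (a + of_real t *s x)) has_vector_derivative D x) (at t)"
        by (intro has_vector_derivative_real_field has_cderiv_line D)
      then have "(\<phi> has_vector_derivative Re (D x)) (at t)"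
        unfolding \<phi>_def by (rule bounded_linear.has_vector_derivative [OF bounded_linear_Re])
      moreover have "Re (D x) = K (a + t *\<^sub>R x, x)"
        unfolding K_def has_cderiv_partials [OF D] by (simp add: scaleR_eq_smult)
      ultimately show ?thesis
        by (simp add: has_real_derivative_iff_has_vector_derivative)
    qed
    have zero: "\<phi> c = 0" "\<phi> 1 = 0"
      using cx by (simp_all add: \<phi>_def g_def flip: scaleR_eq_smult)
    \<comment> \<open>Two zeros on one ray would by Rolle yield a point of the segment with
      derivative 0; the segment lies in the convex ball, where the derivative is positive.\<close>
    have no_root: False if st: "s < t" "\<phi> s = 0" "\<phi> t = 0" "a + s *\<^sub>R x \<in> cball u0 e" "a + t *\<^sub>R x \<in> cball u0 e" for s t
    proof -
      have seg: "a + \<tau> *\<^sub>R x \<in> cball u0 e" if "s \<le> \<tau>" "\<tau> \<le> t" for \<tau>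
      proof -
        define \<mu> where "\<mu> = (\<tau> - s) / (t - s)"
        have "\<mu> * (t - s) = \<tau> - s"
          using st(1) by (simp add: \<mu>_def)
        then have \<mu>: "\<tau> = (1 - \<mu>) * s + \<mu> * t"
          by (simp add: algebra_simps)
        have \<mu>01: "0 \<le> \<mu>" "\<mu> \<le> 1"
          using that st(1) by (auto simp: \<mu>_def)
        have "a + \<tau> *\<^sub>R x = (1 - \<mu>) *\<^sub>R (a + s *\<^sub>R x) + \<mu> *\<^sub>R (a + t *\<^sub>R x)"
          unfolding \<mu> by (simp add: algebra_simps)
        then show ?thesis
          using convexD [OF convex_cball st(4,5), of "1 - \<mu>" \<mu>] \<mu>01 by simp
      qed
      have "\<exists>z. s < z \<and> z < t \<and> DERIV \<phi> z :> 0"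
      proof (rule Rolle)
        show "continuous_on {s..t} \<phi>"
          using der seg DERIV_isCont by (intro continuous_at_imp_continuous_on) fastforce
        show "\<phi> differentiable (at z)" if "s < z" "z < t" for z
          using der [OF seg] that real_differentiable_def by (meson less_imp_le)
      qed (use st in auto)
      then obtain z where z: "s < z" "z < t" "DERIV \<phi> z :> 0"
        by blast
      then have "K (a + z *\<^sub>R x, x) = 0"
        using der [OF seg, of z] DERIV_unique by fastforce
      moreover have "K (a + z *\<^sub>R x, x) > 0"
        using z cx(2) by (intro pos seg) auto
      ultimately show False
        by simp
    qed
    show "c = 1"
      using no_root [of c 1] no_root [of 1 c] zero cx by fastforce
  qed
  then show ?thesis
    using e(1) by blast
qed

text \<open>Every zero has finite order, so some iterated derivative vanishes there while one of its
  partial derivatives does not. This covers the zero set by countably many pieces, each locally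
  inside a set treated by \<open>negligible_zero_set_local\<close>.\<close>

theorem negligible_zero_set:
  fixes g :: "complex^'n \<Rightarrow> complex"
  assumes hol: "hol g (ball b r)" and nz: "u1 \<in> ball b r" "g u1 \<noteq> 0"
  shows "negligible {u \<in> ball b r. g u = 0}"
proof -
  define Z where "Z p = {u \<in> ball b r. foldr partial_deriv (fst p) g u = 0 \<and>
      partial_deriv (snd p) (foldr partial_deriv (fst p) g) u \<noteq> 0}" for p :: "'n list \<times> 'n"
  have "negligible (Z p)" for p
  proof (subst locally_negligible_alt, rule ballI)
    fix u assume u: "u \<in> Z p"
    then obtain e where e: "e > 0" "negligible {v \<in> cball u e. foldr partial_deriv (fst p) g v = 0}"
      using negligible_zero_set_local [OF open_ball _ foldr_partial_deriv_hol [OF open_ball hol]]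
      unfolding Z_def by blast
    have "negligible (Z p \<inter> ball u e)"
      by (rule negligible_subset [OF e(2)]) (auto simp: Z_def)
    then show "\<exists>U. openin (top_of_set (Z p)) U \<and> u \<in> U \<and> negligible U"
      using u e(1) by (intro exI [of _ "Z p \<inter> ball u e"]) (auto intro: openin_open_Int)
  qed
  moreover have "countable (Z ` UNIV)"
  proof -
    have "countable (lists (UNIV :: 'n set) \<times> (UNIV :: 'n set))"
      by (intro countable_SIGMA countable_lists countable_finite) auto
    then show ?thesis
      by (intro countable_image) (simp add: lists_UNIV)
  qed
  ultimately have neg: "negligible (\<Union>(Z ` UNIV))"
    by (intro negligible_countable_Union) auto
  have "{u \<in> ball b r. g u = 0} \<subseteq> \<Union>(Z ` UNIV)"
  proof
    fix u assume "u \<in> {u \<in> ball b r. g u = 0}"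
    then have u: "u \<in> ball b r" "g u = 0"
      by auto
    have "\<exists>is. foldr partial_deriv is g u \<noteq> 0"
    proof (rule ccontr)
      assume "\<not> ?thesis"
      then have "vanishes_to UNIV N g u" for N
        using vanishes_to_iff_partial_derivs [OF open_ball u(1) hol] by blast
      then show False
        using hol_flat_imp_zero [OF open_ball convex_ball hol u(1) nz(1)] nz(2) by blast
    qed
    \<comment> \<open>A shortest list with nonzero derivative: dropping its head, the outermost
      differentiation, leaves a function that vanishes at \<open>u\<close>.\<close>
    then obtain ks where ks: "foldr partial_deriv ks g u \<noteq> 0"
        and min: "\<And>ls. foldr partial_deriv ls g u \<noteq> 0 \<Longrightarrow> length ks \<le> length ls"
      using ex_has_least_nat [of "\<lambda>is. foldr partial_deriv is g u \<noteq> 0" _ length] by blast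
    show "u \<in> \<Union>(Z ` UNIV)"
    proof (cases ks)
      case Nil
      then show ?thesis
        using ks u(2) by simp
    next
      case (Cons i js)
      have "foldr partial_deriv js g u = 0"
        using min [of js] Cons by auto
      then have "u \<in> Z (js, i)"
        using ks u(1) Cons by (simp add: Z_def)
      then show ?thesis
        by blast
    qed
  qed
  then show ?thesis
    using neg negligible_subset by blast
qed

lemma negligible_bad_set:
  fixes \<Phi> :: "complex^'n \<Rightarrow> complex^'m"
  assumes par: "parametrisation X W \<Phi>" and B: "finite B"
  shows "negligible {z \<in> W. \<Phi> z \<in> bad_set X B}"
proof (subst locally_negligible_alt, rule ballI)
  let ?S = "{z \<in> W. \<Phi> z \<in> bad_set X B}"
  fix u assume u: "u \<in> ?S"
  then have uW: "u \<in> W"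
    by simp
  obtain r where r: "r > 0" "ball u r \<subseteq> W" "parametrisation X (ball u r) \<Phi>"
    by (rule parametrisation_ball_inside [OF par uW openin_subtopology_self])
      (use parametrisation_in [OF par uW] in auto)
  obtain G where G: "finite G" "\<forall>g\<in>G. hol g (ball u r)"
    "\<forall>v\<in>ball u r. \<Phi> v \<in> bad_set X B \<longleftrightarrow> (\<forall>g\<in>G. g v = 0)" "\<exists>g\<in>G. \<exists>v\<in>ball u r. g v \<noteq> 0"
    by (rule bad_set_local_equations [OF r(1,3) B])
  then obtain g v where g: "g \<in> G" "v \<in> ball u r" "g v \<noteq> 0"
    by blast
  have "negligible {v \<in> ball u r. g v = 0}"
    using G(2) g by (intro negligible_zero_set) auto
  then have "negligible (?S \<inter> ball u r)"
    by (rule negligible_subset) (use G(3) g(1) in auto)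
  then show "\<exists>U. openin (top_of_set ?S) U \<and> u \<in> U \<and> negligible U"
    using u r(1) by (intro exI [of _ "?S \<inter> ball u r"]) (auto intro: openin_open_Int)
qed

section \<open>The zero estimate at good points\<close>

lemma zero_near_add: "zero_near S F a \<Longrightarrow> zero_near S G a \<Longrightarrow> zero_near S (\<lambda>x. F x + G x) a"
proof -
  assume "zero_near S F a" "zero_near S G a"
  then obtain d e where "d > 0" "\<forall>w\<in>S. dist w a < d \<longrightarrow> F w = 0" "e > 0" "\<forall>w\<in>S. dist w a < e \<longrightarrow> G w = 0"
    unfolding zero_near_def by blast
  then show ?thesis
    unfolding zero_near_def by (intro exI [of _ "min d e"]) auto
qed

lemma zero_near_mult: "zero_near S F a \<Longrightarrow> zero_near S (\<lambda>x. G x * F x) a"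
  unfolding zero_near_def by auto

lemma zero_near_sum:
  "(\<And>k. k \<in> A \<Longrightarrow> zero_near S (F k) a) \<Longrightarrow> zero_near S (\<lambda>x. \<Sum>k\<in>A. F k x) a"
proof (induction A rule: infinite_finite_induct)
  case (insert k A)
  then show ?case
    using zero_near_add [of S "F k" a "\<lambda>x. \<Sum>k\<in>A. F k x"] by simp
qed (auto simp: zero_near_def intro: exI [of _ 1])

lemma vanishes_to_cong_zero_near:
  assumes "zero_near S (\<lambda>x. F x - G x) a" "vanishes_to S N F a"
  shows "vanishes_to S N G a"
proof -
  obtain d where d: "d > 0" "\<forall>w\<in>S. dist w a < d \<longrightarrow> F w - G w = 0"
    using assms(1) unfolding zero_near_def by blast
  show ?thesis
    by (rule vanishes_to_cong [OF open_ball _ _ assms(2), of a d]) (use d in \<open>auto simp: dist_commute\<close>)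
qed

text \<open>A basis of the germs at \<open>a\<close> chosen among the monomials themselves, so that
  it is one of the sets whose exceptional set is removed. A relation that involves a further
  monomial has a nonzero coefficient there, as \<open>B\<close> is independent, and can be solved
  for it.\<close>

lemma maximal_indep_spans:
  fixes E :: "('m::finite \<Rightarrow> nat) set"
  assumes E: "finite E"
  obtains B where "B \<subseteq> E" "indep_near X B a"
    "\<forall>c. \<exists>q. zero_near X (\<lambda>x. mono_comb E c x - mono_comb B q x) a"
proof -
  define \<B> where "\<B> = {B. B \<subseteq> E \<and> indep_near X B a}"
  have "finite \<B>" "{} \<in> \<B>"
    using E by (auto simp: \<B>_def indep_near_def)
  then obtain B where B: "B \<in> \<B>" "\<And>B'. B' \<in> \<B> \<Longrightarrow> B \<subseteq> B' \<Longrightarrow> B = B'"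
    using finite_has_maximal [of \<B>] by blast
  then have sub: "B \<subseteq> E" and ind: "indep_near X B a"
    by (auto simp: \<B>_def)
  have finB: "finite B"
    using sub E finite_subset by blast
  have "\<exists>q. zero_near X (\<lambda>x. mono_fun \<nu> x - mono_comb B q x) a" if \<nu>: "\<nu> \<in> E" for \<nu>
  proof (cases "\<nu> \<in> B")
    case True
    have "mono_comb B (\<lambda>\<mu>. if \<mu> = \<nu> then 1 else 0) x = mono_fun \<nu> x" for x
    proof -
      have "mono_comb B (\<lambda>\<mu>. if \<mu> = \<nu> then 1 else 0) x = (\<Sum>\<mu>\<in>B. if \<mu> = \<nu> then mono_fun \<nu> x else 0)"
        unfolding mono_comb_def by (intro sum.cong) auto
      then show ?thesis
        using True finB by simp
    qed
    then show ?thesis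
      by (intro exI [of _ "\<lambda>\<mu>. if \<mu> = \<nu> then 1 else 0"]) (auto simp: zero_near_def intro: exI [of _ 1])
  next
    case False
    have "insert \<nu> B \<notin> \<B>"
      using B(2) [of "insert \<nu> B"] False by blast
    then obtain c where c: "zero_near X (mono_comb (insert \<nu> B) c) a" "\<exists>\<mu>\<in>insert \<nu> B. c \<mu> \<noteq> 0"
      using \<nu> sub unfolding \<B>_def indep_near_def by blast
    have ins: "mono_comb (insert \<nu> B) c x = c \<nu> * mono_fun \<nu> x + mono_comb B c x" for x
      using False finB by (simp add: mono_comb_def)
    have "c \<nu> \<noteq> 0"
    proof
      assume "c \<nu> = 0"
      then have "mono_comb (insert \<nu> B) c = mono_comb B c"
        by (simp add: ins fun_eq_iff)
      then show False
        using c ind \<open>c \<nu> = 0\<close> unfolding indep_near_def by auto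
    qed
    have "mono_fun \<nu> x - mono_comb B (\<lambda>\<mu>. - c \<mu> / c \<nu>) x = inverse (c \<nu>) * mono_comb (insert \<nu> B) c x" for x
    proof -
      have "mono_comb B (\<lambda>\<mu>. - c \<mu> / c \<nu>) x = - (inverse (c \<nu>) * mono_comb B c x)"
        unfolding mono_comb_def sum_distrib_left sum_negf [symmetric]
        by (intro sum.cong) (auto simp: divide_inverse)
      then show ?thesis
        using \<open>c \<nu> \<noteq> 0\<close> by (simp add: ins algebra_simps)
    qed
    then show ?thesis
      using zero_near_mult [OF c(1), of "\<lambda>_. inverse (c \<nu>)"] by (intro exI [of _ "\<lambda>\<mu>. - c \<mu> / c \<nu>"]) simp
  qed
  then obtain q where q: "\<And>\<nu>. \<nu> \<in> E \<Longrightarrow> zero_near X (\<lambda>x. mono_fun \<nu> x - mono_comb B (q \<nu>) x) a"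
    by metis
  have "\<exists>q. zero_near X (\<lambda>x. mono_comb E c x - mono_comb B q x) a" for c
  proof
    have "zero_near X (\<lambda>x. \<Sum>\<nu>\<in>E. c \<nu> * (mono_fun \<nu> x - mono_comb B (q \<nu>) x)) a"
      by (intro zero_near_sum zero_near_mult q)
    moreover have "(\<Sum>\<nu>\<in>E. c \<nu> * mono_comb B (q \<nu>) x) = mono_comb B (\<lambda>\<mu>. \<Sum>\<nu>\<in>E. c \<nu> * q \<nu> \<mu>) x" for x
      unfolding mono_comb_def sum_distrib_left sum_distrib_right
      by (subst sum.swap) (simp add: mult.assoc)
    ultimately show "zero_near X (\<lambda>x. mono_comb E c x - mono_comb B (\<lambda>\<mu>. \<Sum>\<nu>\<in>E. c \<nu> * q \<nu> \<mu>) x) a"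
      by (simp add: right_diff_distrib sum_subtractf) (simp add: mono_comb_def)
  qed
  then show thesis
    using that sub ind by blast
qed

text \<open>Near \<open>a\<close> a polynomial agrees with a combination of a monomial basis
  \<open>B\<close>, nontrivial because the germ is nonzero. Since \<open>a\<close> is not in
  \<open>bad_set X B\<close>, its order is below \<open>card B\<close>, whatever the coefficients
  are.\<close>

theorem zero_estimate_le:
  fixes \<Phi> :: "complex^'n \<Rightarrow> complex^'m"
  assumes par: "local_parametrisation X a b \<Phi>"
    and good: "\<And>B. finite B \<Longrightarrow> a \<notin> bad_set X B"
    and H: "\<And>B. B \<subseteq> {\<nu>. sum \<nu> UNIV \<le> d} \<Longrightarrow> indep_near X B a \<Longrightarrow> card B \<le> H"
  shows "zero_estimate b \<Phi> d \<le> enat H"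
  unfolding zero_estimate_def
proof (rule Sup_least, safe)
  fix F :: "complex^'m \<Rightarrow> complex"
  assume F: "F \<in> polys_upto d" and nz: "\<not> (\<forall>\<^sub>F z in nhds b. (F \<circ> \<Phi>) z = 0)"
  obtain W where W: "b \<in> W" "parametrisation X W \<Phi>" "\<Phi> b = a"
    using par unfolding local_parametrisation_def by blast
  have aX: "a \<in> X"
    using parametrisation_in W by blast
  obtain c where c: "F = mono_comb {\<nu>. sum \<nu> UNIV \<le> d} c"
    using F unfolding polys_upto_def mono_comb_def [abs_def] mono_fun_def by auto
  obtain B where B: "B \<subseteq> {\<nu>. sum \<nu> UNIV \<le> d}" "indep_near X B a"
    "\<forall>c. \<exists>q. zero_near X (\<lambda>x. mono_comb {\<nu>. sum \<nu> UNIV \<le> d} c x - mono_comb B q x) a"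
    by (rule maximal_indep_spans [OF finite_exponents_upto])
  then obtain q where q: "zero_near X (\<lambda>x. F x - mono_comb B q x) a"
    using c by blast
  have finB: "finite B"
    using B(1) finite_exponents_upto finite_subset by blast
  have "\<not> zero_near X F a"
  proof
    assume "zero_near X F a"
    then have "zero_near UNIV (\<lambda>u. F (\<Phi> u)) b"
      using parametrisation_pullback(2) [OF W(2,1)] W(3) by blast
    then show False
      using nz unfolding zero_near_def eventually_nhds_metric by (simp add: o_def)
  qed
  moreover have "zero_near X F a" if "\<forall>\<nu>\<in>B. q \<nu> = 0"
  proof -
    have "mono_comb B q = (\<lambda>x. 0)"
      using that by (simp add: mono_comb_def fun_eq_iff)
    then show ?thesis
      using q by simp
  qed
  ultimately have "\<exists>\<nu>\<in>B. q \<nu> \<noteq> 0"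
    by blast
  then have "\<not> vanishes_to X (card B) (mono_comb B q) a"
    using good [OF finB] B(2) aX unfolding bad_set_def by blast
  then have "\<not> vanishes_to X (card B) F a"
    using vanishes_to_cong_zero_near [OF q] by blast
  then have nv: "\<not> vanishes_to UNIV (card B) (\<lambda>u. F (\<Phi> u)) b"
    using parametrisation_pullback(1) [OF W(2,1)] W(3) by blast
  have "open W" "\<forall>i. hol (\<lambda>u. \<Phi> u $ i) W"
    by (rule parametrisationE [OF W(2)], assumption)+
  then have "hol (\<lambda>u. F (\<Phi> u)) W"
    using hol_compose_param cdiff_mono_comb c by blast
  then obtain "is" where "is": "length is < card B" "foldr partial_deriv is (\<lambda>u. F (\<Phi> u)) b \<noteq> 0"
    using nv vanishes_to_iff_partial_derivs [OF \<open>open W\<close> W(1)] by blast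
  have "vanishing_order b (F \<circ> \<Phi>) \<le> enat (length is)"
    unfolding vanishing_order_def using "is"(2) by (intro Inf_lower) (auto simp: o_def)
  also have "\<dots> \<le> enat H"
    using "is"(1) H [OF B(1,2)] by simp
  finally show "vanishing_order b (F \<circ> \<Phi>) \<le> enat H" .
qed

section \<open>Spans of monomials\<close>

text \<open>Equality is asked on \<open>S\<close> only: the reduction of powers of algebraic
  coordinates uses relations that hold only there.\<close>

definition in_span :: "(complex^'m) set \<Rightarrow> ('m \<Rightarrow> nat) set \<Rightarrow> (complex^'m \<Rightarrow> complex) \<Rightarrow> bool" where
  "in_span S B f \<longleftrightarrow> (\<exists>c. \<forall>x\<in>S. f x = mono_comb B c x)"

lemma mono_comb_add: "mono_comb B c x + mono_comb B d x = mono_comb B (\<lambda>\<nu>. c \<nu> + d \<nu>) x"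
  by (simp add: mono_comb_def sum.distrib distrib_right)

lemma mono_comb_cmult: "k * mono_comb B c x = mono_comb B (\<lambda>\<nu>. k * c \<nu>) x"
  by (simp add: mono_comb_def sum_distrib_left mult.assoc)

lemma in_span_cong: "(\<And>x. x \<in> S \<Longrightarrow> f x = g x) \<Longrightarrow> in_span S B f \<longleftrightarrow> in_span S B g"
  by (simp add: in_span_def)

lemma in_span_add:
  assumes "in_span S B f" "in_span S B g"
  shows "in_span S B (\<lambda>x. f x + g x)"
proof -
  obtain c d where "\<forall>x\<in>S. f x = mono_comb B c x" "\<forall>x\<in>S. g x = mono_comb B d x"
    using assms unfolding in_span_def by blast
  then show ?thesis
    unfolding in_span_def by (intro exI [of _ "\<lambda>\<nu>. c \<nu> + d \<nu>"]) (simp flip: mono_comb_add)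
qed

lemma in_span_cmult:
  assumes "in_span S B f"
  shows "in_span S B (\<lambda>x. k * f x)"
proof -
  obtain c where "\<forall>x\<in>S. f x = mono_comb B c x"
    using assms unfolding in_span_def by blast
  then show ?thesis
    unfolding in_span_def by (intro exI [of _ "\<lambda>\<nu>. k * c \<nu>"]) (simp flip: mono_comb_cmult)
qed

lemma in_span_zero: "in_span S B (\<lambda>x. 0)"
  unfolding in_span_def by (intro exI [of _ "\<lambda>_. 0"]) (simp add: mono_comb_def)

lemma in_span_sum: "(\<And>k. k \<in> A \<Longrightarrow> in_span S B (f k)) \<Longrightarrow> in_span S B (\<lambda>x. \<Sum>k\<in>A. f k x)"
  by (induction A rule: infinite_finite_induct) (auto intro: in_span_add in_span_zero)

lemma in_span_mono_fun:
  assumes "finite B" "\<nu> \<in> B"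
  shows "in_span S B (mono_fun \<nu>)"
proof -
  have "mono_fun \<nu> x = mono_comb B (\<lambda>\<mu>. if \<mu> = \<nu> then 1 else 0) x" for x
  proof -
    have "mono_comb B (\<lambda>\<mu>. if \<mu> = \<nu> then 1 else 0) x = (\<Sum>\<mu>\<in>B. if \<mu> = \<nu> then mono_fun \<nu> x else 0)"
      unfolding mono_comb_def by (intro sum.cong) auto
    then show ?thesis
      using assms by simp
  qed
  then show ?thesis
    unfolding in_span_def by blast
qed

lemma in_span_mult:
  assumes "in_span S B f" "\<And>\<beta>. \<beta> \<in> B \<Longrightarrow> in_span S B' (\<lambda>x. h x * mono_fun \<beta> x)"
  shows "in_span S B' (\<lambda>x. h x * f x)"
proof -
  obtain c where c: "\<And>x. x \<in> S \<Longrightarrow> f x = mono_comb B c x"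
    using assms(1) unfolding in_span_def by blast
  have "in_span S B' (\<lambda>x. \<Sum>\<beta>\<in>B. c \<beta> * (h x * mono_fun \<beta> x))"
    by (intro in_span_sum in_span_cmult assms(2))
  then show ?thesis
    by (subst in_span_cong [where g = "\<lambda>x. \<Sum>\<beta>\<in>B. c \<beta> * (h x * mono_fun \<beta> x)"])
      (auto simp: c mono_comb_def sum_distrib_left intro!: sum.cong)
qed

lemma in_span_mono:
  assumes "in_span S B f" "finite B'" "B \<subseteq> B'"
  shows "in_span S B' f"
  using in_span_mult [OF assms(1), of B' "\<lambda>_. 1"] in_span_mono_fun [OF assms(2)] assms(3) by auto

lemma in_span_subset: "in_span S B f \<Longrightarrow> T \<subseteq> S \<Longrightarrow> in_span T B f"
  unfolding in_span_def by blast

lemma mono_fun_add: "mono_fun \<kappa> x * mono_fun \<mu> x = mono_fun (\<lambda>i. \<kappa> i + \<mu> i) x"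
  by (simp add: mono_fun_def power_add prod.distrib)

lemma mono_fun_zero [simp]: "mono_fun (\<lambda>_. 0) = (\<lambda>x. 1)"
  by (simp add: mono_fun_def fun_eq_iff)

lemma mono_fun_upd: "mono_fun (\<mu>(j := k)) x = x $ j ^ k * mono_fun (\<mu>(j := 0)) x"
proof -
  have "mono_fun (\<mu>(j := k)) x = x $ j ^ k * (\<Prod>i\<in>UNIV - {j}. x $ i ^ \<mu> i)" for k
    unfolding mono_fun_def by (subst prod.remove [of _ j]) (auto intro!: prod.cong)
  from this [of k] this [of 0] show ?thesis
    by simp
qed

definition exponents :: "'m set \<Rightarrow> nat \<Rightarrow> ('m::finite \<Rightarrow> nat) set" where
  "exponents J t = {\<kappa>. (\<forall>i. i \<notin> J \<longrightarrow> \<kappa> i = 0) \<and> sum \<kappa> UNIV \<le> t}"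

lemma finite_exponents: "finite (exponents J t)"
  by (rule finite_subset [OF _ finite_exponents_upto [of t]]) (auto simp: exponents_def)

abbreviation poly_in :: "'m::finite set \<Rightarrow> nat \<Rightarrow> (complex^'m \<Rightarrow> complex) \<Rightarrow> bool" where
  "poly_in J t f \<equiv> in_span UNIV (exponents J t) f"

definition is_poly :: "'m::finite set \<Rightarrow> (complex^'m \<Rightarrow> complex) \<Rightarrow> bool" where
  "is_poly J f \<longleftrightarrow> (\<exists>t. poly_in J t f)"

lemma poly_in_mono: "poly_in J s f \<Longrightarrow> s \<le> t \<Longrightarrow> J \<subseteq> K \<Longrightarrow> poly_in K t f"
  by (rule in_span_mono [OF _ finite_exponents]) (auto simp: exponents_def)

lemma poly_in_mult:
  assumes "poly_in J s f" "poly_in J t g"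
  shows "poly_in J (s + t) (\<lambda>x. f x * g x)"
proof (rule in_span_mult [OF assms(2)])
  fix \<beta> :: "'a \<Rightarrow> nat" assume \<beta>: "\<beta> \<in> exponents J t"
  have "poly_in J (s + t) (\<lambda>x. mono_fun \<beta> x * f x)"
  proof (rule in_span_mult [OF assms(1)])
    fix \<kappa> :: "'a \<Rightarrow> nat" assume "\<kappa> \<in> exponents J s"
    then have "(\<lambda>i. \<beta> i + \<kappa> i) \<in> exponents J (s + t)"
      using \<beta> by (auto simp: exponents_def sum.distrib)
    then show "poly_in J (s + t) (\<lambda>x. mono_fun \<beta> x * mono_fun \<kappa> x)"
      unfolding mono_fun_add by (rule in_span_mono_fun [OF finite_exponents])
  qed
  then show "poly_in J (s + t) (\<lambda>x. f x * mono_fun \<beta> x)"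
    by (simp add: mult.commute)
qed

lemma poly_in_const: "poly_in J t (\<lambda>x. c)"
proof -
  have "poly_in J t (mono_fun (\<lambda>_. 0))"
    by (rule in_span_mono_fun [OF finite_exponents]) (simp add: exponents_def)
  from in_span_cmult [OF this, of c] show ?thesis
    by simp
qed

lemma poly_in_coord:
  assumes "i \<in> J"
  shows "poly_in J 1 (\<lambda>x. x $ i)"
proof -
  have "mono_fun ((\<lambda>_. 0)(i := 1)) x = x $ i" for x
  proof -
    have "(\<lambda>_. 0)(i := 0 :: nat) = (\<lambda>_. 0)"
      by auto
    then show ?thesis
      using mono_fun_upd [of "\<lambda>_. 0" i 1 x] by simp
  qed
  moreover have "(\<lambda>_. 0)(i := 1) \<in> exponents J 1"
    using assms by (auto simp: exponents_def if_distrib fun_upd_def)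
  then have "poly_in J 1 (mono_fun ((\<lambda>_. 0)(i := 1)))"
    by (rule in_span_mono_fun [OF finite_exponents])
  ultimately show ?thesis
    by (simp add: in_span_def)
qed

lemma poly_in_power: "poly_in J t f \<Longrightarrow> poly_in J (k * t) (\<lambda>x. f x ^ k)"
proof (induction k)
  case (Suc k)
  then show ?case
    using poly_in_mult [of J t f "k * t" "\<lambda>x. f x ^ k"] by simp
qed (simp add: poly_in_const)

lemma poly_in_mono_fun: "sum \<nu> UNIV \<le> t \<Longrightarrow> (\<And>i. i \<notin> J \<Longrightarrow> \<nu> i = 0) \<Longrightarrow> poly_in J t (mono_fun \<nu>)"
  by (rule in_span_mono_fun [OF finite_exponents]) (auto simp: exponents_def)

lemma is_poly_intros:
  "is_poly J (\<lambda>x. c)"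
  "i \<in> J \<Longrightarrow> is_poly J (\<lambda>x. x $ i)"
  "is_poly J f \<Longrightarrow> is_poly J g \<Longrightarrow> is_poly J (\<lambda>x. f x * g x)"
  "is_poly J f \<Longrightarrow> is_poly J g \<Longrightarrow> is_poly J (\<lambda>x. f x + g x)"
  "is_poly J f \<Longrightarrow> is_poly J (\<lambda>x. f x ^ k)"
proof -
  show "is_poly J (\<lambda>x. c)"
    unfolding is_poly_def using poly_in_const by blast
  show "i \<in> J \<Longrightarrow> is_poly J (\<lambda>x. x $ i)"
    unfolding is_poly_def using poly_in_coord by blast
  show "is_poly J f \<Longrightarrow> is_poly J g \<Longrightarrow> is_poly J (\<lambda>x. f x * g x)"
    unfolding is_poly_def using poly_in_mult by blast
  show "is_poly J f \<Longrightarrow> is_poly J (\<lambda>x. f x ^ k)"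
    unfolding is_poly_def using poly_in_power by blast
  assume "is_poly J f" "is_poly J g"
  then obtain s t where "poly_in J s f" "poly_in J t g"
    unfolding is_poly_def by blast
  then have "poly_in J (max s t) f" "poly_in J (max s t) g"
    by (auto intro: poly_in_mono)
  then show "is_poly J (\<lambda>x. f x + g x)"
    unfolding is_poly_def using in_span_add by blast
qed

lemma is_poly_sum: "(\<And>k. k \<in> A \<Longrightarrow> is_poly J (f k)) \<Longrightarrow> is_poly J (\<lambda>x. \<Sum>k\<in>A. f k x)"
  by (induction A rule: infinite_finite_induct) (auto intro: is_poly_intros)

lemma is_poly_prod: "(\<And>k. k \<in> A \<Longrightarrow> is_poly J (f k)) \<Longrightarrow> is_poly J (\<lambda>x. \<Prod>k\<in>A. f k x)"
  by (induction A rule: infinite_finite_induct) (auto intro: is_poly_intros)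

lemma is_poly_UNIV: "is_poly J f \<Longrightarrow> is_poly UNIV f"
  unfolding is_poly_def using poly_in_mono by blast

lemma is_poly_mono_fun: "(\<And>i. i \<notin> J \<Longrightarrow> \<nu> i = 0) \<Longrightarrow> is_poly J (mono_fun \<nu>)"
  unfolding is_poly_def using poly_in_mono_fun by blast

lemma is_poly_cdiff: "is_poly J f \<Longrightarrow> complex_differentiable_at f z"
proof -
  assume "is_poly J f"
  then obtain t c where "f = mono_comb (exponents J t) c"
    unfolding is_poly_def in_span_def by (auto simp: fun_eq_iff)
  then show ?thesis
    using cdiff_mono_comb by simp
qed

lemma is_poly_cong_on:
  assumes "is_poly J f" "\<And>i. i \<in> J \<Longrightarrow> x $ i = y $ i"
  shows "f x = f y"
proof -
  obtain t c where f: "f = mono_comb (exponents J t) c"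
    using assms(1) unfolding is_poly_def in_span_def by (auto simp: fun_eq_iff)
  have "mono_fun \<kappa> x = mono_fun \<kappa> y" if "\<kappa> \<in> exponents J t" for \<kappa>
    unfolding mono_fun_def
  proof (rule prod.cong [OF refl])
    fix i
    show "x $ i ^ \<kappa> i = y $ i ^ \<kappa> i"
      using assms(2) that by (cases "i \<in> J") (auto simp: exponents_def)
  qed
  then show ?thesis
    unfolding f mono_comb_def by (intro sum.cong) auto
qed

lemma polys_upto_iff: "F \<in> polys_upto d \<longleftrightarrow> poly_in UNIV d F"
  unfolding polys_upto_def in_span_def exponents_def mono_comb_def mono_fun_def by (auto simp: fun_eq_iff)

section \<open>Homogeneous linear systems with more unknowns than equations\<close>

lemma homogeneous_system_nontrivial:
  fixes M :: "'k \<Rightarrow> 'b \<Rightarrow> 'a::field"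
  assumes "finite B" "finite K" "card B < card K"
  shows "\<exists>c. (\<exists>k\<in>K. c k \<noteq> 0) \<and> (\<forall>\<beta>\<in>B. (\<Sum>k\<in>K. c k * M k \<beta>) = 0)"
  using assms
proof (induction B arbitrary: K M rule: finite_induct)
  case empty
  then show ?case
    by (intro exI [of _ "\<lambda>_. 1"]) (auto simp: card_gt_0_iff)
next
  case (insert \<beta> B)
  show ?case
  proof (cases "\<forall>k\<in>K. M k \<beta> = 0")
    case True
    obtain c where "\<exists>k\<in>K. c k \<noteq> 0" "\<forall>\<beta>\<in>B. (\<Sum>k\<in>K. c k * M k \<beta>) = 0"
      using insert.IH [of K M] insert.prems insert.hyps by auto
    then show ?thesis
      using True by (intro exI [of _ c]) auto
  next
    case False
    then obtain k0 where k0: "k0 \<in> K" "M k0 \<beta> \<noteq> 0"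
      by blast
    \<comment> \<open>One step of Gaussian elimination: \<open>M'\<close> is what remains after
      equation \<open>\<beta>\<close> is solved for the unknown \<open>k0\<close>.\<close>
    define M' where "M' k b = M k b - M k \<beta> / M k0 \<beta> * M k0 b" for k b
    have "card B < card (K - {k0})"
      using insert k0 by (simp add: card_Diff_singleton)
    then obtain c where c: "\<exists>k\<in>K - {k0}. c k \<noteq> 0" "\<forall>b\<in>B. (\<Sum>k\<in>K - {k0}. c k * M' k b) = 0"
      using insert.IH [of "K - {k0}" M'] insert.prems(1) by auto
    define c0 where "c0 = - (\<Sum>k\<in>K - {k0}. c k * (M k \<beta> / M k0 \<beta>))"
    have eq: "(\<Sum>k\<in>K. (c(k0 := c0)) k * M k b) = (\<Sum>k\<in>K - {k0}. c k * M' k b)" for b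
    proof -
      have "(\<Sum>k\<in>K. (c(k0 := c0)) k * M k b) = c0 * M k0 b + (\<Sum>k\<in>K - {k0}. (c(k0 := c0)) k * M k b)"
        using insert.prems(1) k0(1) by (subst sum.remove [of _ k0]) auto
      also have "(\<Sum>k\<in>K - {k0}. (c(k0 := c0)) k * M k b) = (\<Sum>k\<in>K - {k0}. c k * M k b)"
        by (intro sum.cong) auto
      finally show ?thesis
        by (simp add: c0_def M'_def right_diff_distrib sum_subtractf sum_distrib_right mult.assoc)
    qed
    have "(\<Sum>k\<in>K. (c(k0 := c0)) k * M k b) = 0" if "b \<in> insert \<beta> B" for b
    proof (cases "b = \<beta>")
      case True
      then show ?thesis
        unfolding eq using k0(2) by (simp add: M'_def)
    next
      case False
      then show ?thesis
        unfolding eq using c(2) that by blast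
    qed
    moreover have "\<exists>k\<in>K. (c(k0 := c0)) k \<noteq> 0"
      using c(1) by auto
    ultimately show ?thesis
      by blast
  qed
qed

lemma in_span_dependent:
  assumes "finite B" "finite K" "card B < card K" "\<And>k. k \<in> K \<Longrightarrow> in_span S B (g k)"
  shows "\<exists>c. (\<exists>k\<in>K. c k \<noteq> 0) \<and> (\<forall>x\<in>S. (\<Sum>k\<in>K. c k * g k x) = 0)"
proof -
  obtain M where M: "\<And>k x. k \<in> K \<Longrightarrow> x \<in> S \<Longrightarrow> g k x = mono_comb B (M k) x"
    using assms(4) unfolding in_span_def by metis
  obtain c where c: "\<exists>k\<in>K. c k \<noteq> 0" "\<And>\<beta>. \<beta> \<in> B \<Longrightarrow> (\<Sum>k\<in>K. c k * M k \<beta>) = 0"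
    using homogeneous_system_nontrivial [OF assms(1-3), of M] by blast
  have "(\<Sum>k\<in>K. c k * g k x) = 0" if "x \<in> S" for x
  proof -
    have "(\<Sum>k\<in>K. c k * g k x) = (\<Sum>k\<in>K. \<Sum>\<beta>\<in>B. c k * M k \<beta> * mono_fun \<beta> x)"
      using M that by (intro sum.cong) (auto simp: mono_comb_def sum_distrib_left mult.assoc)
    also have "\<dots> = (\<Sum>\<beta>\<in>B. (\<Sum>k\<in>K. c k * M k \<beta>) * mono_fun \<beta> x)"
      by (subst sum.swap) (simp add: sum_distrib_right)
    finally show ?thesis
      using c(2) by simp
  qed
  then show ?thesis
    using c(1) by blast
qed

section \<open>Counting functions on an algebraic branch\<close>

text \<open>
  Outside \<open>J\<close> each coordinate \<open>j\<close> is a root of a polynomial of degree \<open>D j\<close> over the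
  coordinates in \<open>J\<close>. Up to powers of the product of the leading coefficients, the powers of
  the \<open>j\<close>-th coordinate can therefore be reduced below \<open>D j\<close>.
\<close>

locale algebraic_branch =
  fixes S :: "(complex^'m) set" and J :: "'m set" and D :: "'m \<Rightarrow> nat"
    and a :: "'m \<Rightarrow> nat \<Rightarrow> complex^'m \<Rightarrow> complex" and E :: nat
  assumes D_pos: "\<And>j. j \<notin> J \<Longrightarrow> 0 < D j"
    and coeffs: "\<And>j k. j \<notin> J \<Longrightarrow> k \<le> D j \<Longrightarrow> poly_in J E (a j k)"
    and root: "\<And>j x. j \<notin> J \<Longrightarrow> x \<in> S \<Longrightarrow> (\<Sum>k\<le>D j. a j k x * x $ j ^ k) = 0"
begin

text \<open>Exponents of the normal forms: \<open>e\<close> bounds the degree in the coordinates of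
  \<open>J\<close> alone, the other exponents being bounded by \<open>D\<close>.\<close>

definition reduced :: "nat \<Rightarrow> ('m \<Rightarrow> nat) set" where
  "reduced e = {\<mu>. (\<forall>j. j \<notin> J \<longrightarrow> \<mu> j < D j) \<and> sum \<mu> J \<le> e}"

definition lead :: "complex^'m \<Rightarrow> complex" where
  "lead x = (\<Prod>j\<in>- J. a j (D j) x)"

text \<open>Growth of the \<open>J\<close>-degree under multiplication by \<open>lead\<close> and
  one coordinate: each of the \<open>card (- J)\<close> leading coefficients adds at most
  \<open>E\<close>, and the successor accounts for a coordinate in \<open>J\<close>.\<close>

definition step :: nat where
  "step = Suc (card (- J) * E)"

lemma reduced_subset: "reduced e \<subseteq> Pi\<^sub>E UNIV (\<lambda>i. if i \<in> J then {..e} else {..<D i})"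
proof
  fix \<mu> assume \<mu>: "\<mu> \<in> reduced e"
  have "\<mu> i \<le> e" if "i \<in> J" for i
    using member_le_sum [of i J \<mu>] that \<mu> by (auto simp: reduced_def)
  then show "\<mu> \<in> Pi\<^sub>E UNIV (\<lambda>i. if i \<in> J then {..e} else {..<D i})"
    using \<mu> by (auto simp: reduced_def PiE_iff)
qed

lemma finite_reduced: "finite (reduced e)"
  by (rule finite_subset [OF reduced_subset]) (intro finite_PiE; simp)

lemma card_reduced: "card (reduced e) \<le> (\<Prod>j\<in>- J. D j) * (e + 1) ^ card J"
proof -
  have "card (reduced e) \<le> card (Pi\<^sub>E UNIV (\<lambda>i. if i \<in> J then {..e} else {..<D i}))"
    by (rule card_mono [OF _ reduced_subset]) (intro finite_PiE; simp)
  also have "\<dots> = (\<Prod>i\<in>UNIV. if i \<in> J then e + 1 else D i)"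
    by (subst card_PiE) (auto intro!: prod.cong)
  also have "\<dots> = (\<Prod>i\<in>J. e + 1) * (\<Prod>j\<in>- J. D j)"
    by (subst prod.If_cases) (auto simp: Compl_eq_Diff_UNIV)
  finally show ?thesis
    by (simp add: mult.commute)
qed

lemma in_span_reduced_mono: "in_span S (reduced e) h \<Longrightarrow> e \<le> e' \<Longrightarrow> in_span S (reduced e') h"
  by (rule in_span_mono [OF _ finite_reduced]) (auto simp: reduced_def)

lemma in_span_reduced_poly:
  assumes f: "poly_in J t f" and h: "in_span S (reduced e) h"
  shows "in_span S (reduced (e + t)) (\<lambda>x. f x * h x)"
proof (rule in_span_mult [OF h])
  fix \<mu> assume \<mu>: "\<mu> \<in> reduced e"
  have "in_span S (reduced (e + t)) (\<lambda>x. mono_fun \<mu> x * f x)"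
  proof (rule in_span_mult [OF in_span_subset [OF f subset_UNIV]])
    fix \<kappa> assume \<kappa>: "\<kappa> \<in> exponents J t"
    have "sum \<kappa> J \<le> sum \<kappa> UNIV"
      by (intro sum_mono2) auto
    then have "(\<lambda>i. \<mu> i + \<kappa> i) \<in> reduced (e + t)"
      using \<kappa> \<mu> by (auto simp: exponents_def reduced_def sum.distrib)
    then show "in_span S (reduced (e + t)) (\<lambda>x. mono_fun \<mu> x * mono_fun \<kappa> x)"
      unfolding mono_fun_add by (rule in_span_mono_fun [OF finite_reduced])
  qed
  then show "in_span S (reduced (e + t)) (\<lambda>x. f x * mono_fun \<mu> x)"
    by (simp add: mult.commute)
qed

lemma reduced_upd: "\<mu> \<in> reduced e \<Longrightarrow> j \<notin> J \<Longrightarrow> k < D j \<Longrightarrow> \<mu>(j := k) \<in> reduced e"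
proof -
  assume *: "\<mu> \<in> reduced e" "j \<notin> J" "k < D j"
  have "sum (\<mu>(j := k)) J = sum \<mu> J"
    using *(2) by (intro sum.cong) auto
  then show ?thesis
    using * by (auto simp: reduced_def)
qed

text \<open>The exponent of coordinate \<open>j\<close> either stays below \<open>D j\<close> or
  becomes equal to it; in the latter case the equation replaces the leading term by lower powers.
  The leading coefficient stays as a factor, so nothing is divided, and the coefficients raise the
  \<open>J\<close>-degree by at most \<open>E\<close>.\<close>

lemma in_span_reduced_coord:
  assumes j: "j \<notin> J" and h: "in_span S (reduced e) h"
  shows "in_span S (reduced (e + E)) (\<lambda>x. a j (D j) x * x $ j * h x)"
proof (rule in_span_mult [OF h])
  fix \<mu> assume \<mu>: "\<mu> \<in> reduced e"
  let ?m = "\<lambda>k. mono_fun (\<mu>(j := k))"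
  have *: "in_span S (reduced (e + E)) (\<lambda>x. a j i x * ?m k x)" if "i \<le> D j" "k < D j" for i k
    using that by (intro in_span_reduced_poly coeffs [OF j] in_span_mono_fun finite_reduced reduced_upd [OF \<mu> j])
  have m: "x $ j * mono_fun \<mu> x = x $ j ^ Suc (\<mu> j) * ?m 0 x" for x
    using mono_fun_upd [of \<mu> j "\<mu> j" x] by simp
  show "in_span S (reduced (e + E)) (\<lambda>x. a j (D j) x * x $ j * mono_fun \<mu> x)"
  proof (cases "Suc (\<mu> j) < D j")
    case True
    have eq: "(\<lambda>x. a j (D j) x * x $ j * mono_fun \<mu> x) = (\<lambda>x. a j (D j) x * ?m (Suc (\<mu> j)) x)"
      unfolding mult.assoc m mono_fun_upd [of \<mu> j "Suc (\<mu> j)"] ..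
    show ?thesis
      unfolding eq by (rule * [OF order_refl True])
  next
    case False
    then have D: "Suc (\<mu> j) = D j"
      using \<mu> j by (auto simp: reduced_def Suc_le_eq not_less)
    have "a j (D j) x * x $ j * mono_fun \<mu> x = (\<Sum>k<D j. -1 * (a j k x * ?m k x))" if "x \<in> S" for x
    proof -
      have "(\<Sum>k<D j. a j k x * x $ j ^ k) + a j (D j) x * x $ j ^ D j = 0"
        using root [OF j that] by (simp add: lessThan_Suc_atMost [symmetric])
      then have lead: "a j (D j) x * x $ j ^ D j = - (\<Sum>k<D j. a j k x * x $ j ^ k)"
        by (simp add: add_eq_0_iff)
      have "a j (D j) x * x $ j * mono_fun \<mu> x = a j (D j) x * x $ j ^ D j * ?m 0 x"
        unfolding mult.assoc m D ..
      also have "\<dots> = (\<Sum>k<D j. -1 * (a j k x * (x $ j ^ k * ?m 0 x)))"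
        unfolding lead by (simp add: sum_distrib_right sum_negf mult.assoc)
      finally show ?thesis
        unfolding mono_fun_upd [of \<mu> j _ x, symmetric] .
    qed
    moreover have "in_span S (reduced (e + E)) (\<lambda>x. \<Sum>k<D j. -1 * (a j k x * ?m k x))"
      by (intro in_span_sum in_span_cmult *) auto
    ultimately show ?thesis
      by (subst in_span_cong [where g = "\<lambda>x. \<Sum>k<D j. -1 * (a j k x * ?m k x)"])
  qed
qed

lemma in_span_reduced_prod:
  assumes "finite A" "A \<subseteq> - J" "in_span S (reduced e) h"
  shows "in_span S (reduced (e + card A * E)) (\<lambda>x. (\<Prod>j\<in>A. a j (D j) x) * h x)"
  using assms
proof (induction A rule: finite_induct)
  case (insert j A)
  then have "in_span S (reduced (e + card A * E + E)) (\<lambda>x. a j (D j) x * ((\<Prod>j\<in>A. a j (D j) x) * h x))"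
    by (intro in_span_reduced_poly [OF coeffs]) auto
  then show ?case
    using insert by (simp add: mult.assoc algebra_simps)
qed simp

lemma in_span_reduced_lead:
  assumes "in_span S (reduced e) h"
  shows "in_span S (reduced (e + step)) (\<lambda>x. lead x * h x)"
  unfolding lead_def
  by (rule in_span_reduced_mono [OF in_span_reduced_prod [OF _ order_refl assms]]) (auto simp: step_def)

lemma in_span_reduced_lead_coord:
  assumes h: "in_span S (reduced e) h"
  shows "in_span S (reduced (e + step)) (\<lambda>x. lead x * x $ i * h x)"
proof (cases "i \<in> J")
  case True
  have "in_span S (reduced (e + 1)) (\<lambda>x. x $ i * h x)"
    by (rule in_span_reduced_poly [OF poly_in_coord [OF True] h])
  from in_span_reduced_prod [OF _ order_refl this] show ?thesis
    by (simp add: lead_def step_def mult.assoc)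
next
  case False
  \<comment> \<open>The factor \<open>a i (D i)\<close> of \<open>lead\<close> is spent on reducing
    coordinate \<open>i\<close>; the other factors merely raise the degree.\<close>
  have "in_span S (reduced (e + E + card (- J - {i}) * E))
      (\<lambda>x. (\<Prod>j\<in>- J - {i}. a j (D j) x) * (a i (D i) x * x $ i * h x))"
    using False by (intro in_span_reduced_prod in_span_reduced_coord h) auto
  moreover have "lead x = (\<Prod>j\<in>- J - {i}. a j (D j) x) * a i (D i) x" for x
    unfolding lead_def using False by (subst prod.remove [of _ i]) (auto simp: mult.commute)
  moreover have "e + E + card (- J - {i}) * E \<le> e + step"
  proof -
    have "card (- J) = Suc (card (- J - {i}))"
      using False by (subst card.remove [of _ i]) auto
    then show ?thesis
      by (simp add: step_def)
  qed
  ultimately show ?thesis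
    using in_span_reduced_mono by (simp add: mult.assoc)
qed

text \<open>Each coordinate factor of the monomial consumes one factor \<open>lead\<close>; for
  monomials of lower degree the surplus is absorbed by \<open>in_span_reduced_lead\<close>. The
  multiplier \<open>lead ^ d\<close> is thereby the same for all monomials of degree at most
  \<open>d\<close>, so that linear combinations can be formed.\<close>

lemma in_span_reduced_mono_fun:
  "sum \<nu> UNIV \<le> d \<Longrightarrow> in_span S (reduced (d * step)) (\<lambda>x. lead x ^ d * mono_fun \<nu> x)"
proof (induction d arbitrary: \<nu>)
  case 0
  then have "\<nu> = (\<lambda>_. 0)"
    by (auto simp: fun_eq_iff)
  moreover have "(\<lambda>_. 0) \<in> reduced 0"
    using D_pos by (simp add: reduced_def)
  ultimately show ?case
    using in_span_mono_fun [OF finite_reduced, of "\<lambda>_. 0" 0 S] by simp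
next
  case (Suc d)
  show ?case
  proof (cases "sum \<nu> UNIV = 0")
    case True
    then have "sum \<nu> UNIV \<le> d"
      by simp
    from in_span_reduced_lead [OF Suc.IH [OF this]] show ?thesis
      by (simp add: mult.assoc add.commute)
  next
    case False
    then obtain i where i: "\<nu> i \<noteq> 0"
      by auto
    define \<nu>' where "\<nu>' = \<nu>(i := \<nu> i - 1)"
    have "sum \<nu> UNIV = \<nu> i + sum \<nu> (UNIV - {i})" "sum \<nu>' UNIV = \<nu>' i + sum \<nu>' (UNIV - {i})"
      by (simp_all add: sum.remove [of UNIV i])
    moreover have "sum \<nu>' (UNIV - {i}) = sum \<nu> (UNIV - {i})"
      by (intro sum.cong) (auto simp: \<nu>'_def)
    ultimately have "sum \<nu>' UNIV \<le> d"
      using Suc.prems i by (simp add: \<nu>'_def)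
    moreover have "mono_fun \<nu> x = x $ i * mono_fun \<nu>' x" for x
      using mono_fun_upd [of \<nu> i "\<nu> i" x, unfolded fun_upd_triv] mono_fun_upd [of \<nu> i "\<nu> i - 1" x] i
      by (cases "\<nu> i") (auto simp: \<nu>'_def)
    ultimately show ?thesis
      using in_span_reduced_lead_coord [OF Suc.IH [of \<nu>'], of i] by (simp add: mult_ac add.commute)
  qed
qed

lemma in_span_reduced:
  assumes "poly_in UNIV d f"
  shows "in_span S (reduced (d * step)) (\<lambda>x. lead x ^ d * f x)"
  by (rule in_span_mult [OF in_span_subset [OF assms subset_UNIV]])
    (auto intro: in_span_reduced_mono_fun simp: exponents_def)

text \<open>After multiplication by the common factor \<open>lead ^ d\<close> all monomials of
  \<open>B\<close> lie in the span of \<open>reduced (d * step)\<close>, so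
  \<open>card_reduced\<close> limits how many of them can be independent.\<close>

theorem card_indep_le:
  assumes B: "B \<subseteq> {\<nu>. sum \<nu> UNIV \<le> d}"
    and ind: "\<And>c. (\<And>x. x \<in> S \<Longrightarrow> lead x ^ d * mono_comb B c x = 0) \<Longrightarrow> \<forall>\<nu>\<in>B. c \<nu> = 0"
  shows "card B \<le> (\<Prod>j\<in>- J. D j) * (d * step + 1) ^ card J"
proof (rule ccontr)
  assume "\<not> ?thesis"
  then have less: "card (reduced (d * step)) < card B"
    using card_reduced [of "d * step"] by linarith
  have "finite B"
    using B finite_exponents_upto finite_subset by blast
  then obtain c where c: "\<exists>\<nu>\<in>B. c \<nu> \<noteq> 0" "\<forall>x\<in>S. (\<Sum>\<nu>\<in>B. c \<nu> * (lead x ^ d * mono_fun \<nu> x)) = 0"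
    using in_span_dependent [OF finite_reduced _ less, of S "\<lambda>\<nu> x. lead x ^ d * mono_fun \<nu> x"]
      in_span_reduced_mono_fun B by blast
  have "lead x ^ d * mono_comb B c x = 0" if "x \<in> S" for x
    using c(2) that by (simp add: mono_comb_def sum_distrib_left mult_ac)
  then show False
    using ind c(1) by blast
qed

text \<open>
  Monomials in the coordinates in \<open>J\<close> and in \<open>F\<close> range over \<open>card J + 1\<close> exponents, so for large
  degree there are more of them than \<open>card_reduced\<close> allows to be independent.
\<close>

theorem algebraic_relation:
  assumes lead: "\<And>x. x \<in> S \<Longrightarrow> lead x \<noteq> 0" and F: "is_poly UNIV F"
  obtains s c where "\<exists>\<kappa>\<in>{\<kappa>. (\<forall>i. i \<notin> J \<longrightarrow> \<kappa> i = 0) \<and> (\<forall>i. \<kappa> i \<le> s)}. \<exists>k\<le>s. c \<kappa> k \<noteq> 0"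
    "\<forall>x\<in>S. (\<Sum>k\<le>s. mono_comb {\<kappa>. (\<forall>i. i \<notin> J \<longrightarrow> \<kappa> i = 0) \<and> (\<forall>i. \<kappa> i \<le> s)} (\<lambda>\<kappa>. c \<kappa> k) x * F x ^ k) = 0"
proof -
  obtain t where t: "poly_in UNIV t F"
    using F unfolding is_poly_def by blast
  define box where "box s = {\<kappa> :: 'm \<Rightarrow> nat. (\<forall>i. i \<notin> J \<longrightarrow> \<kappa> i = 0) \<and> (\<forall>i. \<kappa> i \<le> s)}" for s
  have box: "box s = Pi\<^sub>E UNIV (\<lambda>i. if i \<in> J then {..s} else {0})" for s
  proof -
    have "\<kappa> i \<le> s" if "\<forall>i. (i \<in> J \<longrightarrow> \<kappa> i \<le> s) \<and> (i \<in> J \<or> \<kappa> i = 0)" for \<kappa> :: "'m \<Rightarrow> nat" and i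
      using that by (cases "i \<in> J") auto
    then show ?thesis
      by (auto simp: box_def PiE_iff split: if_splits)
  qed
  have fin: "finite (box s)" for s
    unfolding box by (intro finite_PiE) auto
  have card_box: "card (box s) = (s + 1) ^ card J" for s
  proof -
    have "card (box s) = (\<Prod>i\<in>UNIV. if i \<in> J then s + 1 else 1)"
      unfolding box by (subst card_PiE) (auto intro!: prod.cong)
    also have "\<dots> = (\<Prod>i\<in>J. s + 1)"
      by (subst prod.If_cases) (auto simp: Compl_eq_Diff_UNIV)
    finally show ?thesis
      by simp
  qed
  \<comment> \<open>\<open>M * s\<close> bounds the degree of a monomial times a power of
    \<open>F\<close> when all exponents are at most \<open>s\<close>: \<open>CARD('m) * s\<close>
    from the monomial and \<open>t * s\<close> from the power.\<close>
  define M where "M = CARD('m) + t"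
  define K where "K = (\<Prod>j\<in>- J. D j)"
  \<comment> \<open>Chosen so that the dimension bound \<open>K * (d * step + 1) ^ card J\<close> is
    at most \<open>s * (s + 1) ^ card J\<close>, which is below the number
    \<open>(s + 1) ^ (card J + 1)\<close> of available products.\<close>
  define s where "s = K * (M * step + 1) ^ card J"
  define d where "d = M * s"
  have deg: "poly_in UNIV d (\<lambda>x. mono_fun \<kappa> x * F x ^ k)" if "\<kappa> \<in> box s" "k \<le> s" for \<kappa> k
  proof -
    have "sum \<kappa> UNIV \<le> (\<Sum>i\<in>(UNIV :: 'm set). s)"
      using that by (intro sum_mono) (auto simp: box_def)
    then have "poly_in UNIV (CARD('m) * s) (mono_fun \<kappa>)"
      by (intro poly_in_mono_fun) auto
    moreover have "poly_in UNIV (s * t) (\<lambda>x. F x ^ k)"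
      by (rule poly_in_mono [OF poly_in_power [OF t, of k]]) (use that in auto)
    ultimately have "poly_in UNIV (CARD('m) * s + s * t) (\<lambda>x. mono_fun \<kappa> x * F x ^ k)"
      by (rule poly_in_mult)
    then show ?thesis
      by (simp add: d_def M_def algebra_simps)
  qed
  have "card (reduced (d * step)) < card (box s \<times> {..s})"
  proof -
    have "d * step + 1 \<le> (M * step + 1) * (s + 1)"
      by (simp add: d_def algebra_simps)
    then have "(d * step + 1) ^ card J \<le> ((M * step + 1) * (s + 1)) ^ card J"
      by (rule power_mono) simp
    then have "K * (d * step + 1) ^ card J \<le> K * ((M * step + 1) * (s + 1)) ^ card J"
      by (rule mult_left_mono) simp
    also have "\<dots> = s * (s + 1) ^ card J"
      unfolding power_mult_distrib mult.assoc [symmetric] by (simp only: s_def)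
    finally have "K * (d * step + 1) ^ card J \<le> s * (s + 1) ^ card J" .
    moreover have "card (reduced (d * step)) \<le> K * (d * step + 1) ^ card J"
      unfolding K_def by (rule card_reduced)
    moreover have "s * (s + 1) ^ card J < (s + 1) ^ card J * (s + 1)"
      by simp
    ultimately show ?thesis
      using fin by (simp only: card_cartesian_product card_box card_atMost Suc_eq_plus1)
  qed
  moreover have "in_span S (reduced (d * step)) (\<lambda>x. lead x ^ d * (mono_fun (fst p) x * F x ^ snd p))"
    if "p \<in> box s \<times> {..s}" for p
    using in_span_reduced [OF deg [of "fst p" "snd p"]] that by auto
  ultimately have "\<exists>c. (\<exists>p\<in>box s \<times> {..s}. c p \<noteq> 0) \<and>
      (\<forall>x\<in>S. (\<Sum>p\<in>box s \<times> {..s}. c p * (lead x ^ d * (mono_fun (fst p) x * F x ^ snd p))) = 0)"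
    using fin by (intro in_span_dependent [OF finite_reduced]) auto
  then obtain c where c: "\<exists>p\<in>box s \<times> {..s}. c p \<noteq> 0"
      "\<forall>x\<in>S. (\<Sum>p\<in>box s \<times> {..s}. c p * (lead x ^ d * (mono_fun (fst p) x * F x ^ snd p))) = 0"
    by blast
  have "(\<Sum>k\<le>s. mono_comb (box s) (\<lambda>\<kappa>. c (\<kappa>, k)) x * F x ^ k) = 0" if x: "x \<in> S" for x
  proof -
    have "(\<Sum>p\<in>box s \<times> {..s}. c p * (lead x ^ d * (mono_fun (fst p) x * F x ^ snd p)))
        = lead x ^ d * (\<Sum>k\<le>s. mono_comb (box s) (\<lambda>\<kappa>. c (\<kappa>, k)) x * F x ^ k)"
      unfolding sum.cartesian_product' mono_comb_def sum_distrib_left sum_distrib_right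
      by (subst sum.swap) (simp add: mult_ac)
    then show ?thesis
      using c(2) lead [OF x] x by auto
  qed
  then show thesis
    using that [of s "\<lambda>\<kappa> k. c (\<kappa>, k)"] c(1) unfolding box_def by auto
qed

end

section \<open>Regular points of the Zariski closure\<close>

text \<open>The Zariski closure of a set. For the image of a parametrised ball it is also the
  closure of the germ at the centre, by \<open>zariski_closure_germ_eq\<close>.\<close>

definition alg_closure :: "(complex^'m) set \<Rightarrow> (complex^'m) set" where
  "alg_closure S = {x. \<forall>F. is_poly UNIV F \<and> (\<forall>y\<in>S. F y = 0) \<longrightarrow> F x = 0}"

text \<open>Algebraic independence of the coordinate functions with index in \<open>J\<close>,
  restricted to \<open>S\<close>; a formal polynomial is a family of coefficients on a finite set of
  exponents supported in \<open>J\<close>.\<close>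

definition alg_indep :: "(complex^'m) set \<Rightarrow> 'm set \<Rightarrow> bool" where
  "alg_indep S J \<longleftrightarrow> (\<forall>B c. finite B \<and> (\<forall>\<kappa>\<in>B. \<forall>i. i \<notin> J \<longrightarrow> \<kappa> i = 0) \<and>
     (\<forall>x\<in>S. mono_comb B c x = 0) \<longrightarrow> (\<forall>\<kappa>\<in>B. c \<kappa> = 0))"

lemma is_poly_continuous_on: "is_poly J F \<Longrightarrow> continuous_on A F"
  by (meson is_poly_cdiff cdiff_imp_isCont continuous_at_imp_continuous_on)

text \<open>
  Connected submanifolds have this property by the identity theorem.
\<close>

locale locally_zariski_dense =
  fixes S :: "(complex^'m) set"
  assumes nonempty: "S \<noteq> {}"
    and dense: "\<And>F U p x. is_poly UNIV F \<Longrightarrow> open U \<Longrightarrow> p \<in> S \<inter> U \<Longrightarrow>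
      (\<And>y. y \<in> S \<inter> U \<Longrightarrow> F y = 0) \<Longrightarrow> x \<in> S \<Longrightarrow> F x = 0"
begin

text \<open>Polynomials restricted to \<open>S\<close> form an integral domain: \<open>G\<close>
  vanishes on the nonempty relatively open part where \<open>F\<close> does not, hence on all of
  \<open>S\<close>.\<close>

lemma zero_product:
  assumes F: "is_poly UNIV F" and G: "is_poly UNIV G" and FG: "\<And>x. x \<in> S \<Longrightarrow> F x * G x = 0"
    and p: "p \<in> S" "F p \<noteq> 0" and x: "x \<in> S"
  shows "G x = 0"
proof (rule dense [OF G _ _ _ x])
  show "open (F -` (- {0}))"
    by (rule open_vimage) (auto intro: is_poly_continuous_on [OF F])
  show "p \<in> S \<inter> F -` (- {0})"
    using p by simp
  show "G y = 0" if "y \<in> S \<inter> F -` (- {0})" for y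
    using FG [of y] that by auto
qed

lemma nonzero_prod:
  assumes "finite A" "\<And>j. j \<in> A \<Longrightarrow> is_poly UNIV (f j)" "\<And>j. j \<in> A \<Longrightarrow> \<exists>x\<in>S. f j x \<noteq> 0"
  shows "\<exists>x\<in>S. (\<Prod>j\<in>A. f j x) \<noteq> 0"
  using assms
proof (induction A rule: finite_induct)
  case empty
  then show ?case
    using nonempty by auto
next
  case (insert j A)
  obtain p where p: "p \<in> S" "f j p \<noteq> 0"
    using insert.prems(2) [of j] by blast
  obtain x where x: "x \<in> S" "(\<Prod>j\<in>A. f j x) \<noteq> 0"
    using insert by auto
  show ?case
  proof (rule ccontr)
    assume "\<not> ?thesis"
    then have FG: "f j y * (\<Prod>j\<in>A. f j y) = 0" if "y \<in> S" for y
      using that insert.hyps by auto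
    have "(\<Prod>j\<in>A. f j x) = 0"
      by (rule zero_product [where F = "f j" and p = p])
        (use FG insert.prems(1) p x(1) in \<open>auto intro: is_poly_prod\<close>)
    then show False
      using x(2) by simp
  qed
qed

section \<open>Transcendence bases and minimal equations of the coordinates\<close>

lemma maximal_alg_indep:
  obtains J where "alg_indep S J" "\<And>j. j \<notin> J \<Longrightarrow> \<not> alg_indep S (insert j J)"
proof -
  have "alg_indep S {}"
    unfolding alg_indep_def
  proof (intro allI impI ballI, elim conjE)
    fix B :: "('m \<Rightarrow> nat) set" and c \<kappa>
    assume B: "finite B" "\<forall>\<kappa>\<in>B. \<forall>i. i \<notin> {} \<longrightarrow> \<kappa> i = 0" "\<forall>x\<in>S. mono_comb B c x = 0" "\<kappa> \<in> B"
    then have "B \<subseteq> {\<lambda>_. 0}"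
      by (auto simp: fun_eq_iff)
    then have "B = {\<lambda>_. 0}" "\<kappa> = (\<lambda>_. 0)"
      using B(4) by blast+
    then show "c \<kappa> = 0"
      using B(3,4) nonempty by (auto simp: mono_comb_def)
  qed
  then obtain J where J: "alg_indep S J" "\<And>K. alg_indep S K \<Longrightarrow> J \<subseteq> K \<Longrightarrow> J = K"
    using finite_has_maximal [of "{J. alg_indep S J}"] finite_subset [OF subset_UNIV, of "{J. alg_indep S J}"] by auto
  show thesis
    by (rule that [OF J(1)]) (use J(2) in blast)
qed

definition algebraic_of_degree :: "'m set \<Rightarrow> 'm \<Rightarrow> nat \<Rightarrow> (nat \<Rightarrow> complex^'m \<Rightarrow> complex) \<Rightarrow> bool" where
  "algebraic_of_degree J j D a \<longleftrightarrow> (\<forall>k. is_poly J (a k)) \<and> (\<exists>x\<in>S. a D x \<noteq> 0) \<and>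
     (\<forall>x\<in>S. (\<Sum>k\<le>D. a k x * x $ j ^ k) = 0)"

text \<open>A dependence over \<open>insert j J\<close> is sorted by powers of coordinate
  \<open>j\<close>. Some coefficient is a nontrivial combination of monomials in \<open>J\<close>,
  so it is not identically zero on \<open>S\<close>; the degree is the highest power with such a
  coefficient, and the terms above it vanish on \<open>S\<close>.\<close>

lemma algebraic_of_degree_exists:
  assumes J: "alg_indep S J" and j: "\<not> alg_indep S (insert j J)"
  shows "\<exists>D a. algebraic_of_degree J j D a"
proof -
  obtain B c where "finite B \<and> (\<forall>\<kappa>\<in>B. \<forall>i. i \<notin> insert j J \<longrightarrow> \<kappa> i = 0) \<and> (\<forall>x\<in>S. mono_comb B c x = 0)"
      and "\<not> (\<forall>\<kappa>\<in>B. c \<kappa> = 0)"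
    using j unfolding alg_indep_def not_all not_imp by (elim exE conjE) (rule that, intro conjI)
  then obtain \<mu> where B: "finite B" "\<forall>\<kappa>\<in>B. \<forall>i. i \<notin> insert j J \<longrightarrow> \<kappa> i = 0" "\<forall>x\<in>S. mono_comb B c x = 0"
      and \<mu>: "\<mu> \<in> B" "c \<mu> \<noteq> 0"
    by blast
  define a where "a k x = (\<Sum>\<kappa>\<in>{\<kappa>\<in>B. \<kappa> j = k}. c \<kappa> * mono_fun (\<kappa>(j := 0)) x)" for k x
  have pol: "is_poly J (a k)" for k
    unfolding a_def
    by (intro is_poly_sum is_poly_intros is_poly_mono_fun) (use B(2) in auto)
  have nz: "\<exists>x\<in>S. a (\<mu> j) x \<noteq> 0"
  proof (rule ccontr)
    assume "\<not> ?thesis"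
    then have z: "a (\<mu> j) x = 0" if "x \<in> S" for x
      using that by blast
    \<comment> \<open>Clearing the entry \<open>j\<close> is injective where that entry is fixed, so
      no two coefficients merge and \<open>c \<mu>\<close> survives.\<close>
    define B' where "B' = (\<lambda>\<kappa>. \<kappa>(j := 0)) ` {\<kappa>\<in>B. \<kappa> j = \<mu> j}"
    have inj: "inj_on (\<lambda>\<kappa>. \<kappa>(j := 0)) {\<kappa>\<in>B. \<kappa> j = \<mu> j}"
    proof (rule inj_onI)
      fix \<kappa> \<kappa>' assume *: "\<kappa> \<in> {\<kappa>\<in>B. \<kappa> j = \<mu> j}" "\<kappa>' \<in> {\<kappa>\<in>B. \<kappa> j = \<mu> j}" "\<kappa>(j := 0) = \<kappa>'(j := 0)"
      then have "\<kappa> i = \<kappa>' i" for i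
        by (cases "i = j") (auto dest: fun_cong [of _ _ i])
      then show "\<kappa> = \<kappa>'"
        by blast
    qed
    have eq: "mono_comb B' (\<lambda>\<kappa>. c (\<kappa>(j := \<mu> j))) x = a (\<mu> j) x" for x
      unfolding mono_comb_def B'_def a_def sum.reindex [OF inj] o_def
      by (intro sum.cong) (auto simp: fun_upd_idem)
    have "finite B' \<and> (\<forall>\<kappa>\<in>B'. \<forall>i. i \<notin> J \<longrightarrow> \<kappa> i = 0) \<and>
        (\<forall>x\<in>S. mono_comb B' (\<lambda>\<kappa>. c (\<kappa>(j := \<mu> j))) x = 0)"
      unfolding eq using B(1,2) z by (auto simp: B'_def)
    from J [unfolded alg_indep_def, THEN spec, THEN spec, THEN mp, OF this]
    have "\<forall>\<kappa>\<in>B'. c (\<kappa>(j := \<mu> j)) = 0" .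
    then have "c \<mu> = 0"
      using \<mu>(1) by (fastforce simp: B'_def fun_upd_idem)
    then show False
      using \<mu>(2) by simp
  qed
  define m where "m = Max ((\<lambda>\<kappa>. \<kappa> j) ` B)"
  have m: "\<kappa> j \<le> m" if "\<kappa> \<in> B" for \<kappa>
    using that B(1) by (simp add: m_def)
  define Q where "Q = {k. k \<le> m \<and> (\<exists>x\<in>S. a k x \<noteq> 0)}"
  define D where "D = Max Q"
  have Q: "finite Q" "\<mu> j \<in> Q"
    using nz m [OF \<mu>(1)] by (auto simp: Q_def)
  then have "D \<in> Q"
    unfolding D_def by (intro Max_in) auto
  then have D: "D \<le> m" "\<exists>x\<in>S. a D x \<noteq> 0"
    by (auto simp: Q_def)
  have above: "k \<le> D" if "k \<le> m" "x \<in> S" "a k x \<noteq> 0" for k x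
    unfolding D_def using Q(1) that by (intro Max_ge) (auto simp: Q_def)
  have "(\<Sum>k\<le>D. a k x * x $ j ^ k) = 0" if x: "x \<in> S" for x
  proof -
    have "(\<Sum>k\<le>D. a k x * x $ j ^ k) = (\<Sum>k\<le>m. a k x * x $ j ^ k)"
    proof (rule sum.mono_neutral_left)
      show "\<forall>k\<in>{..m} - {..D}. a k x * x $ j ^ k = 0"
        using above [OF _ x] by fastforce
    qed (use D(1) in auto)
    also have "\<dots> = (\<Sum>k\<le>m. \<Sum>\<kappa>\<in>{\<kappa>\<in>B. \<kappa> j = k}. c \<kappa> * mono_fun \<kappa> x)"
      unfolding a_def sum_distrib_right
    proof (intro sum.cong refl)
      fix k \<kappa> assume "\<kappa> \<in> {\<kappa>\<in>B. \<kappa> j = k}"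
      then show "c \<kappa> * mono_fun (\<kappa>(j := 0)) x * x $ j ^ k = c \<kappa> * mono_fun \<kappa> x"
        using mono_fun_upd [of \<kappa> j k x] by (auto simp: fun_upd_idem)
    qed
    also have "\<dots> = mono_comb B c x"
      unfolding mono_comb_def using B(1) m by (intro sum.group) auto
    finally show ?thesis
      using B(3) x by simp
  qed
  then show ?thesis
    unfolding algebraic_of_degree_def using pol D(2) by blast
qed

text \<open>In a minimal equation the derivative in coordinate \<open>j\<close> cannot vanish
  identically on \<open>S\<close>: it would be an equation of degree \<open>D j - 1\<close> whose
  leading coefficient is \<open>D j\<close> times the old one, nonzero in characteristic 0. This
  transversality feeds the inverse function theorem.\<close>

lemma minimal_equations:
  obtains J D a E where "alg_indep S J" "algebraic_branch S J D a E"
    "\<And>j. j \<notin> J \<Longrightarrow> \<exists>x\<in>S. a j (D j) x \<noteq> 0"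
    "\<And>j. j \<notin> J \<Longrightarrow> \<exists>x\<in>S. (\<Sum>k<D j. of_nat (Suc k) * a j (Suc k) x * x $ j ^ k) \<noteq> 0"
proof -
  obtain J where J: "alg_indep S J" "\<And>j. j \<notin> J \<Longrightarrow> \<not> alg_indep S (insert j J)"
    by (rule maximal_alg_indep) blast
  define D where "D j = (LEAST d. \<exists>a. algebraic_of_degree J j d a)" for j
  have "\<exists>a. algebraic_of_degree J j (D j) a" if "j \<notin> J" for j
    unfolding D_def using algebraic_of_degree_exists [OF J(1) J(2) [OF that]] by (rule LeastI_ex)
  then obtain a where a: "\<And>j. j \<notin> J \<Longrightarrow> algebraic_of_degree J j (D j) (a j)"
    by metis
  have least: "D j \<le> d" if "algebraic_of_degree J j d b" for j d b
    unfolding D_def using that by (intro Least_le) blast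
  have Dpos: "0 < D j" if "j \<notin> J" for j
  proof (rule ccontr)
    assume "\<not> ?thesis"
    then show False
      using a [OF that] by (auto simp: algebraic_of_degree_def)
  qed
  have "\<exists>t. poly_in J t (a j k)" if "j \<notin> J" for j k
    using a [OF that] unfolding algebraic_of_degree_def is_poly_def by blast
  then obtain t where t: "\<And>j k. j \<notin> J \<Longrightarrow> poly_in J (t j k) (a j k)"
    by metis
  \<comment> \<open>The sum is a convenient common upper bound for the degrees of the finitely many
    coefficients \<open>a j k\<close> with \<open>k \<le> D j\<close>.\<close>
  define E where "E = (\<Sum>j\<in>UNIV. \<Sum>k\<le>D j. t j k)"
  have tE: "t j k \<le> E" if "k \<le> D j" for j k
  proof -
    have "t j k \<le> (\<Sum>k\<le>D j. t j k)"
      using that by (intro member_le_sum) auto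
    also have "\<dots> \<le> E"
      unfolding E_def by (rule member_le_sum [of j UNIV "\<lambda>j. \<Sum>k\<le>D j. t j k"]) auto
    finally show ?thesis .
  qed
  have branch: "algebraic_branch S J D a E"
  proof
    show "poly_in J E (a j k)" if "j \<notin> J" "k \<le> D j" for j k
      by (rule poly_in_mono [OF t [OF that(1)] tE [OF that(2)] order_refl])
    show "(\<Sum>k\<le>D j. a j k x * x $ j ^ k) = 0" if "j \<notin> J" "x \<in> S" for j x
      using a [OF that(1)] that(2) unfolding algebraic_of_degree_def by blast
  qed (rule Dpos)
  have der: "\<exists>x\<in>S. (\<Sum>k<D j. of_nat (Suc k) * a j (Suc k) x * x $ j ^ k) \<noteq> 0" if j: "j \<notin> J" for j
  proof (rule ccontr)
    assume *: "\<not> ?thesis"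
    have "algebraic_of_degree J j (D j - 1) (\<lambda>k x. of_nat (Suc k) * a j (Suc k) x)"
      unfolding algebraic_of_degree_def
    proof (intro conjI allI ballI)
      show "is_poly J (\<lambda>x. of_nat (Suc k) * a j (Suc k) x)" for k
        using a [OF j] unfolding algebraic_of_degree_def by (intro is_poly_intros) blast
      obtain x where "x \<in> S" "a j (D j) x \<noteq> 0"
        using a [OF j] unfolding algebraic_of_degree_def by blast
      then show "\<exists>x\<in>S. of_nat (Suc (D j - 1)) * a j (Suc (D j - 1)) x \<noteq> 0"
        using Dpos [OF j] by (intro bexI [of _ x]) auto
      fix x assume "x \<in> S"
      moreover have "{..D j - 1} = {..<D j}"
        using Dpos [OF j] by auto
      ultimately show "(\<Sum>k\<le>D j - 1. of_nat (Suc k) * a j (Suc k) x * x $ j ^ k) = 0"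
        using * by auto
    qed
    then show False
      using least Dpos [OF j] by fastforce
  qed
  show thesis
    by (rule that [OF J(1) branch _ der]) (use a in \<open>auto simp: algebraic_of_degree_def\<close>)
qed

end

section \<open>Coordinate subspaces and the complex inverse function theorem\<close>

lemma dim_coordinate_subspace:
  fixes J :: "'m::finite set"
  defines "L \<equiv> {y :: complex^'m. \<forall>i. i \<notin> J \<longrightarrow> y $ i = 0}"
  shows "vec.subspace L" "vec.dim L = card J"
proof -
  show "vec.subspace L"
    unfolding vec.subspace_def L_def by auto
  let ?B = "(\<lambda>i. axis i 1 :: complex^'m) ` J"
  show "vec.dim L = card J"
  proof (rule vec.dim_unique [where B = ?B])
    show "?B \<subseteq> L"
      by (auto simp: L_def axis_def)
    show "L \<subseteq> vec.span ?B"
    proof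
      fix y assume y: "y \<in> L"
      have "y = (\<Sum>i\<in>UNIV. y $ i *s axis i 1)"
        by (simp add: sum_axis_component flip: axis_eq_smult)
      also have "\<dots> = (\<Sum>i\<in>J. y $ i *s axis i 1)"
        using y by (intro sum.mono_neutral_right) (auto simp: L_def)
      also have "\<dots> \<in> vec.span ?B"
        by (intro vec.span_sum vec.span_scale vec.span_base) auto
      finally show "y \<in> vec.span ?B" .
    qed
    show "vec.independent ?B"
      by (rule vec.independent_mono [OF independent_cart_basis]) (auto simp: cart_basis_def)
    show "card ?B = card J"
      by (rule card_image) (auto simp: inj_on_def axis_eq_axis)
  qed
qed

text \<open>The real inverse function theorem applies because the partial derivatives are continuous
  and the injective derivative has a linear left inverse. The inverse of a complex-linear bijection
  is complex linear, so the local inverse is holomorphic.\<close>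

theorem complex_inverse_function:
  fixes F :: "complex^'m \<Rightarrow> complex^'m"
  assumes hol: "\<And>i. hol (\<lambda>x. F x $ i) UNIV"
    and inj: "\<And>v. (\<And>i. (\<Sum>j\<in>UNIV. v $ j * partial_deriv j (\<lambda>x. F x $ i) p) = 0) \<Longrightarrow> v = 0"
  obtains U V g where "open U" "p \<in> U" "open V" "F p \<in> V" "homeomorphism U V F g" "\<forall>i. hol (\<lambda>y. g y $ i) V"
proof -
  define d where "d x v = (\<chi> i. \<Sum>j\<in>UNIV. v $ j * partial_deriv j (\<lambda>x. F x $ i) x)" for x v
  have derF: "(F has_derivative d x) (at x)" for x
  proof (rule has_derivative_vec)
    fix i
    obtain D where D: "has_cderiv (\<lambda>x. F x $ i) D x"
      using hol unfolding hol_def cdiff_iff by blast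
    have "D = (\<lambda>v. d x v $ i)"
      by (simp add: d_def fun_eq_iff has_cderiv_partials [OF D])
    then show "((\<lambda>x. F x $ i) has_derivative (\<lambda>v. d x v $ i)) (at x)"
      using D by (simp add: has_cderiv_def)
  qed
  have bl: "bounded_linear (d x)" for x
    using derF has_derivative_bounded_linear by blast
  have dsmult: "d x (c *s v) = c *s d x v" for x c v
    by (simp add: d_def cart_eq_iff sum_distrib_left mult.assoc)
  define f' where "f' x = Blinfun (d x)" for x
  have f': "blinfun_apply (f' x) = d x" for x
    unfolding f'_def by (rule bounded_linear_Blinfun_apply [OF bl])
  have cont: "continuous_on UNIV f'"
  proof (rule continuous_on_blinfun_componentwise)
    fix v :: "complex^'m"
    have "continuous_on UNIV (partial_deriv j (\<lambda>x. F x $ i))" for i j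
      by (rule hol_imp_continuous_on [OF partial_deriv_hol [OF open_UNIV hol]])
    then show "continuous_on UNIV (\<lambda>x. blinfun_apply (f' x) v)"
      unfolding f' d_def by (intro continuous_intros continuous_on_vec_lambda)
  qed
  have "inj (d p)"
  proof (rule injI)
    fix u v assume "d p u = d p v"
    then have "d p (u - v) = 0"
      using bounded_linear.linear [OF bl, THEN linear_diff] by simp
    then have "u - v = 0"
      by (intro inj) (simp add: d_def cart_eq_iff)
    then show "u = v"
      by simp
  qed
  then obtain g0 where g0: "linear g0" "g0 \<circ> d p = id"
    using linear_injective_left_inverse [OF bounded_linear.linear [OF bl]] by blast
  have g0bl: "bounded_linear g0"
    using g0(1) linear_conv_bounded_linear by blast
  have inv: "Blinfun g0 o\<^sub>L f' p = id_blinfun"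
    by (rule blinfun_eqI) (use g0(2) in \<open>simp add: f' bounded_linear_Blinfun_apply [OF g0bl] fun_eq_iff\<close>)
  obtain U V g g' where U: "open U" "p \<in> U" "open V" "F p \<in> V" "homeomorphism U V F g"
    and g: "\<And>y. y \<in> V \<Longrightarrow> (g has_derivative (g' y)) (at y)"
      "\<And>y. y \<in> V \<Longrightarrow> g' y = inv_into UNIV (blinfun_apply (f' (g y)))"
      "\<And>y. y \<in> V \<Longrightarrow> bij (blinfun_apply (f' (g y)))"
    using inverse_function_theorem [OF open_UNIV, of F f' p "Blinfun g0"] derF f' cont inv
    by (metis UNIV_I)
  have "hol (\<lambda>y. g y $ i) V" for i
    unfolding hol_def
  proof
    fix y assume y: "y \<in> V"
    have bij: "bij (d (g y))"
      using g(3) [OF y] by (simp add: f')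
    have g': "g' y = inv_into UNIV (d (g y))"
      using g(2) [OF y] by (simp add: f')
    have "g' y (c *s v) = c *s g' y v" for c v
    proof -
      have "d (g y) (c *s g' y v) = c *s v"
        using bij by (simp add: dsmult g' bij_is_surj surj_f_inv_f)
      then show ?thesis
        using bij by (metis bij_inv_eq_iff g')
    qed
    moreover have "((\<lambda>y. g y $ i) has_derivative (\<lambda>v. g' y v $ i)) (at y)"
      by (rule bounded_linear.has_derivative [OF bounded_linear_vec_nth g(1) [OF y]])
    ultimately have "has_cderiv (\<lambda>y. g y $ i) (\<lambda>v. g' y v $ i) y"
      by (simp add: has_cderiv_def)
    then show "complex_differentiable_at (\<lambda>y. g y $ i) y"
      using cdiff_iff by blast
  qed
  then show thesis
    using that U by blast
qed

section \<open>The closure as a graph near a generic point\<close>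

context locally_zariski_dense
begin

lemma subset_alg_closure: "S \<subseteq> alg_closure S"
  by (auto simp: alg_closure_def)

text \<open>
  Near a point where the equations of the coordinates outside a transcendence basis are transversal,
  their common zero set is a graph over the basis coordinates. A polynomial vanishing on \<open>S\<close> satisfies on
  this graph an algebraic relation over the basis coordinates, whose lowest coefficient would
  otherwise be a polynomial in the basis coordinates vanishing on \<open>S\<close>; so the graph is all of the
  closure.
\<close>

theorem regular_point_of_alg_closure:
  obtains k C p U where "open U" "p \<in> alg_closure S \<inter> U"
    "complex_submanifold k U (alg_closure S \<inter> U)"
    "\<forall>d B. 1 \<le> d \<longrightarrow> B \<subseteq> {\<nu>. sum \<nu> UNIV \<le> d} \<longrightarrow>
       (\<forall>c. (\<forall>x\<in>S. mono_comb B c x = 0) \<longrightarrow> (\<forall>\<nu>\<in>B. c \<nu> = 0)) \<longrightarrow> card B \<le> C * d ^ k"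
proof -
  obtain J D a E where J: "alg_indep S J" and branch: "algebraic_branch S J D a E"
    and lead_nz: "\<And>j. j \<notin> J \<Longrightarrow> \<exists>x\<in>S. a j (D j) x \<noteq> 0"
    and der_nz: "\<And>j. j \<notin> J \<Longrightarrow> \<exists>x\<in>S. (\<Sum>k<D j. of_nat (Suc k) * a j (Suc k) x * x $ j ^ k) \<noteq> 0"
    by (rule minimal_equations) blast
  interpret algebraic_branch S J D a E
    by (rule branch)
  define P where "P j x = (\<Sum>k\<le>D j. a j k x * x $ j ^ k)" for j x
  define dP where "dP j x = (\<Sum>k<D j. of_nat (Suc k) * a j (Suc k) x * x $ j ^ k)" for j x
  have polya: "is_poly J (a j k)" if "j \<notin> J" "k \<le> D j" for j k
    using coeffs [OF that] unfolding is_poly_def by blast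
  have polyP: "is_poly UNIV (P j)" if "j \<notin> J" for j
    unfolding P_def using polya [OF that] is_poly_UNIV by (intro is_poly_sum is_poly_intros) auto
  have polydP: "is_poly UNIV (dP j)" if "j \<notin> J" for j
    unfolding dP_def
  proof (intro is_poly_sum is_poly_intros)
    show "is_poly UNIV (a j (Suc k))" if "k \<in> {..<D j}" for k
      using polya [OF \<open>j \<notin> J\<close>, of "Suc k"] that is_poly_UNIV by auto
  qed auto
  have polylead: "is_poly UNIV lead"
    unfolding lead_def using polya is_poly_UNIV by (intro is_poly_prod) auto
  \<comment> \<open>A single point where no leading coefficient and no derivative of a minimal
    equation vanishes; it exists because a finite product of polynomials that are not identically
    zero on \<open>S\<close> is not identically zero either.\<close>
  have "\<exists>p\<in>S. (\<Prod>j\<in>- J. a j (D j) p * dP j p) \<noteq> 0"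
  proof (rule nonzero_prod)
    fix j assume "j \<in> - J"
    then have j: "j \<notin> J"
      by simp
    show "is_poly UNIV (\<lambda>x. a j (D j) x * dP j x)"
      by (intro is_poly_intros polydP [OF j] is_poly_UNIV [OF polya [OF j order_refl]])
    obtain q where q: "q \<in> S" "a j (D j) q \<noteq> 0"
      using lead_nz [OF j] by blast
    obtain x where x: "x \<in> S" "dP j x \<noteq> 0"
      using der_nz [OF j] unfolding dP_def by blast
    show "\<exists>x\<in>S. a j (D j) x * dP j x \<noteq> 0"
    proof (rule ccontr)
      assume "\<not> ?thesis"
      then have "dP j x = 0"
        using zero_product [OF is_poly_UNIV [OF polya [OF j order_refl]] polydP [OF j] _ q x(1)] by blast
      then show False
        using x(2) by simp
    qed
  qed simp
  then obtain p where p: "p \<in> S" "\<And>j. j \<notin> J \<Longrightarrow> a j (D j) p \<noteq> 0" "\<And>j. j \<notin> J \<Longrightarrow> dP j p \<noteq> 0"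
    by auto
  have leadp: "lead p \<noteq> 0"
    using p(2) by (simp add: lead_def)
  \<comment> \<open>From \<open>d * step + 1 \<le> d * (step + 1)\<close>, valid for
    \<open>d \<ge> 1\<close>.\<close>
  define C where "C = (\<Prod>j\<in>- J. D j) * (step + 1) ^ card J"
  have count: "card B \<le> C * d ^ card J"
    if d: "1 \<le> d" and B: "B \<subseteq> {\<nu>. sum \<nu> UNIV \<le> d}"
      and ind: "\<forall>c. (\<forall>x\<in>S. mono_comb B c x = 0) \<longrightarrow> (\<forall>\<nu>\<in>B. c \<nu> = 0)" for d B
  proof -
    have "card B \<le> (\<Prod>j\<in>- J. D j) * (d * step + 1) ^ card J"
    proof (rule card_indep_le [OF B])
      fix c assume c: "\<And>x. x \<in> S \<Longrightarrow> lead x ^ d * mono_comb B c x = 0"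
      have "finite B"
        using B finite_exponents_upto finite_subset by blast
      have "is_poly UNIV (mono_comb B c)"
        unfolding mono_comb_def [abs_def] by (intro is_poly_sum is_poly_intros is_poly_mono_fun) auto
      \<comment> \<open>The factor \<open>lead ^ d\<close> cancels, since polynomials on
        \<open>S\<close> have no zero divisors.\<close>
      then have "mono_comb B c x = 0" if "x \<in> S" for x
        using zero_product [OF is_poly_intros(5) [OF polylead] _ c p(1) _ that] leadp by simp
      then show "\<forall>\<nu>\<in>B. c \<nu> = 0"
        using ind by blast
    qed
    also have "\<dots> \<le> (\<Prod>j\<in>- J. D j) * (d * (step + 1)) ^ card J"
      using d by (intro mult_left_mono power_mono) (auto simp: algebra_simps)
    finally show ?thesis
      by (simp only: C_def power_mult_distrib mult_ac)
  qed
  \<comment> \<open>Straightening map: it keeps the coordinates in \<open>J\<close> and replaces the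
    others by their equations, so that the common zero set becomes a coordinate subspace.\<close>
  define F where "F x = (\<chi> i. if i \<in> J then x $ i else P i x)" for x
  have holF: "hol (\<lambda>x. F x $ i) UNIV" for i
    unfolding hol_def F_def using is_poly_cdiff [OF polyP] cdiff_intros(2) by (cases "i \<in> J") auto
  have "v = 0" if v: "\<And>i. (\<Sum>j\<in>UNIV. v $ j * partial_deriv j (\<lambda>x. F x $ i) p) = 0" for v
  proof -
    have vJ: "v $ i = 0" if "i \<in> J" for i
    proof -
      have "(\<lambda>x. F x $ i) = (\<lambda>x. x $ i)"
        using that by (simp add: F_def)
      then show ?thesis
        using v [of i] has_cderiv_partials [OF has_cderiv_coord [of i p], of v] by simp
    qed
    have "v $ i = 0" if i: "i \<notin> J" for i
    proof -
      obtain Q where Q: "has_cderiv (P i) Q p"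
        using is_poly_cdiff [OF polyP [OF i]] cdiff_iff by blast
      have "(\<lambda>x. F x $ i) = P i"
        using i by (simp add: F_def fun_eq_iff)
      then have "Q v = 0"
        using v [of i] has_cderiv_partials [OF Q, of v] by simp
      moreover have "((\<lambda>t. P i (p + t *s v)) has_field_derivative Q v) (at 0)"
        using Q by (intro has_cderiv_line) simp
      \<comment> \<open>Since \<open>v\<close> vanishes on \<open>J\<close>, the coefficients, being
        polynomials in the coordinates of \<open>J\<close>, are constant along the line: the
        Jacobian is block triangular, with diagonal entries \<open>dP i p\<close> outside
        \<open>J\<close>.\<close>
      moreover have "P i (p + t *s v) = (\<Sum>k\<le>D i. a i k p * (p $ i + t * v $ i) ^ k)" for t
      proof -
        have "a i k (p + t *s v) = a i k p" if "k \<le> D i" for k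
          by (rule is_poly_cong_on [OF polya [OF i that]]) (simp add: vJ)
        then show ?thesis
          by (simp add: P_def)
      qed
      moreover have "((\<lambda>t. \<Sum>k\<le>D i. a i k p * (p $ i + t * v $ i) ^ k) has_field_derivative
          (\<Sum>k\<le>D i. a i k p * (of_nat k * p $ i ^ (k - 1) * v $ i))) (at 0)"
        by (auto intro!: derivative_eq_intros sum.cong)
      ultimately have "(\<Sum>k\<le>D i. a i k p * (of_nat k * p $ i ^ (k - 1) * v $ i)) = 0"
        using DERIV_unique by simp
      moreover have "(\<Sum>k\<le>D i. a i k p * (of_nat k * p $ i ^ (k - 1) * v $ i)) = dP i p * v $ i"
        by (simp add: sum.atMost_shift dP_def sum_distrib_left sum_distrib_right mult_ac)
      ultimately have "dP i p * v $ i = 0"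
        by simp
      then show ?thesis
        using p(3) [OF i] by simp
    qed
    then show ?thesis
      using vJ by (auto simp: cart_eq_iff)
  qed
  then obtain U V g where U: "open U" "p \<in> U" "open V" "F p \<in> V" "homeomorphism U V F g"
      and holg: "\<forall>i. hol (\<lambda>y. g y $ i) V"
    using complex_inverse_function [OF holF] by blast
  have gF: "\<And>x. x \<in> U \<Longrightarrow> g (F x) = x" and Fg: "\<And>y. y \<in> V \<Longrightarrow> F (g y) = y"
    and FU: "F ` U = V" and gV: "g ` V = U" and contF: "continuous_on U F" and contg: "continuous_on V g"
    using U(5) unfolding homeomorphism_def by auto
  have "open (V \<inter> g -` (lead -` (- {0})))"
    by (intro continuous_open_preimage [OF contg U(3)] open_vimage is_poly_continuous_on [OF polylead]) auto
  moreover have "F p \<in> V \<inter> g -` (lead -` (- {0}))"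
    using U(2,4) gF leadp by simp
  ultimately obtain \<rho> where \<rho>: "\<rho> > 0" "ball (F p) \<rho> \<subseteq> V \<inter> g -` (lead -` (- {0}))"
    using open_contains_ball by blast
  \<comment> \<open>A ball, because \<open>hol_identity\<close> needs convexity, and small enough
    for \<open>lead\<close> not to vanish on the branch, as \<open>algebraic_relation\<close>
    requires.\<close>
  define V0 where "V0 = ball (F p) \<rho>"
  define U0 where "U0 = U \<inter> F -` V0"
  have V0: "open V0" "convex V0" "V0 \<subseteq> V" "F p \<in> V0" "\<And>y. y \<in> V0 \<Longrightarrow> lead (g y) \<noteq> 0"
    using \<rho> by (auto simp: V0_def)
  have U0: "open U0"
    unfolding U0_def by (rule continuous_open_preimage [OF contF U(1) V0(1)])
  have gV0: "g y \<in> U0" if "y \<in> V0" for y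
    using that V0(3) Fg gV by (auto simp: U0_def)
  have pU0: "p \<in> U0"
    using U(2) V0(4) by (simp add: U0_def)
  have bihol: "biholomorphism U0 V0 F g"
    unfolding biholomorphism_def
  proof (intro conjI ballI)
    show "holo_map_on F U0"
      unfolding holo_map_on_def using holo_on_open_iff [OF U0] hol_subset [OF holF] by blast
    show "holo_map_on g V0"
      unfolding holo_map_on_def using holo_on_open_iff [OF V0(1)] hol_subset V0(3) holg by blast
    show "F ` U0 = V0"
      using gV0 V0(3) Fg by (force simp: U0_def)
    show "g ` V0 = U0"
      using gV0 gF by (force simp: U0_def)
  qed (use gF Fg V0(3) in \<open>auto simp: U0_def\<close>)
  define L where "L = {y :: complex^'m. \<forall>i. i \<notin> J \<longrightarrow> y $ i = 0}"
  have L: "vec.subspace L" "vec.dim L = card J"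
    unfolding L_def by (rule dim_coordinate_subspace)+
  define Y where "Y = g ` (L \<inter> V0)"
  have Y_iff: "x \<in> Y \<longleftrightarrow> (\<forall>j. j \<notin> J \<longrightarrow> P j x = 0)" if x: "x \<in> U0" for x
  proof -
    have "x \<in> Y \<longleftrightarrow> F x \<in> L"
    proof
      assume "x \<in> Y"
      then show "F x \<in> L"
        using Fg V0(3) by (auto simp: Y_def)
    next
      assume "F x \<in> L"
      then show "x \<in> Y"
        using x gF by (auto simp: Y_def U0_def image_iff intro!: bexI [of _ "F x"])
    qed
    then show ?thesis
      by (simp add: L_def F_def)
  qed
  have YU0: "Y \<subseteq> U0"
    using gV0 by (auto simp: Y_def)
  have closure_Y: "alg_closure S \<inter> U0 = Y"
  proof
    show "alg_closure S \<inter> U0 \<subseteq> Y"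
    proof
      fix x assume x: "x \<in> alg_closure S \<inter> U0"
      have "P j x = 0" if "j \<notin> J" for j
        using x polyP [OF that] root [OF that] unfolding alg_closure_def P_def by blast
      then show "x \<in> Y"
        using Y_iff x by blast
    qed
    have SY: "S \<inter> U0 \<subseteq> Y"
      using \<open>alg_closure S \<inter> U0 \<subseteq> Y\<close> subset_alg_closure by blast
    have "G x = 0" if G: "is_poly UNIV G" "\<forall>y\<in>S. G y = 0" and x: "x \<in> Y" for G x
    proof (rule ccontr)
      assume nz: "G x \<noteq> 0"
      have "algebraic_branch Y J D a E"
      proof
        show "(\<Sum>k\<le>D j. a j k x * x $ j ^ k) = 0" if "j \<notin> J" "x \<in> Y" for j x
          using Y_iff [of x] that YU0 by (auto simp: P_def)
      qed (use D_pos coeffs in auto)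
      then interpret Y: algebraic_branch Y J D a E .
      have "\<And>x. x \<in> Y \<Longrightarrow> lead x \<noteq> 0"
        using V0(5) by (auto simp: Y_def)
      then obtain s c where c: "\<exists>\<kappa>\<in>{\<kappa>. (\<forall>i. i \<notin> J \<longrightarrow> \<kappa> i = 0) \<and> (\<forall>i. \<kappa> i \<le> s)}. \<exists>k\<le>s. c \<kappa> k \<noteq> 0"
        "\<forall>x\<in>Y. (\<Sum>k\<le>s. mono_comb {\<kappa>. (\<forall>i. i \<notin> J \<longrightarrow> \<kappa> i = 0) \<and> (\<forall>i. \<kappa> i \<le> s)} (\<lambda>\<kappa>. c \<kappa> k) x * G x ^ k) = 0"
        by (rule Y.algebraic_relation [OF _ G(1)])
      define box where "box = {\<kappa> :: 'm \<Rightarrow> nat. (\<forall>i. i \<notin> J \<longrightarrow> \<kappa> i = 0) \<and> (\<forall>i. \<kappa> i \<le> s)}"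
      have finbox: "finite box"
      proof (rule finite_subset)
        show "box \<subseteq> Pi\<^sub>E UNIV (\<lambda>_. {..s})"
          by (auto simp: box_def)
      qed (intro finite_PiE; simp)
      define q where "q k = mono_comb box (\<lambda>\<kappa>. c \<kappa> k)" for k
      have rel: "(\<Sum>k\<le>s. q k x * G x ^ k) = 0" if "x \<in> Y" for x
        using c(2) that by (simp add: q_def box_def)
      \<comment> \<open>The lowest power of \<open>G\<close> with a nontrivial coefficient. Dividing
        by \<open>G ^ k0\<close> leaves an expression \<open>R\<close> whose constant term is that
        coefficient.\<close>
      define k0 where "k0 = (LEAST k. k \<le> s \<and> (\<exists>\<kappa>\<in>box. c \<kappa> k \<noteq> 0))"
      have "\<exists>k. k \<le> s \<and> (\<exists>\<kappa>\<in>box. c \<kappa> k \<noteq> 0)"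
        using c(1) unfolding box_def by blast
      then have k0: "k0 \<le> s" "\<exists>\<kappa>\<in>box. c \<kappa> k0 \<noteq> 0"
        unfolding k0_def by (rule LeastI2_ex, blast)+
      have below: "q k x = 0" if "k < k0" for k x
      proof -
        have "\<forall>\<kappa>\<in>box. c \<kappa> k = 0"
          using not_less_Least [of k "\<lambda>k. k \<le> s \<and> (\<exists>\<kappa>\<in>box. c \<kappa> k \<noteq> 0)"] that k0(1)
          by (simp flip: k0_def)
        then show ?thesis
          by (simp add: q_def mono_comb_def)
      qed
      define R where "R x = (\<Sum>k\<in>{k0..s}. q k x * G x ^ (k - k0))" for x
      have factor: "G x ^ k0 * R x = 0" if "x \<in> Y" for x
      proof -
        have "(\<Sum>k\<le>s. q k x * G x ^ k) = (\<Sum>k\<in>{k0..s}. q k x * G x ^ k)"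
          using below by (intro sum.mono_neutral_right) auto
        also have "\<dots> = (\<Sum>k\<in>{k0..s}. G x ^ k0 * (q k x * G x ^ (k - k0)))"
          by (intro sum.cong) (auto simp flip: power_add)
        finally show ?thesis
          using rel [OF that] by (simp add: R_def sum_distrib_left)
      qed
      have polyq: "is_poly UNIV (q k)" for k
        unfolding q_def mono_comb_def [abs_def] by (intro is_poly_sum is_poly_intros is_poly_mono_fun) auto
      have polyR: "is_poly UNIV R"
        unfolding R_def by (intro is_poly_sum is_poly_intros polyq G(1))
      have holV0: "hol (\<lambda>y. H (g y)) V0" if "is_poly UNIV H" for H
        using hol_compose_param [OF is_poly_cdiff [OF that] holg] hol_subset V0(3) by blast
      obtain y1 where y1: "y1 \<in> L \<inter> V0" "x = g y1"
        using x by (auto simp: Y_def)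
      \<comment> \<open>\<open>G ^ k0\<close> can be cancelled only where \<open>G\<close> is
        nonzero, which is ensured near \<open>x\<close>; the identity theorem on
        \<open>L \<inter> V0\<close> extends \<open>R = 0\<close> to the whole branch.\<close>
      have "isCont (\<lambda>y. G (g y)) y1"
        using holV0 [OF G(1)] y1(1) cdiff_imp_isCont unfolding hol_def by blast
      then obtain e where e: "e > 0" "\<And>y. dist y1 y < e \<Longrightarrow> G (g y) \<noteq> 0"
        using continuous_at_avoid [of y1 "\<lambda>y. G (g y)" 0] nz y1(2) by auto
      have R0: "R (g y) = 0" if y: "y \<in> L \<inter> V0" for y
      proof (rule hol_identity [OF V0(1,2) holV0 [OF polyR] L(1) y1(1) y e(1)])
        fix z assume z: "z \<in> L \<inter> V0" "dist z y1 < e"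
        then show "R (g z) = 0"
          using factor [of "g z"] e(2) [of z] by (auto simp: Y_def dist_commute)
      qed
      \<comment> \<open>On \<open>S\<close> the polynomial \<open>G\<close> vanishes, so
        \<open>R\<close> reduces to its constant term \<open>q k0\<close>. Density spreads its
        vanishing from \<open>S \<inter> U0\<close> to \<open>S\<close>, against the independence of
        \<open>J\<close>.\<close>
      have "q k0 z = 0" if z: "z \<in> S \<inter> U0" for z
      proof -
        have "R z = 0"
          using SY z R0 by (auto simp: Y_def)
        moreover have "R z = q k0 z + (\<Sum>k\<in>{Suc k0..s}. q k z * G z ^ (k - k0))"
          unfolding R_def using k0(1) by (subst sum.atLeast_Suc_atMost) auto
        moreover have "(\<Sum>k\<in>{Suc k0..s}. q k z * G z ^ (k - k0)) = 0"
          using G(2) z by (intro sum.neutral) auto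
        ultimately show ?thesis
          by simp
      qed
      then have "\<forall>z\<in>S. mono_comb box (\<lambda>\<kappa>. c \<kappa> k0) z = 0"
        using dense [OF polyq U0, of p k0] p(1) pU0 unfolding q_def by blast
      then have "finite box \<and> (\<forall>\<kappa>\<in>box. \<forall>i. i \<notin> J \<longrightarrow> \<kappa> i = 0) \<and>
          (\<forall>z\<in>S. mono_comb box (\<lambda>\<kappa>. c \<kappa> k0) z = 0)"
        using finbox by (auto simp: box_def)
      from J [unfolded alg_indep_def, THEN spec, THEN spec, THEN mp, OF this] show False
        using k0(2) by blast
    qed
    then show "Y \<subseteq> alg_closure S \<inter> U0"
      using YU0 by (auto simp: alg_closure_def)
  qed
  have "complex_submanifold (card J) U0 (alg_closure S \<inter> U0)"
    unfolding complex_submanifold_def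
  proof (intro conjI ballI)
    fix x assume "x \<in> alg_closure S \<inter> U0"
    then have "x \<in> U0"
      by simp
    moreover have "F ` (alg_closure S \<inter> U0 \<inter> U0) = L \<inter> V0"
    proof -
      have "F ` Y = L \<inter> V0"
        using Fg V0(3) by (force simp: Y_def)
      moreover have "alg_closure S \<inter> U0 \<inter> U0 = Y"
        using closure_Y by blast
      ultimately show ?thesis
        by (simp only:)
    qed
    ultimately show "\<exists>U V (f :: complex^'m \<Rightarrow> complex^'m) g L. open U \<and> x \<in> U \<and> U \<subseteq> U0 \<and> open V \<and>
        biholomorphism U V f g \<and> vec.subspace L \<and> vec.dim L = card J \<and>
        f ` (alg_closure S \<inter> U0 \<inter> U) = L \<inter> V"
      using U0 V0(1) bihol L by (intro exI [of _ U0] exI [of _ V0] exI [of _ F] exI [of _ g] exI [of _ L]) auto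
  qed simp
  moreover have "p \<in> alg_closure S \<inter> U0"
    using p(1) pU0 subset_alg_closure by blast
  ultimately show thesis
    using that [OF U0 _ _, of p "card J" C] count by blast
qed

end

section \<open>The transcendency index at good points\<close>

lemma submanifold_dim_le:
  fixes X :: "(complex^'m) set"
  assumes "complex_submanifold k U X" "p \<in> X"
  shows "k \<le> CARD('m)"
proof -
  obtain L :: "(complex^'m) set" where "vec.dim L = k"
    using assms unfolding complex_submanifold_def by metis
  then show ?thesis
    using vec.dim_subset_UNIV [of L] by (simp add: vec.dimension_def card_cart_basis)
qed

text \<open>\<open>Sup\<close> on \<open>nat\<close> is meaningful for nonempty bounded sets; the
  given regular point and the ambient dimension provide both conditions.\<close>

lemma analytic_dim_bounds:
  fixes Z :: "(complex^'m) set"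
  assumes "open U" "p \<in> Z \<inter> U" "complex_submanifold k U (Z \<inter> U)"
  shows "k \<le> analytic_dim Z" "analytic_dim Z \<le> CARD('m)"
proof -
  let ?K = "{k. \<exists>p U. open U \<and> p \<in> Z \<inter> U \<and> complex_submanifold k U (Z \<inter> U)}"
  have k: "k \<in> ?K"
    using assms by blast
  have le: "l \<le> CARD('m)" if "l \<in> ?K" for l
    using that submanifold_dim_le by blast
  show "k \<le> analytic_dim Z"
    unfolding analytic_dim_def using k le by (intro cSup_upper) (auto simp: bdd_above_def)
  show "analytic_dim Z \<le> CARD('m)"
    unfolding analytic_dim_def using k le by (intro cSup_least) blast+
qed

lemma parametrised_ball_dense:
  fixes \<Phi> :: "complex^'n \<Rightarrow> complex^'m"
  assumes r: "r > 0" and par: "parametrisation X (ball b r) \<Phi>"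
  shows "locally_zariski_dense (\<Phi> ` ball b r)"
proof
  show "\<Phi> ` ball b r \<noteq> {}"
    using r by auto
  fix F U p x
  assume F: "is_poly UNIV F" and U: "open U" "p \<in> \<Phi> ` ball b r \<inter> U"
    and zero: "\<And>y. y \<in> \<Phi> ` ball b r \<inter> U \<Longrightarrow> F y = 0" and x: "x \<in> \<Phi> ` ball b r"
  obtain u where u: "u \<in> ball b r" "p = \<Phi> u"
    using U(2) by blast
  obtain V where V: "open V" "\<Phi> ` ball b r = X \<inter> V"
    by (rule parametrisationE [OF par])
  have "zero_near (\<Phi> ` ball b r \<inter> U) F p"
    unfolding zero_near_def using zero by (intro exI [of _ 1]) auto
  then have "zero_near X F p"
    unfolding V(2) using zero_near_Int_open [OF U(1), of p] zero_near_Int_open [OF V(1), of p] U(2) V(2)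
    by auto
  then show "F x = 0"
    using zero_near_ball_iff [OF par is_poly_cdiff [OF F] u(1)] u(2) x by blast
qed

text \<open>By the identity theorem, a polynomial that vanishes on \<open>X\<close> near the centre
  vanishes on the whole image of the ball. Shrinking the neighbourhood therefore does not shrink the
  closure, and the least algebraic set exists.\<close>

lemma zariski_closure_germ_eq:
  fixes \<Phi> :: "complex^'n \<Rightarrow> complex^'m"
  assumes r: "r > 0" and par: "parametrisation X (ball b r) \<Phi>"
  shows "zariski_closure_germ X (\<Phi> b) = alg_closure (\<Phi> ` ball b r)"
  unfolding zariski_closure_germ_def
proof (rule Least_equality)
  let ?S = "\<Phi> ` ball b r"
  obtain V where V: "open V" "?S = X \<inter> V"
    by (rule parametrisationE [OF par])
  have poly: "is_poly UNIV F \<longleftrightarrow> F \<in> (\<Union>d. polys_upto d)" for F :: "complex^'m \<Rightarrow> complex"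
    by (simp add: is_poly_def polys_upto_iff)
  have "algebraic_set (alg_closure ?S)"
    unfolding algebraic_set_def
    by (rule exI [of _ "{F. is_poly UNIV F \<and> (\<forall>y\<in>?S. F y = 0)}"]) (use poly in \<open>auto simp: alg_closure_def\<close>)
  moreover have "\<Phi> b \<in> V"
    using V(2) r by (metis Int_iff centre_in_ball imageI)
  moreover have "X \<inter> V \<subseteq> alg_closure ?S"
    unfolding V(2) [symmetric] by (auto simp: alg_closure_def)
  ultimately show "algebraic_set (alg_closure ?S) \<and> (\<exists>U. open U \<and> \<Phi> b \<in> U \<and> X \<inter> U \<subseteq> alg_closure ?S)"
    using V(1) by blast
  fix Z assume "algebraic_set Z \<and> (\<exists>U. open U \<and> \<Phi> b \<in> U \<and> X \<inter> U \<subseteq> Z)"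
  then obtain T U where T: "T \<subseteq> (\<Union>d. polys_upto d)" "Z = {x. \<forall>F\<in>T. F x = 0}"
    and U: "open U" "\<Phi> b \<in> U" "X \<inter> U \<subseteq> Z"
    unfolding algebraic_set_def by blast
  show "alg_closure ?S \<subseteq> Z"
  proof
    fix x assume x: "x \<in> alg_closure ?S"
    have "F x = 0" if F: "F \<in> T" for F
    proof -
      have pF: "is_poly UNIV F"
        using F T(1) poly by blast
      have "zero_near (X \<inter> U) F (\<Phi> b)"
        unfolding zero_near_def using U(3) F T(2) by (intro exI [of _ 1]) auto
      then have "zero_near X F (\<Phi> b)"
        using zero_near_Int_open [OF U(1,2)] by blast
      then have "\<forall>y\<in>?S. F y = 0"
        using zero_near_ball_iff [OF par is_poly_cdiff [OF pF], of b] r by simp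
      then show ?thesis
        using x pF by (auto simp: alg_closure_def)
    qed
    then show "x \<in> Z"
      using T(2) by blast
  qed
qed

text \<open>\<open>C + 1\<close> replaces \<open>C\<close> so that the logarithm stays meaningful
  for \<open>C = 0\<close>; for \<open>t = 0\<close> the left side is
  \<open>-\<infinity>\<close>.\<close>

lemma log_enat_le:
  assumes "t \<le> enat H" "H \<le> C * d ^ k" "2 \<le> d"
  shows "log_enat d t \<le> ereal (real k + log (real d) (real C + 1))"
proof (cases t)
  case (enat n)
  show ?thesis
  proof (cases "n = 0")
    case False
    have "real n \<le> real (C * d ^ k)"
      using assms(1,2) enat by (simp del: of_nat_mult)
    also have "\<dots> \<le> (real C + 1) * real d ^ k"
      by (simp add: algebra_simps)
    finally have "log (real d) (real n) \<le> log (real d) ((real C + 1) * real d ^ k)"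
      using assms(3) False by (subst log_le_cancel_iff) (auto intro: mult_pos_pos)
    also have "\<dots> = real k + log (real d) (real C + 1)"
      using assms(3) by (subst log_mult) (auto simp: log_nat_power)
    finally show ?thesis
      using enat False by (simp add: log_enat_def)
  qed (use enat in \<open>simp add: log_enat_def\<close>)
qed (use assms(1) in simp)

text \<open>Independence near \<open>a\<close> and independence on the image of a parameter ball
  coincide, so the count at the generic point feeds \<open>zero_estimate_le\<close> at
  \<open>a\<close>. In the upper limit the logarithm of \<open>C + 1\<close> to base
  \<open>d\<close> tends to 0, which leaves the exponent \<open>k\<close>.\<close>

theorem transcendency_index_le:
  fixes \<Phi> :: "complex^'n \<Rightarrow> complex^'m"
  assumes par: "local_parametrisation X a b \<Phi>"
    and good: "\<And>B. finite B \<Longrightarrow> a \<notin> bad_set X B"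
  shows "transcendency_index b \<Phi> \<le> ereal (real (analytic_dim (zariski_closure_germ X a)))"
    and "analytic_dim (zariski_closure_germ X a) \<le> CARD('m)"
proof -
  obtain W where W: "b \<in> W" "parametrisation X W \<Phi>" "\<Phi> b = a"
    using par unfolding local_parametrisation_def by blast
  obtain r where r: "r > 0" "parametrisation X (ball b r) \<Phi>"
    by (rule parametrisation_ball_inside [OF W(2,1) openin_subtopology_self])
      (use parametrisation_in [OF W(2,1)] in auto)
  define S where "S = \<Phi> ` ball b r"
  have Z: "zariski_closure_germ X a = alg_closure S"
    using zariski_closure_germ_eq [OF r] W(3) by (simp add: S_def)
  interpret locally_zariski_dense S
    unfolding S_def by (rule parametrised_ball_dense [OF r])
  obtain k C p U where U: "open U" "p \<in> alg_closure S \<inter> U" "complex_submanifold k U (alg_closure S \<inter> U)"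
    and count: "\<forall>d B. 1 \<le> d \<longrightarrow> B \<subseteq> {\<nu>. sum \<nu> UNIV \<le> d} \<longrightarrow>
       (\<forall>c. (\<forall>x\<in>S. mono_comb B c x = 0) \<longrightarrow> (\<forall>\<nu>\<in>B. c \<nu> = 0)) \<longrightarrow> card B \<le> C * d ^ k"
    by (rule regular_point_of_alg_closure)
  show "analytic_dim (zariski_closure_germ X a) \<le> CARD('m)"
    unfolding Z by (rule analytic_dim_bounds(2) [OF U])
  have ze: "zero_estimate b \<Phi> d \<le> enat (C * d ^ k)" if "1 \<le> d" for d
  proof (rule zero_estimate_le [OF par good])
    fix B assume B: "B \<subseteq> {\<nu> :: 'm \<Rightarrow> nat. sum \<nu> UNIV \<le> d}" "indep_near X B a"
    have "\<forall>c. (\<forall>x\<in>S. mono_comb B c x = 0) \<longrightarrow> (\<forall>\<nu>\<in>B. c \<nu> = 0)"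
      using B(2) indep_near_ball_iff [OF r(2), of b B] r(1) W(3) unfolding S_def by simp
    then show "card B \<le> C * d ^ k"
      using count that B(1) by blast
  qed
  have "transcendency_index b \<Phi> \<le> limsup (\<lambda>d. ereal (real k + log (real d) (real C + 1)))"
    unfolding transcendency_index_def
  proof (rule Limsup_mono)
    show "\<forall>\<^sub>F d in sequentially. log_enat d (zero_estimate b \<Phi> d) \<le> ereal (real k + log (real d) (real C + 1))"
      using eventually_ge_at_top [of 2]
    proof eventually_elim
      case (elim d)
      then show ?case
        using ze [of d] by (intro log_enat_le [OF _ order_refl]) auto
    qed
  qed
  also have "\<dots> = ereal (real k)"
  proof (rule lim_imp_Limsup)
    have "((\<lambda>d. inverse (ln (real d))) \<longlongrightarrow> 0) sequentially"
      by (rule tendsto_inverse_0_at_top, rule filterlim_compose [OF ln_at_top filterlim_real_sequentially])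
    then have "((\<lambda>d. ln (real C + 1) * inverse (ln (real d))) \<longlongrightarrow> ln (real C + 1) * 0) sequentially"
      by (intro tendsto_intros)
    then have "((\<lambda>d. real k + log (real d) (real C + 1)) \<longlongrightarrow> real k + 0) sequentially"
      unfolding log_def divide_inverse by (intro tendsto_intros) simp
    then show "((\<lambda>d. ereal (real k + log (real d) (real C + 1))) \<longlongrightarrow> ereal (real k)) sequentially"
      by simp
  qed simp
  also have "\<dots> \<le> ereal (real (analytic_dim (zariski_closure_germ X a)))"
    unfolding Z using analytic_dim_bounds(1) [OF U] by simp
  finally show "transcendency_index b \<Phi> \<le> ereal (real (analytic_dim (zariski_closure_germ X a)))" .
qed

theorem corollary12p6:
  fixes \<Omega> X :: "(complex^'m) set"
  assumes "open \<Omega>"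
    and "complex_submanifold CARD('n::finite) \<Omega> X"
  shows "\<exists>A. (\<exists>\<A>. countable \<A> \<and> (\<forall>T\<in>\<A>. thin_analytic_subset X T) \<and> A = \<Union>\<A>) \<and>
           (\<forall>a \<in> X - A. \<forall>b. \<forall>\<Phi> :: complex^'n \<Rightarrow> complex^'m. local_parametrisation X a b \<Phi> \<longrightarrow>
              transcendency_index b \<Phi> \<le> ereal (real (analytic_dim (zariski_closure_germ X a))) \<and>
              analytic_dim (zariski_closure_germ X a) \<le> CARD('m)) \<and>
           first_category_in (top_of_set X) A \<and>
           lebesgue_null_in TYPE('n) X A"
proof -
  \<comment> \<open>The index type \<open>'m\<close> is finite, so exponents form a countable type
    and its finite subsets a countable family.\<close>
  define \<A> where "\<A> = bad_set X ` {B. finite B}"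
  have countable: "countable \<A>"
    unfolding \<A>_def by (intro countable_image countable_Collect_finite)
  have thin: "thin_analytic_subset X T" if "T \<in> \<A>" for T
    using that thin_bad_set [OF assms(2)] by (auto simp: \<A>_def)
  have "first_category_in (top_of_set X) (\<Union>\<A>)"
    unfolding first_category_in_def using countable thin by (auto simp: thin_analytic_subset_def)
  moreover have "lebesgue_null_in TYPE('n) X (\<Union>\<A>)"
    unfolding lebesgue_null_in_def
  proof (intro conjI allI impI)
    show "\<Union>\<A> \<subseteq> X"
      by (auto simp: \<A>_def bad_set_def)
    fix W and \<Phi> :: "complex^'n \<Rightarrow> complex^'m"
    assume par: "parametrisation X W \<Phi>"
    have "negligible (\<Union>((\<lambda>T. {z \<in> W. \<Phi> z \<in> T}) ` \<A>))"
      using countable negligible_bad_set [OF par] by (intro negligible_countable_Union) (auto simp: \<A>_def)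
    moreover have "{z \<in> W. \<Phi> z \<in> \<Union>\<A>} = \<Union>((\<lambda>T. {z \<in> W. \<Phi> z \<in> T}) ` \<A>)"
      by auto
    ultimately show "{z \<in> W. \<Phi> z \<in> \<Union>\<A>} \<in> null_sets lebesgue"
      by (simp add: negligible_iff_null_sets)
  qed
  moreover have "transcendency_index b \<Phi> \<le> ereal (real (analytic_dim (zariski_closure_germ X a))) \<and>
      analytic_dim (zariski_closure_germ X a) \<le> CARD('m)"
    if "a \<in> X - \<Union>\<A>" "local_parametrisation X a b \<Phi>" for a b and \<Phi> :: "complex^'n \<Rightarrow> complex^'m"
  proof -
    have "a \<notin> bad_set X B" if "finite B" for B
      using \<open>a \<in> X - \<Union>\<A>\<close> that by (auto simp: \<A>_def)
    then show ?thesis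
      using transcendency_index_le [OF that(2)] by blast
  qed
  ultimately show ?thesis
    using countable thin by (intro exI [of _ "\<Union>\<A>"]) blast
qed

end
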